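(* Let $N\ge1$, $a\in(-1,1)$, $U_0\in\mathcal{T}_0$. There exists $C>0$ depending only on $N$, $a$ and $U_0$ such that for every family $\{U_\varepsilon\}_{\varepsilon\in(0,1)}\subset\mathcal{U}_0$ of minimizers of $\mathcal{F}_\varepsilon$ (in $\mathcal{U}_0$), with $u_\varepsilon=U_\varepsilon|_{y=0}$, we have $$\int_0^\infty\int_{\mathbb{R}^{N+1}}|y|^a|\partial_tU_\varepsilon|^2\,dX\,d\tau\le C,$$ and, for every $R\ge\varepsilon$, $$\int_0^R\int_{\mathbb{R}^{N+1}}|y|^a|\nabla U_\varepsilon|^2\,dX\,d\tau+\int_0^R\int_{\mathbb{R}^N\times\{0\}}\Phi(u_\varepsilon)\,dx\,d\tau\le CR.$$
   Context: Points of $\mathbb{R}^{N+1}$ are $X=(x,y)$, $x\in\mathbb{R}^N$, $y\in\mathbb{R}$; $\nabla$ is the gradient in $X$. $\mathbb{B}_R\subset\mathbb{R}^{N+1}$ is the open ball of radius $R$ centred at $0$, $\mathbb{Q}_R^+=\mathbb{B}_R\times(0,R^2)$. Standing assumption: $\beta\in C(\mathbb{R};\mathbb{R})$, $\beta\ge0$, $\operatorname{supp}\beta=[0,1]$, $\int_0^1\beta(v)\,dv=\tfrac12$; $\Phi(u)=2\int_0^u\beta(v)\,dv$. Weighted spaces: $L^{2,a}$ is the $L^2$ space with weight $|y|^a$. $H^{1,a}(\mathbb{R}^{N+1})$ has norm$^2$ $\int|y|^a(U^2+|\nabla U|^2)dX$; $H^{1,a}(\mathbb{Q}_R^+)$ has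 norm$^2$ $\int_{\mathbb{Q}_R^+}|y|^a(U^2+|\partial_tU|^2+|\nabla U|^2)dX\,dt$. $\mathcal{U}=\bigcap_{R>0}H^{1,a}(\mathbb{Q}_R^+)$. Every $U\in\mathcal{U}$ has traces $U|_{y=0}$ and $U|_{t=0}$; every $U_0\in H^{1,a}(\mathbb{R}^{N+1})$ has a trace $u_0=U_0|_{y=0}$ on $\mathbb{R}^N$. Set $\mathcal{T}_0=\{U_0\in H^{1,a}(\mathbb{R}^{N+1}):U_0\not\equiv0,\ \mathcal{L}^N(\{u_0>0\})<+\infty\}$ ($\mathcal{L}^N$ Lebesgue measure) and, for the given $U_0$, $\mathcal{U}_0=\{U\in\mathcal{U}:U|_{t=0}=U_0\}$. The functional $\mathcal{F}_\varepsilon:\mathcal{U}\to[0,+\infty]$ is $$\mathcal{F}_\varepsilon(U)=\int_0^\infty\frac{e^{-t/\varepsilon}}{\varepsilon}\Big\{\int_{\mathbb{R}^{N+1}}|y|^a\big(\varepsilon|\partial_tU|^2+|\nabla U|^2\big)dX+\int_{\mathbb{R}^N\times\{0\}}\Phi(u)\,dx\Big\}dt,\qquad u=U|_{y=0}.$$ *)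

theory Defs
  imports "HOL-Analysis.Analysis"
begin

section \<open>Smooth functions and weak gradients\<close>

fun times_cont_diff :: "nat \<Rightarrow> ('e::euclidean_space \<Rightarrow> real) \<Rightarrow> bool" where
  "times_cont_diff 0 f = continuous_on UNIV f"
| "times_cont_diff (Suc k) f =
    ((\<forall>z. f differentiable (at z)) \<and>
     (\<forall>v. times_cont_diff k (\<lambda>z. frechet_derivative f (at z) v)))"

definition smooth_fun :: "('e::euclidean_space \<Rightarrow> real) \<Rightarrow> bool" where
  "smooth_fun f \<longleftrightarrow> (\<forall>k. times_cont_diff k f)"

definition test_fun :: "'e::euclidean_space set \<Rightarrow> ('e \<Rightarrow> real) \<Rightarrow> bool" where
  "test_fun \<Omega> f \<longleftrightarrow> smooth_fun f \<and> (\<exists>K. compact K \<and> K \<subseteq> \<Omega> \<and> (\<forall>z. z \<notin> K \<longrightarrow> f z = 0))"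

definition classical_grad :: "('e::euclidean_space \<Rightarrow> real) \<Rightarrow> 'e \<Rightarrow> 'e" where
  "classical_grad f z = (\<Sum>b\<in>Basis. frechet_derivative f (at z) b *\<^sub>R b)"

definition locally_integrable ::
    "'e::euclidean_space set \<Rightarrow> ('e \<Rightarrow> 'b::euclidean_space) \<Rightarrow> bool" where
  "locally_integrable \<Omega> f \<longleftrightarrow> (\<forall>K. compact K \<and> K \<subseteq> \<Omega> \<longrightarrow> set_integrable lborel K f)"

definition is_weak_grad ::
    "'e::euclidean_space set \<Rightarrow> ('e \<Rightarrow> real) \<Rightarrow> ('e \<Rightarrow> 'e) \<Rightarrow> bool" where
  "is_weak_grad \<Omega> U G \<longleftrightarrow>
     locally_integrable \<Omega> U \<and> locally_integrable \<Omega> G \<and>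
     (\<forall>f. test_fun \<Omega> f \<longrightarrow> (\<forall>b\<in>Basis.
        (LINT z:\<Omega>|lborel. U z * frechet_derivative f (at z) b)
          = - (LINT z:\<Omega>|lborel. (G z \<bullet> b) * f z)))"

definition weak_grad :: "'e::euclidean_space set \<Rightarrow> ('e \<Rightarrow> real) \<Rightarrow> 'e \<Rightarrow> 'e" where
  "weak_grad \<Omega> U = (SOME G. is_weak_grad \<Omega> U G)"


section \<open>Weighted Sobolev spaces\<close>

text \<open>Functions, not classes modulo null sets, are the elements of all the spaces below. Only the
  values in \<open>\<Omega>\<close> matter. The space \<open>H1 w \<Omega>\<close> is the closure, in the weighted norm with square
  \<open>\<integral> w (U\<^sup>2 + |grad U|\<^sup>2)\<close> over \<open>\<Omega>\<close>, of the functions that are smooth up to the boundary,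
  i.e. restrictions to \<open>\<Omega>\<close> of smooth functions on the whole space; the gradient of the limit is its
  weak gradient. For the weights \<open>|y| powr a\<close> with \<open>-1 < a < 1\<close>, which are in the Muckenhoupt
  class A2, and the domains used here, these are all the functions which are, with
  their weak gradient, in the weighted space L2.\<close>

definition L2w :: "('e::euclidean_space \<Rightarrow> real) \<Rightarrow> 'e set \<Rightarrow> ('e \<Rightarrow> real) set" where
  "L2w w \<Omega> = {U. set_borel_measurable lborel \<Omega> U \<and>
     (\<integral>\<^sup>+z\<in>\<Omega>. ennreal (w z * (U z)\<^sup>2) \<partial>lborel) < \<infinity>}"

definition H1_tendsto ::
    "('e::euclidean_space \<Rightarrow> real) \<Rightarrow> 'e set \<Rightarrow> (nat \<Rightarrow> 'e \<Rightarrow> real) \<Rightarrow> ('e \<Rightarrow> real) \<Rightarrow> bool" where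
  "H1_tendsto w \<Omega> f U \<longleftrightarrow> (\<exists>G. is_weak_grad \<Omega> U G \<and>
     (\<lambda>k. \<integral>\<^sup>+z\<in>\<Omega>. ennreal (w z * ((f k z - U z)\<^sup>2 + (norm (classical_grad (f k) z - G z))\<^sup>2)) \<partial>lborel)
       \<longlonglongrightarrow> 0)"

definition H1 :: "('e::euclidean_space \<Rightarrow> real) \<Rightarrow> 'e set \<Rightarrow> ('e \<Rightarrow> real) set" where
  "H1 w \<Omega> = {U. (\<exists>G. is_weak_grad \<Omega> U G \<and> U \<in> L2w w \<Omega> \<and> (\<lambda>z. norm (G z)) \<in> L2w w \<Omega>) \<and>
                (\<exists>f. (\<forall>k. smooth_fun (f k)) \<and> H1_tendsto w \<Omega> f U)}"


section \<open>The half-space-time setting\<close>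

text \<open>Points of space are \<open>X = (x, y)\<close>, points of space-time are \<open>(X, t)\<close>.\<close>

type_synonym 'n space = "(real ^ 'n) \<times> real"
type_synonym 'n spacetime = "'n space \<times> real"

definition wt :: "real \<Rightarrow> 'n::finite space \<Rightarrow> real" where
  "wt a X = \<bar>snd X\<bar> powr a"

definition wt_time :: "real \<Rightarrow> 'n::finite spacetime \<Rightarrow> real" where
  "wt_time a z = wt a (fst z)"

definition Qplus :: "real \<Rightarrow> 'n::finite spacetime set" where
  "Qplus R = ball 0 R \<times> {0<..<R\<^sup>2}"

definition UU :: "real \<Rightarrow> ('n::finite spacetime \<Rightarrow> real) set" where
  "UU a = (\<Inter>R\<in>{0<..}. H1 (wt_time a) (Qplus R))"

definition time_deriv :: "('n::finite spacetime \<Rightarrow> real) \<Rightarrow> 'n spacetime \<Rightarrow> real" where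
  "time_deriv U z = snd (weak_grad (UNIV \<times> {0<..}) U z)"

definition space_grad :: "('n::finite spacetime \<Rightarrow> real) \<Rightarrow> 'n spacetime \<Rightarrow> 'n space" where
  "space_grad U z = fst (weak_grad (UNIV \<times> {0<..}) U z)"

text \<open>The trace operators are the continuous extensions of the restriction of smooth functions:
  the trace is the \<open>L2\<close>-limit of the restrictions of a sequence of smooth functions that converges
  in the Sobolev norm. It is unique up to null sets.\<close>

definition has_trace_y0 ::
    "real \<Rightarrow> ('n::finite spacetime \<Rightarrow> real) \<Rightarrow> ((real ^ 'n) \<times> real \<Rightarrow> real) \<Rightarrow> bool" where
  "has_trace_y0 a U u \<longleftrightarrow>
     set_borel_measurable lborel (UNIV \<times> {0<..}) u \<and>
     (\<forall>R>0. \<exists>f. (\<forall>k. smooth_fun (f k)) \<and> H1_tendsto (wt_time a) (Qplus R) f U \<and>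
        (\<lambda>k. \<integral>\<^sup>+p\<in>ball 0 R \<times> {0<..<R\<^sup>2}. ennreal ((f k ((fst p, 0), snd p) - u p)\<^sup>2) \<partial>lborel)
          \<longlonglongrightarrow> 0)"

definition trace_y0 ::
    "real \<Rightarrow> ('n::finite spacetime \<Rightarrow> real) \<Rightarrow> (real ^ 'n) \<times> real \<Rightarrow> real" where
  "trace_y0 a U = (SOME u. has_trace_y0 a U u)"

definition has_trace_t0 ::
    "real \<Rightarrow> ('n::finite spacetime \<Rightarrow> real) \<Rightarrow> ('n space \<Rightarrow> real) \<Rightarrow> bool" where
  "has_trace_t0 a U U0 \<longleftrightarrow>
     U0 \<in> borel_measurable lborel \<and>
     (\<forall>R>0. \<exists>f. (\<forall>k. smooth_fun (f k)) \<and> H1_tendsto (wt_time a) (Qplus R) f U \<and>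
        (\<lambda>k. \<integral>\<^sup>+X\<in>ball 0 R. ennreal (wt a X * (f k (X, 0) - U0 X)\<^sup>2) \<partial>lborel) \<longlonglongrightarrow> 0)"

definition has_space_trace_y0 ::
    "real \<Rightarrow> ('n::finite space \<Rightarrow> real) \<Rightarrow> (real ^ 'n \<Rightarrow> real) \<Rightarrow> bool" where
  "has_space_trace_y0 a U0 u0 \<longleftrightarrow>
     u0 \<in> borel_measurable lborel \<and>
     (\<exists>f. (\<forall>k. smooth_fun (f k)) \<and> H1_tendsto (wt a) UNIV f U0 \<and>
        (\<lambda>k. \<integral>\<^sup>+x. ennreal ((f k (x, 0) - u0 x)\<^sup>2) \<partial>lborel) \<longlonglongrightarrow> 0)"

definition space_trace_y0 :: "real \<Rightarrow> ('n::finite space \<Rightarrow> real) \<Rightarrow> real ^ 'n \<Rightarrow> real" where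
  "space_trace_y0 a U0 = (SOME u0. has_space_trace_y0 a U0 u0)"

definition TT0 :: "real \<Rightarrow> ('n::finite space \<Rightarrow> real) set" where
  "TT0 a = {U0 \<in> H1 (wt a) UNIV.
     \<not> (AE X in lborel. U0 X = 0) \<and> emeasure lborel {x. space_trace_y0 a U0 x > 0} < \<infinity>}"

definition UU0 :: "real \<Rightarrow> ('n::finite space \<Rightarrow> real) \<Rightarrow> ('n spacetime \<Rightarrow> real) set" where
  "UU0 a U0 = {U \<in> UU a. has_trace_t0 a U U0}"


section \<open>The functional\<close>

definition admissible_beta :: "(real \<Rightarrow> real) \<Rightarrow> bool" where
  "admissible_beta \<beta> \<longleftrightarrow>
     continuous_on UNIV \<beta> \<and> (\<forall>v. \<beta> v \<ge> 0) \<and>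
     closure {v. \<beta> v \<noteq> 0} = {0..1} \<and> (LBINT v=0..1. \<beta> v) = 1 / 2"

definition Phi :: "(real \<Rightarrow> real) \<Rightarrow> real \<Rightarrow> real" where
  "Phi \<beta> u = 2 * (LBINT v=ereal 0..ereal u. \<beta> v)"

definition FF ::
    "real \<Rightarrow> (real \<Rightarrow> real) \<Rightarrow> real \<Rightarrow> ('n::finite spacetime \<Rightarrow> real) \<Rightarrow> ennreal" where
  "FF a \<beta> \<epsilon> U =
     (\<integral>\<^sup>+t\<in>{0<..}. ennreal (exp (- t / \<epsilon>) / \<epsilon>) *
        ((\<integral>\<^sup>+X. ennreal (wt a X *
             (\<epsilon> * (time_deriv U (X, t))\<^sup>2 + (norm (space_grad U (X, t)))\<^sup>2)) \<partial>lborel)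
         + (\<integral>\<^sup>+x. ennreal (Phi \<beta> (trace_y0 a U (x, t))) \<partial>lborel)) \<partial>lborel)"

definition is_minimizer ::
    "real \<Rightarrow> (real \<Rightarrow> real) \<Rightarrow> ('n::finite space \<Rightarrow> real) \<Rightarrow> real \<Rightarrow> ('n spacetime \<Rightarrow> real) \<Rightarrow> bool" where
  "is_minimizer a \<beta> U0 \<epsilon> U \<longleftrightarrow>
     U \<in> UU0 a U0 \<and> (\<forall>V\<in>UU0 a U0. FF a \<beta> \<epsilon> U \<le> FF a \<beta> \<epsilon> V)"

end

theory Submission
  imports Defs "HOL-Real_Asymp.Real_Asymp"
begin

text \<open>
  Let \<open>D t\<close> be the integral of \<open>|y|\<^sup>a |U\<^sub>t|\<^sup>2\<close> over space at time \<open>t\<close>, and let \<open>E t\<close> be the integral of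
  \<open>|y|\<^sup>a |grad U|\<^sup>2\<close> plus that of \<open>\<Phi>(u)\<close> over the hyperplane. The functional is the integral of
  \<open>(e\<^bsup>-t/\<epsilon>\<^esup>/\<epsilon>) (\<epsilon> D + E)\<close> over positive times. Both estimates come from comparing the minimizer with
  two explicit competitors.

  The first is the initial datum, kept constant in time. As \<open>\<Phi>\<close> takes values in \<open>[0, 1]\<close> and vanishes on
  the negative half-line, its functional is at most
  \<open>c = \<integral> |y|\<^sup>a |grad U\<^sub>0|\<^sup>2 + |{u\<^sub>0 > 0}|\<close>, whatever \<open>\<epsilon>\<close> and \<open>\<beta>\<close> are; hence so is that of the minimizer
  (\<open>FF_const_time_le\<close>).

  The second is the minimizer itself run along another clock, \<open>U(X, \<phi> t)\<close>, where \<open>\<phi>\<close> is the inverse of a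
  diffeomorphism \<open>\<psi>\<close> of the line with \<open>\<psi> 0 = 0\<close> and \<open>\<psi>' \<ge> 1\<close>. It has the same initial trace, and the
  substitution \<open>t = \<psi> s\<close> turns its functional into the integral of
  \<open>(e\<^bsup>-\<psi>/\<epsilon>\<^esup>/\<epsilon>) (\<epsilon> D / \<psi>' + \<psi>' E)\<close> (\<open>FF_reparam\<close>). The family
  \<open>\<psi> s = s + \<delta> (e\<^bsup>(1/\<epsilon> - \<kappa>) s\<^esup> - e\<^bsup>-\<kappa> s\<^esup>)\<close> with \<open>0 \<le> \<kappa> \<le> 1/\<epsilon>\<close> is chosen so that minimality can be used
  without differentiating in \<open>\<delta>\<close>. Put \<open>x = (\<psi> s - s)/\<epsilon>\<close>. The coefficient of \<open>D\<close> decreases, and that of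
  \<open>E\<close> is at most \<open>(e\<^bsup>-s/\<epsilon>\<^esup>/\<epsilon>) (1 + \<delta>/\<epsilon> - \<kappa> \<epsilon> x e\<^bsup>-x\<^esup>)\<close>, because \<open>e\<^bsup>-x\<^esup> (1 + x) \<le> 1\<close>. For \<open>\<kappa> = 0\<close> what
  \<open>D\<close> loses is of order \<open>\<delta>/\<epsilon>\<close> without an exponential weight, and \<open>\<delta> \<rightarrow> 0\<close> gives \<open>\<integral> D \<le> c\<close>
  (\<open>dissipation_bound\<close>). For \<open>\<kappa> = 1/R\<close> the loss of \<open>E\<close> on \<open>(0, R)\<close> bounds
  \<open>\<integral> (1 - e\<^bsup>-s/\<epsilon>\<^esup>) E\<close> there by a multiple of \<open>c R\<close>, while \<open>\<integral> e\<^bsup>-s/\<epsilon>\<^esup> E \<le> c \<epsilon>\<close> is part of the bound on the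
  functional (\<open>energy_bound\<close>).

  The remaining work makes this computation legitimate. The gradient and the traces in the functional
  are arbitrary representatives, so that their values for a competitor are only known through
  uniqueness. For gradients this is the fundamental lemma of the calculus of variations. For traces
  both existence and uniqueness follow from a weighted trace inequality; it holds because
  \<open>|y|\<^sup>a\<close> and \<open>|y|\<^bsup>-a\<^esup>\<close> are both integrable near \<open>0\<close>, that is, because \<open>-1 < a < 1\<close>.
\<close>

section \<open>Calculus of smooth functions\<close>

lemma times_cont_diff_SucI:
  assumes "\<And>z. (f has_derivative D z) (at z)"
    and "\<And>v. times_cont_diff k (\<lambda>z. D z v)"
  shows "times_cont_diff (Suc k) f"
proof -
  have "frechet_derivative f (at z) = D z" for z
    using frechet_derivative_at[OF assms(1)] by simp
  then show ?thesis
    using assms by (auto simp: differentiable_def)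
qed

lemma times_cont_diff_has_derivative:
  "times_cont_diff (Suc k) f \<Longrightarrow> (f has_derivative frechet_derivative f (at z)) (at z)"
  by (simp add: frechet_derivative_works[symmetric])

lemma times_cont_diff_Suc_imp: "times_cont_diff (Suc k) f \<Longrightarrow> times_cont_diff k f"
proof (induction k arbitrary: f)
  case 0
  then show ?case
    by (auto intro!: differentiable_imp_continuous_on simp: differentiable_on_def
        differentiable_at_withinI)
next
  case (Suc k)
  then show ?case by (metis times_cont_diff.simps(2))
qed

lemma times_cont_diff_const [simp]: "times_cont_diff k (\<lambda>z. c)"
proof (induction k arbitrary: c)
  case (Suc k)
  show ?case by (rule times_cont_diff_SucI[where D="\<lambda>z v. 0"]) (auto simp: Suc)
qed simp

lemma times_cont_diff_bounded_linear: "bounded_linear f \<Longrightarrow> times_cont_diff k f"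
proof (cases k)
  case 0
  assume "bounded_linear f"
  then show ?thesis using 0 linear_continuous_on by auto
next
  case (Suc j)
  assume "bounded_linear f"
  then show ?thesis unfolding Suc
    by (intro times_cont_diff_SucI[where D="\<lambda>z. f"]) (auto simp: bounded_linear_imp_has_derivative)
qed

lemma times_cont_diff_add:
  "times_cont_diff k f \<Longrightarrow> times_cont_diff k g \<Longrightarrow> times_cont_diff k (\<lambda>z. f z + g z)"
proof (induction k arbitrary: f g)
  case (Suc k)
  show ?case
    by (rule times_cont_diff_SucI)
      (rule has_derivative_add times_cont_diff_has_derivative Suc.prems Suc.IH
        | use Suc.prems in simp)+
qed (auto intro: continuous_on_add)

lemma times_cont_diff_mult:
  "times_cont_diff k f \<Longrightarrow> times_cont_diff k g \<Longrightarrow> times_cont_diff k (\<lambda>z. f z * g z)"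
proof (induction k arbitrary: f g)
  case (Suc k)
  have "times_cont_diff k (\<lambda>z. frechet_derivative f (at z) v)"
    "times_cont_diff k (\<lambda>z. frechet_derivative g (at z) v)" for v
    using Suc.prems by simp_all
  then show ?case
    by (intro times_cont_diff_SucI[OF has_derivative_mult
          [OF times_cont_diff_has_derivative[OF Suc.prems(1)] times_cont_diff_has_derivative[OF Suc.prems(2)]]]
        times_cont_diff_add Suc.IH times_cont_diff_Suc_imp[OF Suc.prems(1)]
        times_cont_diff_Suc_imp[OF Suc.prems(2)])
qed (auto intro: continuous_on_mult)

lemma times_cont_diff_sum:
  "(\<And>i. i \<in> I \<Longrightarrow> times_cont_diff k (f i)) \<Longrightarrow> times_cont_diff k (\<lambda>z. \<Sum>i\<in>I. f i z)"
  by (induction I rule: infinite_finite_induct) (auto intro: times_cont_diff_add)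

lemma times_cont_diff_prod:
  "(\<And>i. i \<in> I \<Longrightarrow> times_cont_diff k (f i)) \<Longrightarrow> times_cont_diff k (\<lambda>z. \<Prod>i\<in>I. f i z)"
  by (induction I rule: infinite_finite_induct) (auto intro: times_cont_diff_mult)

text \<open>The chain rule expresses the derivative of \<open>f \<circ> T\<close> as a sum of products of a partial
  derivative of \<open>f\<close>, composed with \<open>T\<close>, and a derivative of a component of \<open>T\<close>; so the induction
  on the order of differentiability needs only sums and products.\<close>

lemma times_cont_diff_compose:
  fixes T :: "'a::euclidean_space \<Rightarrow> 'b::euclidean_space"
  assumes "\<And>b. b \<in> Basis \<Longrightarrow> times_cont_diff k (\<lambda>z. T z \<bullet> b)" and "times_cont_diff k f"
  shows "times_cont_diff k (\<lambda>z. f (T z))"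
  using assms
proof (induction k arbitrary: f)
  case 0
  then have "continuous_on UNIV T"
    by (simp add: continuous_on_componentwise[where f=T])
  then show ?case
    using 0 by (auto intro: continuous_on_compose2[where t=UNIV])
next
  case (Suc k)
  define DT where "DT z v = (\<Sum>b\<in>Basis. frechet_derivative (\<lambda>z. T z \<bullet> b) (at z) v *\<^sub>R b)" for z v
  have DT: "(T has_derivative DT z) (at z)" for z
    by (subst has_derivative_componentwise_within)
      (use times_cont_diff_has_derivative[OF Suc.prems(1)] in \<open>auto simp: DT_def\<close>)
  have Df: "(f has_derivative frechet_derivative f (at z)) (at z)" for z
    using times_cont_diff_has_derivative[OF Suc.prems(2)] .
  have eq: "frechet_derivative f (at (T z)) (DT z v) =
     (\<Sum>b\<in>Basis. frechet_derivative (\<lambda>z. T z \<bullet> b) (at z) v * frechet_derivative f (at (T z)) b)" for z v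
    unfolding DT_def
    by (simp add: linear_sum[OF has_derivative_linear[OF Df]] linear_scale[OF has_derivative_linear[OF Df]])
  show ?case
  proof (rule times_cont_diff_SucI)
    show "((\<lambda>z. f (T z)) has_derivative (\<lambda>v. frechet_derivative f (at (T z)) (DT z v))) (at z)" for z
      using diff_chain_at[OF DT Df] by (simp add: o_def)
    have "times_cont_diff k (\<lambda>z. frechet_derivative (\<lambda>z. T z \<bullet> b) (at z) v)"
      if "b \<in> Basis" for b v
      using Suc.prems(1)[OF that] by simp
    moreover have "times_cont_diff k (\<lambda>z. frechet_derivative f (at (T z)) b)" for b
      by (rule Suc.IH[where f="\<lambda>z. frechet_derivative f (at z) b"])
        (use Suc.prems times_cont_diff_Suc_imp in \<open>auto simp del: times_cont_diff.simps\<close>, use Suc.prems in auto)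
    ultimately show "times_cont_diff k (\<lambda>z. frechet_derivative f (at (T z)) (DT z v))" for v
      unfolding eq by (intro times_cont_diff_sum times_cont_diff_mult)
  qed
qed

lemma smooth_funI: "(\<And>k. times_cont_diff k f) \<Longrightarrow> smooth_fun f"
  by (simp add: smooth_fun_def)

lemma smooth_fun_times_cont_diff: "smooth_fun f \<Longrightarrow> times_cont_diff k f"
  by (simp add: smooth_fun_def)

lemma smooth_fun_const: "smooth_fun (\<lambda>z. c)"
  by (simp add: smooth_fun_def)

lemma smooth_fun_add: "smooth_fun f \<Longrightarrow> smooth_fun g \<Longrightarrow> smooth_fun (\<lambda>z. f z + g z)"
  by (simp add: smooth_fun_def times_cont_diff_add)

lemma smooth_fun_mult: "smooth_fun f \<Longrightarrow> smooth_fun g \<Longrightarrow> smooth_fun (\<lambda>z. f z * g z)"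
  by (simp add: smooth_fun_def times_cont_diff_mult)

lemma smooth_fun_diff: "smooth_fun f \<Longrightarrow> smooth_fun g \<Longrightarrow> smooth_fun (\<lambda>z. f z - g z)"
  using smooth_fun_add[of f "\<lambda>z. (-1) * g z"] smooth_fun_mult[OF smooth_fun_const, of g "-1"]
  by simp

lemma smooth_fun_prod: "(\<And>i. i \<in> I \<Longrightarrow> smooth_fun (f i)) \<Longrightarrow> smooth_fun (\<lambda>z. \<Prod>i\<in>I. f i z)"
  by (simp add: smooth_fun_def times_cont_diff_prod)

lemma smooth_fun_compose:
  fixes T :: "'a::euclidean_space \<Rightarrow> 'b::euclidean_space"
  assumes "\<And>b. b \<in> Basis \<Longrightarrow> smooth_fun (\<lambda>z. T z \<bullet> b)" and "smooth_fun f"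
  shows "smooth_fun (\<lambda>z. f (T z))"
  using assms times_cont_diff_compose[of _ T f] by (simp add: smooth_fun_def)

lemma smooth_fun_bounded_linear: "bounded_linear f \<Longrightarrow> smooth_fun f"
  by (simp add: smooth_fun_def times_cont_diff_bounded_linear)

lemma smooth_fun_real_compose:
  fixes h :: "'a::euclidean_space \<Rightarrow> real" and f :: "real \<Rightarrow> real"
  assumes "smooth_fun h" "smooth_fun f"
  shows "smooth_fun (\<lambda>z. f (h z))"
  by (rule smooth_fun_compose) (use assms in auto)

lemma smooth_fun_has_derivative:
  "smooth_fun f \<Longrightarrow> (f has_derivative frechet_derivative f (at z)) (at z)"
  using times_cont_diff_has_derivative smooth_fun_times_cont_diff by blast

lemma smooth_fun_frechet: "smooth_fun f \<Longrightarrow> smooth_fun (\<lambda>z. frechet_derivative f (at z) v)"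
  unfolding smooth_fun_def by (metis times_cont_diff.simps(2))

lemma smooth_fun_continuous: "smooth_fun f \<Longrightarrow> continuous_on S f"
  using smooth_fun_times_cont_diff[of f 0] continuous_on_subset by auto

lemma smooth_fun_measurable [measurable_dest]: "smooth_fun f \<Longrightarrow> f \<in> borel_measurable borel"
  by (simp add: borel_measurable_continuous_onI smooth_fun_continuous)

lemma frechet_real: "(f has_real_derivative d) (at x) \<Longrightarrow> frechet_derivative f (at x) = (\<lambda>v. d * v)"
  using frechet_derivative_at[of f "(*) d" x] by (simp add: has_field_derivative_def)

lemma times_cont_diff_real_SucI:
  fixes f :: "real \<Rightarrow> real"
  assumes "\<And>x. (f has_real_derivative f' x) (at x)" and "times_cont_diff k f'"
  shows "times_cont_diff (Suc k) f"
  by (rule times_cont_diff_SucI[where D="\<lambda>z v. f' z * v"])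
    (use assms in \<open>auto simp: has_field_derivative_def intro: times_cont_diff_mult\<close>)

lemma continuous_on_real_deriv:
  fixes f :: "real \<Rightarrow> real"
  assumes "\<And>x. (f has_real_derivative f' x) (at x)"
  shows "continuous_on UNIV f"
  by (rule DERIV_continuous_on) (use assms has_field_derivative_at_within in blast)

lemma smooth_fun_real_deriv:
  fixes f :: "real \<Rightarrow> real"
  assumes "smooth_fun f" and "\<And>x. (f has_real_derivative f' x) (at x)"
  shows "smooth_fun f'"
proof -
  have "f' x = frechet_derivative f (at x) 1" for x
    using frechet_real[OF assms(2)] by simp
  then show ?thesis
    using smooth_fun_frechet[OF assms(1), of 1] by presburger
qed

lemma smooth_fun_exp: "smooth_fun (\<lambda>x::real. exp (c * x))"
proof (rule smooth_funI)
  show "times_cont_diff k (\<lambda>x::real. exp (c * x))" for k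
  proof (induction k)
    case (Suc k)
    show ?case
      by (rule times_cont_diff_real_SucI[where f'="\<lambda>x. c * exp (c * x)"])
        (auto intro!: derivative_eq_intros times_cont_diff_mult Suc)
  qed (auto intro!: continuous_intros)
qed

text \<open>The derivative \<open>- p' (1 / p)\<^sup>2\<close> is a polynomial in \<open>p'\<close> and the function itself, so each order of
  differentiability of \<open>1 / p\<close> yields the next one.\<close>

lemma smooth_fun_inverse:
  fixes p :: "real \<Rightarrow> real"
  assumes "smooth_fun p" and "\<And>x. p x > 0"
  shows "smooth_fun (\<lambda>x. 1 / p x)"
proof (rule smooth_funI)
  define p' where "p' x = frechet_derivative p (at x) 1" for x
  have p': "(p has_real_derivative p' x) (at x)" for x
    using smooth_fun_has_derivative[OF assms(1), of x] linear_times[of _]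
    unfolding has_field_derivative_def p'_def
    by (metis (no_types, lifting) ext has_derivative_linear linear_scale mult.commute mult.right_neutral real_scaleR_def)
  have sp': "smooth_fun (\<lambda>x. - p' x)"
    using smooth_fun_mult[OF smooth_fun_const smooth_fun_real_deriv[OF assms(1) p'], of "-1"] by simp
  have p0: "p x \<noteq> 0" for x using assms(2)[of x] by simp
  show "times_cont_diff k (\<lambda>x. 1 / p x)" for k
  proof (induction k)
    case 0
    show ?case
      using smooth_fun_continuous[OF assms(1), of UNIV] p0 by (auto intro!: continuous_intros)
  next
    case (Suc k)
    show ?case
    proof (rule times_cont_diff_real_SucI[where f'="\<lambda>x. - p' x * (1 / p x * (1 / p x))"])
      show "((\<lambda>x. 1 / p x) has_real_derivative - p' x * (1 / p x * (1 / p x))) (at x)" for x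
        using p0 p' by (auto intro!: derivative_eq_intros simp: field_simps)
      show "times_cont_diff k (\<lambda>x. - p' x * (1 / p x * (1 / p x)))"
        by (intro times_cont_diff_mult Suc smooth_fun_times_cont_diff[OF sp'])
    qed
  qed
qed

text \<open>A solution of an autonomous differential equation with smooth right-hand side is smooth:
  each derivative gained on the right is passed on to the left.\<close>

lemma smooth_fun_autonomous_ODE:
  fixes \<phi> :: "real \<Rightarrow> real"
  assumes "\<And>t. (\<phi> has_real_derivative g (\<phi> t)) (at t)" and "smooth_fun g"
  shows "smooth_fun \<phi>"
proof (rule smooth_funI)
  show "times_cont_diff k \<phi>" for k
  proof (induction k)
    case 0
    show ?case using continuous_on_real_deriv[OF assms(1)] by simp
  next
    case (Suc k)
    show ?case
      by (rule times_cont_diff_real_SucI[OF assms(1)], rule times_cont_diff_compose)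
        (use Suc smooth_fun_times_cont_diff[OF assms(2)] in auto)
  qed
qed


section \<open>Bump functions and the fundamental lemma of the calculus of variations\<close>

text \<open>The functions \<open>x\<^sup>-\<^sup>n exp (- 1 / x)\<close>, extended by zero to the negative half-line. The
  exponents \<open>n\<close> are needed because the derivative of one of them is a combination of two others.\<close>

definition flat_exp :: "nat \<Rightarrow> real \<Rightarrow> real" where
  "flat_exp n x = (if x > 0 then exp (- 1 / x) / x ^ n else 0)"

lemma flat_exp_limit: "((\<lambda>x. flat_exp n x) \<longlongrightarrow> 0) (at 0)"
proof -
  have "((\<lambda>x::real. exp (- 1 / x) / x ^ n) \<longlongrightarrow> 0) (at_right 0)"
    by real_asymp
  then have "((\<lambda>x. flat_exp n x) \<longlongrightarrow> 0) (at_right 0)"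
    by (rule tendsto_cong[THEN iffD1, rotated])
      (auto simp: flat_exp_def eventually_at_filter)
  moreover have "((\<lambda>x. flat_exp n x) \<longlongrightarrow> 0) (at_left 0)"
    by (rule tendsto_eventually) (auto simp: flat_exp_def eventually_at_filter)
  ultimately show ?thesis by (simp add: filterlim_split_at)
qed

lemma flat_exp_deriv:
  "(flat_exp n has_real_derivative flat_exp (Suc (Suc n)) x - n * flat_exp (Suc n) x) (at x)"
proof -
  consider "x > 0" | "x < 0" | "x = 0" by linarith
  then show ?thesis
  proof cases
    case 1
    have "((\<lambda>x. exp (- 1 / x) / x ^ n) has_real_derivative
        flat_exp (Suc (Suc n)) x - n * flat_exp (Suc n) x) (at x)"
    proof (cases n)
      case (Suc m)
      have "m = 0 \<or> x ^ m = x * x ^ (m - Suc 0)"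
        by (cases m) auto
      then show ?thesis
        using 1 Suc
        by (auto intro!: derivative_eq_intros simp: flat_exp_def field_simps power2_eq_square)
    qed (use 1 in \<open>auto intro!: derivative_eq_intros simp: flat_exp_def field_simps power2_eq_square\<close>)
    then show ?thesis
      by (rule has_field_derivative_transform_within_open[where S="{0<..}"])
        (use 1 in \<open>auto simp: flat_exp_def\<close>)
  next
    case 2
    have "((\<lambda>x. 0) has_real_derivative 0) (at x)" by simp
    then have "(flat_exp n has_real_derivative 0) (at x)"
      by (rule has_field_derivative_transform_within_open[where S="{..<0}"])
        (use 2 in \<open>auto simp: flat_exp_def\<close>)
    then show ?thesis using 2 by (simp add: flat_exp_def)
  next
    case 3
    \<comment> \<open>The difference quotient of \<open>flat_exp n\<close> at the origin is \<open>flat_exp (Suc n)\<close>.\<close>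
    have "((\<lambda>h. flat_exp (Suc n) h) \<longlongrightarrow> 0) (at 0)" by (rule flat_exp_limit)
    then have "((\<lambda>h. (flat_exp n (0 + h) - flat_exp n 0) / h) \<longlongrightarrow> 0) (at 0)"
      by (rule tendsto_cong[THEN iffD1, rotated])
        (auto simp: flat_exp_def eventually_at_filter)
    then show ?thesis using 3 by (simp add: DERIV_def flat_exp_def)
  qed
qed

lemma smooth_fun_flat_exp: "smooth_fun (flat_exp n)"
proof (rule smooth_funI)
  show "times_cont_diff k (flat_exp n)" for k
  proof (induction k arbitrary: n)
    case 0
    show ?case using continuous_on_real_deriv[OF flat_exp_deriv] by simp
  next
    case (Suc k)
    have "times_cont_diff k (\<lambda>x. flat_exp (Suc (Suc n)) x + (- real n) * flat_exp (Suc n) x)"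
      by (intro times_cont_diff_add times_cont_diff_mult Suc times_cont_diff_const)
    then show ?case
      by (intro times_cont_diff_real_SucI[OF flat_exp_deriv]) simp
  qed
qed

text \<open>As \<open>n\<close> grows, each factor tends to one on its side of a face of the box and stays zero on the other
  side: a smooth approximation of the indicator of the box from below.\<close>

definition box_bump :: "nat \<Rightarrow> 'e::euclidean_space \<Rightarrow> 'e \<Rightarrow> 'e \<Rightarrow> real" where
  "box_bump n a b z =
     (\<Prod>i\<in>Basis. flat_exp 0 (n * (z \<bullet> i - a \<bullet> i)) * flat_exp 0 (n * (b \<bullet> i - z \<bullet> i)))"

lemma flat_exp_bounds: "0 \<le> flat_exp 0 x" "flat_exp 0 x \<le> 1"
  by (auto simp: flat_exp_def)

lemma box_bump_bounds: "0 \<le> box_bump n a b z" "box_bump n a b z \<le> 1"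
  unfolding box_bump_def
  by (auto intro!: prod_nonneg prod_le_1 mult_le_one simp: flat_exp_bounds)

lemma box_bump_outside: "z \<notin> box a b \<Longrightarrow> box_bump n a b z = 0"
  unfolding box_bump_def mem_box
  by (auto simp: flat_exp_def zero_less_mult_iff intro!: prod_zero)

lemma box_bump_tendsto: "(\<lambda>n. box_bump n a b z) \<longlonglongrightarrow> indicator (box a b) z"
proof (cases "z \<in> box a b")
  case True
  have *: "(\<lambda>n. flat_exp 0 (real n * c)) \<longlonglongrightarrow> 1" if "c > 0" for c
  proof -
    have "(\<lambda>n. exp (- 1 / (real n * c))) \<longlonglongrightarrow> 1" using that by real_asymp
    then show ?thesis
      by (rule tendsto_cong[THEN iffD1, rotated])
        (use that in \<open>auto simp: flat_exp_def eventually_at_top_linorder intro!: exI[of _ 1]\<close>)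
  qed
  have "(\<lambda>n. box_bump n a b z) \<longlonglongrightarrow> (\<Prod>i\<in>(Basis::'a set). 1 * 1)"
    unfolding box_bump_def by (intro tendsto_prod tendsto_mult *) (use True in \<open>auto simp: mem_box\<close>)
  then show ?thesis using True by simp
next
  case False
  then show ?thesis by (simp add: box_bump_outside)
qed

lemma smooth_fun_box_bump: "smooth_fun (box_bump n a b)"
proof -
  have lin: "smooth_fun (\<lambda>z::'a. c * (z \<bullet> i))" for c i
    by (intro smooth_fun_mult smooth_fun_const smooth_fun_bounded_linear bounded_linear_inner_left)
  have "smooth_fun (\<lambda>z::'a. flat_exp 0 (c * (z \<bullet> i - d)))" for c d i
  proof -
    have "smooth_fun (\<lambda>z::'a. c * (z \<bullet> i) - c * d)"
      by (intro smooth_fun_diff lin smooth_fun_const)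
    from smooth_fun_real_compose[OF this smooth_fun_flat_exp] show ?thesis
      by (simp add: algebra_simps)
  qed
  moreover have "smooth_fun (\<lambda>z::'a. flat_exp 0 (c * (d - z \<bullet> i)))" for c d i
  proof -
    have "smooth_fun (\<lambda>z::'a. c * d - c * (z \<bullet> i))"
      by (intro smooth_fun_diff lin smooth_fun_const)
    from smooth_fun_real_compose[OF this smooth_fun_flat_exp] show ?thesis
      by (simp add: algebra_simps)
  qed
  ultimately show ?thesis
    unfolding box_bump_def[abs_def] by (intro smooth_fun_prod smooth_fun_mult)
qed

lemma test_fun_box_bump: "cbox a b \<subseteq> \<Omega> \<Longrightarrow> test_fun \<Omega> (box_bump n a b)"
  unfolding test_fun_def using smooth_fun_box_bump box_bump_outside
  by (metis box_subset_cbox compact_cbox subsetD)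

text \<open>The restrictions to an exhausting sequence of compact sets are measurable and converge pointwise.\<close>

lemma locally_integrable_measurable:
  fixes f :: "'e::euclidean_space \<Rightarrow> 'b::euclidean_space"
  assumes "locally_integrable \<Omega> f" "open \<Omega>"
  shows "(\<lambda>z. indicator \<Omega> z *\<^sub>R f z) \<in> borel_measurable lborel"
proof -
  obtain C where C: "\<And>n::nat. compact (C n)" "\<And>n. C n \<subseteq> \<Omega>" "\<And>n. C n \<subseteq> interior (C (Suc n))"
    "\<Union>(range C) = \<Omega>"
    using open_Union_compact_subsets[OF assms(2)] by metis
  have inc: "incseq C"
    using order_trans[OF C(3) interior_subset] by (rule incseq_SucI)
  show ?thesis
  proof (rule borel_measurable_LIMSEQ_metric)
    show "(\<lambda>z. indicator (C n) z *\<^sub>R f z) \<in> borel_measurable lborel" for n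
      using assms(1) C(1,2) borel_measurable_integrable
      unfolding locally_integrable_def set_integrable_def by metis
    show "(\<lambda>n. indicat_real (C n) z *\<^sub>R f z) \<longlonglongrightarrow> indicat_real \<Omega> z *\<^sub>R f z" for z
    proof -
      have "(\<lambda>n. indicator (C n) z :: real) \<longlonglongrightarrow> indicator (\<Union>n. C n) z"
        by (rule LIMSEQ_indicator_incseq[OF inc])
      then show ?thesis using C(4) by (intro tendsto_scaleR tendsto_const) simp
    qed
  qed
qed

lemma test_fun_zero_outside:
  assumes "test_fun \<Omega> f"
  obtains K where "compact K" "K \<subseteq> \<Omega>" "\<And>z. z \<notin> K \<Longrightarrow> f z = 0"
    "\<And>z v. z \<notin> K \<Longrightarrow> frechet_derivative f (at z) v = 0"
proof -
  obtain K where K: "compact K" "K \<subseteq> \<Omega>" "\<And>z. z \<notin> K \<Longrightarrow> f z = 0"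
    using assms unfolding test_fun_def by blast
  have "frechet_derivative f (at z) v = 0" if "z \<notin> K" for z v
  proof -
    have "((\<lambda>_. 0) has_derivative (\<lambda>_. 0)) (at z)" by simp
    then have "(f has_derivative (\<lambda>_. 0)) (at z)"
      by (rule has_derivative_transform_within_open[where s="- K"])
        (use that K in \<open>auto simp: compact_imp_closed open_Compl\<close>)
    from frechet_derivative_at[OF this] show ?thesis by metis
  qed
  with K that show ?thesis by blast
qed

lemma test_fun_smooth: "test_fun \<Omega> f \<Longrightarrow> smooth_fun f"
  by (simp add: test_fun_def)

lemma set_integral_outside_zero:
  fixes h :: "'e \<Rightarrow> 'b::{banach, second_countable_topology}"
  assumes "\<And>z. z \<notin> K \<Longrightarrow> h z = 0" "K \<subseteq> A"
  shows "(LINT z:A|M. h z) = (LINT z|M. h z)"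
  unfolding set_lebesgue_integral_def
  by (rule Bochner_Integration.integral_cong) (use assms in \<open>auto simp: indicator_def\<close>)

lemma test_fun_mult_integrable:
  assumes H: "locally_integrable \<Omega> H" and f: "test_fun \<Omega> f"
  shows "integrable lborel (\<lambda>z. H z * f z)" "(LINT z:\<Omega>|lborel. H z * f z) = (LINT z|lborel. H z * f z)"
proof -
  obtain K where K: "compact K" "K \<subseteq> \<Omega>" "\<And>z. z \<notin> K \<Longrightarrow> f z = 0"
    using test_fun_zero_outside[OF f] by metis
  have cont: "continuous_on K f" using smooth_fun_continuous[OF test_fun_smooth[OF f]] .
  then obtain B where B: "\<And>z. z \<in> K \<Longrightarrow> norm (f z) \<le> B"
    using compact_continuous_image[OF cont K(1)] compact_imp_bounded bounded_iff
    by (metis imageI)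
  have int: "set_integrable lborel K H" using H K unfolding locally_integrable_def by blast
  have *: "H z * f z = (indicator K z *\<^sub>R H z) * f z" for z
    using K(3)[of z] by (auto simp: indicator_def)
  show "integrable lborel (\<lambda>z. H z * f z)"
    unfolding *
  proof (rule Bochner_Integration.integrable_bound)
    show "integrable lborel (\<lambda>z. B * (indicator K z *\<^sub>R H z))"
      using int unfolding set_integrable_def by simp
    show "(\<lambda>z. (indicat_real K z *\<^sub>R H z) * f z) \<in> borel_measurable lborel"
      using borel_measurable_integrable[OF int[unfolded set_integrable_def]]
        smooth_fun_measurable[OF test_fun_smooth[OF f]]
      by (intro borel_measurable_times) auto
    show "AE z in lborel. norm ((indicat_real K z *\<^sub>R H z) * f z) \<le> norm (B * (indicat_real K z *\<^sub>R H z))"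
    proof (rule AE_I2)
      show "norm ((indicat_real K z *\<^sub>R H z) * f z) \<le> norm (B * (indicat_real K z *\<^sub>R H z))" for z
        using B[of z] by (cases "z \<in> K")
          (auto simp: indicator_def abs_mult mult.commute[of _ "\<bar>f z\<bar>"] intro!: mult_right_mono)
    qed
  qed
  show "(LINT z:\<Omega>|lborel. H z * f z) = (LINT z|lborel. H z * f z)"
    by (rule set_integral_outside_zero[where K=K]) (use K in auto)
qed

text \<open>The Borel sets over which the integral vanishes form a Dynkin system, which contains the boxes, an
  intersection-stable generator.\<close>

lemma integral_box_zero_imp_AE_zero:
  fixes g :: "'e::euclidean_space \<Rightarrow> real"
  assumes int: "integrable lborel g" and box0: "\<And>l u. (LINT z:box l u|lborel. g z) = 0"
    and tot: "(LINT z|lborel. g z) = 0"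
  shows "AE z in lborel. g z = 0"
proof (rule sigma_finite_measure.density_zero[OF sigma_finite_lborel int])
  have setint: "set_integrable lborel A g" if "A \<in> sets borel" for A
    using int integrable_mult_indicator[of A lborel g] that unfolding set_integrable_def by simp
  fix A :: "'e set" assume A: "A \<in> sets lborel"
  have "Int_stable (range (\<lambda>(a, b). box a b :: 'e set))"
    by (auto simp: Int_stable_def box_Int_box)
  moreover have "range (\<lambda>(a, b). box a b :: 'e set) \<subseteq> Pow UNIV" by simp
  moreover from A have "A \<in> sigma_sets UNIV (range (\<lambda>(a, b). box a b :: 'e set))"
    by (simp add: borel_eq_box)
  ultimately show "(LINT z:A|lborel. g z) = 0"
  proof (induction rule: sigma_sets_induct_disjoint)
    case (basic A)
    then show ?case using box0 by auto
  next
    case empty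
    then show ?case by (simp add: set_lebesgue_integral_def)
  next
    case (compl A)
    then have A: "A \<in> sets borel" by (simp add: borel_eq_box)
    have "(LINT z:UNIV - A|lborel. g z) + (LINT z:A|lborel. g z) = (LINT z:(UNIV - A) \<union> A|lborel. g z)"
      by (rule set_integral_Un[symmetric]) (use A setint in auto)
    then show ?case using compl(2) tot by (simp add: Un_commute set_lebesgue_integral_def)
  next
    case (union A)
    then have A: "A i \<in> sets borel" for i by (auto simp: borel_eq_box)
    have "(LINT z:(\<Union>i. A i)|lborel. g z) = (\<Sum>i. (LINT z:(A i)|lborel. g z))"
      by (rule lebesgue_integral_countable_add)
        (use A union(1) setint in \<open>auto simp: disjoint_family_on_def\<close>)
    then show ?case using union by simp
  qed
qed

lemma AE_cbox_imp_box: "AE z in lborel. z \<in> cbox a b \<longrightarrow> z \<in> box a b"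
proof -
  have "emeasure lborel (cbox a b - box a b) = emeasure lborel (cbox a b) - emeasure lborel (box a b)"
    by (rule emeasure_Diff) (auto simp: emeasure_lborel_box_eq box_subset_cbox)
  also have "\<dots> = 0"
    by (simp add: emeasure_lborel_box_eq emeasure_lborel_cbox_eq)
  finally have "cbox a b - box a b \<in> null_sets lborel"
    by (simp add: null_sets_def)
  then show ?thesis using AE_not_in by fastforce
qed

text \<open>Testing with \<open>box_bump n a b\<close> and letting \<open>n\<close> tend to infinity shows that the integral over
  every box with closure in \<open>\<Omega>\<close> vanishes; such closed boxes, countably many, cover \<open>\<Omega>\<close>.\<close>

theorem fundamental_lemma_variations:
  fixes H :: "'e::euclidean_space \<Rightarrow> real"
  assumes op: "open \<Omega>" and H: "locally_integrable \<Omega> H"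
    and test: "\<And>f. test_fun \<Omega> f \<Longrightarrow> (LINT z:\<Omega>|lborel. H z * f z) = 0"
  shows "AE z in lborel. z \<in> \<Omega> \<longrightarrow> H z = 0"
proof -
  have box0: "(LINT z:box a b|lborel. H z) = 0" if sub: "cbox a b \<subseteq> \<Omega>" for a b
  proof -
    have int: "set_integrable lborel (cbox a b) H"
      using H sub compact_cbox unfolding locally_integrable_def by blast
    have "(\<lambda>n. LINT z|lborel. (indicator (cbox a b) z *\<^sub>R H z) * box_bump n a b z) \<longlonglongrightarrow>
        (LINT z|lborel. (indicator (cbox a b) z *\<^sub>R H z) * indicator (box a b) z)"
    proof (rule integral_dominated_convergence)
      show "integrable lborel (\<lambda>z. norm (indicat_real (cbox a b) z *\<^sub>R H z))"
        using int unfolding set_integrable_def by (rule integrable_norm)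
      show "AE z in lborel. (\<lambda>n. (indicat_real (cbox a b) z *\<^sub>R H z) * box_bump n a b z) \<longlonglongrightarrow>
          (indicator (cbox a b) z *\<^sub>R H z) * indicator (box a b) z"
        by (intro AE_I2 tendsto_mult tendsto_const box_bump_tendsto)
      show "AE z in lborel. norm ((indicat_real (cbox a b) z *\<^sub>R H z) * box_bump n a b z)
          \<le> norm (indicat_real (cbox a b) z *\<^sub>R H z)" for n
        using box_bump_bounds[of n a b]
        by (intro AE_I2) (auto simp: abs_mult intro!: mult_left_le)
    qed (use borel_measurable_integrable[OF int[unfolded set_integrable_def]]
          smooth_fun_measurable[OF smooth_fun_box_bump] in \<open>auto intro!: borel_measurable_times\<close>)
    moreover have "(LINT z|lborel. (indicator (cbox a b) z *\<^sub>R H z) * box_bump n a b z) = 0" for n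
    proof -
      have eq: "(\<lambda>z. (indicator (cbox a b) z *\<^sub>R H z) * box_bump n a b z) = (\<lambda>z. H z * box_bump n a b z)"
        using box_bump_outside[of _ a b n] box_subset_cbox[of a b] by (fastforce simp: indicator_def)
      show ?thesis
        unfolding eq
        using test[OF test_fun_box_bump[OF sub]] test_fun_mult_integrable(2)[OF H test_fun_box_bump[OF sub]]
        by simp
    qed
    moreover have "(\<lambda>z. (indicator (cbox a b) z *\<^sub>R H z) * indicator (box a b) z)
        = (\<lambda>z. indicator (box a b) z *\<^sub>R H z)"
      using box_subset_cbox[of a b] by (fastforce simp: indicator_def)
    ultimately show ?thesis
      by (simp only: LIMSEQ_const_iff set_lebesgue_integral_def)
  qed
  have cbox0: "AE z in lborel. z \<in> cbox c d \<longrightarrow> H z = 0" if sub: "cbox c d \<subseteq> \<Omega>" for c d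
  proof -
    define g where "g = (\<lambda>z. indicator (box c d) z *\<^sub>R H z)"
    have "AE z in lborel. g z = 0"
    proof (rule integral_box_zero_imp_AE_zero)
      have "set_integrable lborel (cbox c d) H"
        using H sub compact_cbox unfolding locally_integrable_def by blast
      then show "integrable lborel g"
        unfolding g_def set_integrable_def[symmetric]
        by (rule set_integrable_subset) (auto simp: box_subset_cbox)
      show "(LINT z|lborel. g z) = 0"
        using box0[OF sub] by (simp add: g_def set_lebesgue_integral_def)
      fix l u
      define a b where "a = (\<Sum>i\<in>Basis. max (l \<bullet> i) (c \<bullet> i) *\<^sub>R i)"
        and "b = (\<Sum>i\<in>Basis. min (u \<bullet> i) (d \<bullet> i) *\<^sub>R i)"
      have "box l u \<inter> box c d = box a b" "cbox a b \<subseteq> cbox c d"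
        by (auto simp: box_Int_box a_def b_def mem_box)
      moreover have "(LINT z:box l u|lborel. g z) = (LINT z:box l u \<inter> box c d|lborel. H z)"
        unfolding g_def set_lebesgue_integral_def
        by (rule Bochner_Integration.integral_cong) (auto simp: indicator_def)
      ultimately show "(LINT z:box l u|lborel. g z) = 0"
        using box0[of a b] sub by simp
    qed
    with AE_cbox_imp_box[of c d] show ?thesis
      by eventually_elim (auto simp: g_def)
  qed
  obtain \<D> where D: "countable \<D>" "\<D> \<subseteq> Pow \<Omega>" "\<And>X. X \<in> \<D> \<Longrightarrow> \<exists>a b. X = cbox a b" "\<Union>\<D> = \<Omega>"
    using open_countable_Union_open_cbox[OF op] by metis
  have "AE z in lborel. z \<in> X \<longrightarrow> H z = 0" if X: "X \<in> \<D>" for X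
  proof -
    obtain a b where "X = cbox a b" using D(3)[OF X] by blast
    moreover have "X \<subseteq> \<Omega>" using D(2) X by blast
    ultimately show ?thesis using cbox0[of a b] by simp
  qed
  then have "AE z in lborel. \<forall>X\<in>\<D>. z \<in> X \<longrightarrow> H z = 0"
    unfolding AE_ball_countable[OF D(1)] by blast
  then show ?thesis
  proof eventually_elim
    case (elim z)
    show ?case
    proof
      assume "z \<in> \<Omega>"
      then obtain X where "X \<in> \<D>" "z \<in> X" using D(4) by blast
      with elim show "H z = 0" by blast
    qed
  qed
qed


section \<open>Weak gradients\<close>

lemma is_weak_grad_locally_integrable:
  assumes "is_weak_grad \<Omega> U G"
  shows "locally_integrable \<Omega> U" "locally_integrable \<Omega> G"
  using assms unfolding is_weak_grad_def by (rule conjunct1, rule conjunct1[OF conjunct2])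

lemma is_weak_grad_identity:
  assumes "is_weak_grad \<Omega> U G" "test_fun \<Omega> f" "b \<in> Basis"
  shows "(LINT z:\<Omega>|lborel. U z * frechet_derivative f (at z) b) = - (LINT z:\<Omega>|lborel. (G z \<bullet> b) * f z)"
  using assms unfolding is_weak_grad_def by blast

lemma locally_integrable_inner:
  assumes "locally_integrable \<Omega> G"
  shows "locally_integrable \<Omega> (\<lambda>z. G z \<bullet> b)"
  unfolding locally_integrable_def set_integrable_def
proof (intro allI impI)
  fix K assume "compact K \<and> K \<subseteq> \<Omega>"
  then have "integrable lborel (\<lambda>z. indicat_real K z *\<^sub>R G z)"
    using assms unfolding locally_integrable_def set_integrable_def by blast
  then have "integrable lborel (\<lambda>z. (indicat_real K z *\<^sub>R G z) \<bullet> b)"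
    by (rule integrable_inner_left)
  then show "integrable lborel (\<lambda>z. indicat_real K z *\<^sub>R (G z \<bullet> b))"
    by (simp only: inner_scaleR_left real_scaleR_def)
qed

lemma locally_integrable_diff:
  assumes "locally_integrable \<Omega> f" "locally_integrable \<Omega> g"
  shows "locally_integrable \<Omega> (\<lambda>z. f z - g z)"
  unfolding locally_integrable_def
proof (intro allI impI)
  fix K assume "compact K \<and> K \<subseteq> \<Omega>"
  then show "set_integrable lborel K (\<lambda>z. f z - g z)"
    using assms unfolding locally_integrable_def by (intro set_integral_diff(1)) blast+
qed

text \<open>The fundamental lemma applies to each component of the difference.\<close>

lemma is_weak_grad_unique:
  assumes op: "open \<Omega>" and 1: "is_weak_grad \<Omega> U G1" and 2: "is_weak_grad \<Omega> U G2"
  shows "AE z in lborel. z \<in> \<Omega> \<longrightarrow> G1 z = G2 z"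
proof -
  have "AE z in lborel. z \<in> \<Omega> \<longrightarrow> G1 z \<bullet> b - G2 z \<bullet> b = 0" if b: "b \<in> Basis" for b
  proof (rule fundamental_lemma_variations[OF op])
    have loc: "locally_integrable \<Omega> (\<lambda>z. G1 z \<bullet> b)" "locally_integrable \<Omega> (\<lambda>z. G2 z \<bullet> b)"
      by (rule locally_integrable_inner[OF is_weak_grad_locally_integrable(2)[OF 1]],
          rule locally_integrable_inner[OF is_weak_grad_locally_integrable(2)[OF 2]])
    then show diff: "locally_integrable \<Omega> (\<lambda>z. G1 z \<bullet> b - G2 z \<bullet> b)"
      by (rule locally_integrable_diff)
    fix f assume f: "test_fun \<Omega> f"
    have "(LINT z:\<Omega>|lborel. (G1 z \<bullet> b) * f z) = (LINT z:\<Omega>|lborel. (G2 z \<bullet> b) * f z)"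
      using is_weak_grad_identity[OF 1 f b] is_weak_grad_identity[OF 2 f b] by simp
    moreover have "(LINT z:\<Omega>|lborel. (G1 z \<bullet> b - G2 z \<bullet> b) * f z)
        = (LINT z|lborel. (G1 z \<bullet> b) * f z) - (LINT z|lborel. (G2 z \<bullet> b) * f z)"
      using test_fun_mult_integrable[OF loc(1) f] test_fun_mult_integrable[OF loc(2) f]
        test_fun_mult_integrable(2)[OF diff f]
      by (simp add: left_diff_distrib)
    ultimately show "(LINT z:\<Omega>|lborel. (G1 z \<bullet> b - G2 z \<bullet> b) * f z) = 0"
      using test_fun_mult_integrable(2)[OF loc(1) f] test_fun_mult_integrable(2)[OF loc(2) f] by simp
  qed
  then have "AE z in lborel. \<forall>b\<in>Basis. z \<in> \<Omega> \<longrightarrow> G1 z \<bullet> b - G2 z \<bullet> b = 0"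
    by (subst AE_ball_countable) (auto simp: countable_finite)
  then show ?thesis
    by eventually_elim (auto intro: euclidean_eqI)
qed

lemma locally_integrable_subset:
  "locally_integrable \<Omega> f \<Longrightarrow> \<Omega>' \<subseteq> \<Omega> \<Longrightarrow> locally_integrable \<Omega>' f"
  unfolding locally_integrable_def by blast

lemma test_fun_mono: "test_fun \<Omega>' f \<Longrightarrow> \<Omega>' \<subseteq> \<Omega> \<Longrightarrow> test_fun \<Omega> f"
  unfolding test_fun_def by blast

text \<open>Outside the support of the test function both sides of the defining identity vanish, so that
  the domain of integration does not matter.\<close>

lemma is_weak_grad_identity_mono:
  assumes f: "test_fun \<Omega>' f" and sub: "\<Omega>' \<subseteq> \<Omega>"
  shows "(LINT z:\<Omega>|lborel. U z * frechet_derivative f (at z) b) =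
      (LINT z:\<Omega>'|lborel. U z * frechet_derivative f (at z) b)"
    "(LINT z:\<Omega>|lborel. (G z \<bullet> b) * f z) = (LINT z:\<Omega>'|lborel. (G z \<bullet> b) * f z)"
proof -
  obtain K where K: "K \<subseteq> \<Omega>'" "\<And>z. z \<notin> K \<Longrightarrow> f z = 0"
    "\<And>z v. z \<notin> K \<Longrightarrow> frechet_derivative f (at z) v = 0"
    using test_fun_zero_outside[OF f] by metis
  show "(LINT z:\<Omega>|lborel. U z * frechet_derivative f (at z) b) =
      (LINT z:\<Omega>'|lborel. U z * frechet_derivative f (at z) b)"
    by (rule trans[OF set_integral_outside_zero[of K] set_integral_outside_zero[of K, symmetric]])
      (use K sub in auto)
  show "(LINT z:\<Omega>|lborel. (G z \<bullet> b) * f z) = (LINT z:\<Omega>'|lborel. (G z \<bullet> b) * f z)"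
    by (rule trans[OF set_integral_outside_zero[of K] set_integral_outside_zero[of K, symmetric]])
      (use K sub in auto)
qed

lemma is_weak_grad_subset:
  assumes "is_weak_grad \<Omega> U G" and sub: "\<Omega>' \<subseteq> \<Omega>"
  shows "is_weak_grad \<Omega>' U G"
  unfolding is_weak_grad_def
proof (intro conjI allI impI ballI)
  show "locally_integrable \<Omega>' U" "locally_integrable \<Omega>' G"
    using assms locally_integrable_subset unfolding is_weak_grad_def by blast+
  fix f b assume f: "test_fun \<Omega>' f" and b: "b \<in> (Basis::'a set)"
  have "(LINT z:\<Omega>|lborel. U z * frechet_derivative f (at z) b)
          = - (LINT z:\<Omega>|lborel. (G z \<bullet> b) * f z)"
    using is_weak_grad_identity[OF assms(1) test_fun_mono[OF f sub] b] .
  then show "(LINT z:\<Omega>'|lborel. U z * frechet_derivative f (at z) b)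
          = - (LINT z:\<Omega>'|lborel. (G z \<bullet> b) * f z)"
    unfolding is_weak_grad_identity_mono[OF f sub] .
qed

text \<open>At almost every point the cut-off functions are eventually constant. Defining the glued function as
  their limit makes it measurable without modifying it on the exceptional null set.\<close>

lemma glue_measurable_functions:
  fixes u :: "nat \<Rightarrow> 'a \<Rightarrow> 'b::{banach, second_countable_topology}"
  assumes inc: "incseq A"
    and meas: "\<And>n. (\<lambda>z. indicator (A n) z *\<^sub>R u n z) \<in> borel_measurable M"
    and eq: "\<And>n. AE z in M. z \<in> A n \<longrightarrow> u n z = u (Suc n) z"
  obtains v where "(\<lambda>z. indicator (\<Union>n. A n) z *\<^sub>R v z) \<in> borel_measurable M"
    "\<And>n. AE z in M. z \<in> A n \<longrightarrow> v z = u n z"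
proof
  define v where "v z = lim (\<lambda>n. indicat_real (A n) z *\<^sub>R u n z)" for z
  have "indicat_real (\<Union>n. A n) z *\<^sub>R v z = v z" for z
  proof (cases "z \<in> (\<Union>n. A n)")
    case False
    then have "(\<lambda>n. indicat_real (A n) z *\<^sub>R u n z) = (\<lambda>n. 0)" by auto
    then show ?thesis using False by (simp add: v_def)
  qed simp
  moreover have "v \<in> borel_measurable M"
    unfolding v_def using meas by (rule borel_measurable_lim_metric)
  ultimately show "(\<lambda>z. indicator (\<Union>n. A n) z *\<^sub>R v z) \<in> borel_measurable M" by simp
  show "AE z in M. z \<in> A n \<longrightarrow> v z = u n z" for n
  proof -
    have "AE z in M. \<forall>m. z \<in> A m \<longrightarrow> u m z = u (Suc m) z"
      using eq by (simp add: AE_all_countable)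
    then show ?thesis
    proof eventually_elim
      case (elim z)
      show ?case
      proof
        assume z: "z \<in> A n"
        have A: "z \<in> A m" if "m \<ge> n" for m using inc z that by (auto simp: incseq_def)
        have "u m z = u n z" if "m \<ge> n" for m
          using that
        proof (induction m rule: dec_induct)
          case (step m)
          have "u m z = u (Suc m) z" using elim A[OF step.hyps(1)] by blast
          from trans[OF this[symmetric] step.IH] show ?case .
        qed (rule refl)
        with A have "indicat_real (A m) z *\<^sub>R u m z = u n z" if "m \<ge> n" for m
          using that by (metis indicator_simps(1) scaleR_one)
        then have "(\<lambda>m. indicat_real (A m) z *\<^sub>R u m z) \<longlonglongrightarrow> u n z"
          by (intro tendsto_eventually eventually_sequentiallyI)
        then show "v z = u n z" unfolding v_def by (rule limI)
      qed
    qed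
  qed
qed

lemma compact_subset_incseq_open:
  assumes "compact K" "K \<subseteq> (\<Union>n. \<Omega> n)" "\<And>n::nat. open (\<Omega> n)" "incseq \<Omega>"
  obtains n where "K \<subseteq> \<Omega> n"
proof -
  obtain N where N: "finite N" "K \<subseteq> (\<Union>n\<in>N. \<Omega> n)"
    using compactE_image[OF assms(1), of UNIV \<Omega>] assms(2,3) by (metis UNIV_I subset_UNIV)
  obtain m where "\<forall>n\<in>N. n \<le> m" using N(1) finite_nat_set_iff_bounded_le by blast
  then have "K \<subseteq> \<Omega> m" using N(2) assms(4) unfolding incseq_def by blast
  with that show ?thesis .
qed

lemma set_integrable_AE_cong:
  fixes f g :: "'a \<Rightarrow> 'b::{banach, second_countable_topology}"
  assumes "set_integrable M K f" "(\<lambda>z. indicator A z *\<^sub>R g z) \<in> borel_measurable M"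
    "AE z in M. z \<in> K \<longrightarrow> f z = g z" "K \<subseteq> A" "K \<in> sets M"
  shows "set_integrable M K g"
proof -
  have *: "indicator K z *\<^sub>R g z = indicator K z *\<^sub>R (indicator A z *\<^sub>R g z)" for z
    using assms(4) by (auto simp: indicator_def)
  show ?thesis unfolding set_integrable_def
  proof (rule integrable_cong_AE_imp)
    show "integrable M (\<lambda>z. indicat_real K z *\<^sub>R f z)" using assms(1) by (simp add: set_integrable_def)
    show "(\<lambda>z. indicat_real K z *\<^sub>R g z) \<in> borel_measurable M"
      unfolding * using assms(2,5) by measurable
    show "AE z in M. indicat_real K z *\<^sub>R f z = indicat_real K z *\<^sub>R g z"
      using assms(3) by eventually_elim (auto simp: indicator_def)
  qed
qed

lemma is_weak_grad_cong:
  assumes W: "is_weak_grad \<Omega> U G1" and op: "open \<Omega>"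
    and meas: "(\<lambda>z. indicator \<Omega> z *\<^sub>R G2 z) \<in> borel_measurable lborel"
    and eq: "AE z in lborel. z \<in> \<Omega> \<longrightarrow> G1 z = G2 z"
  shows "is_weak_grad \<Omega> U G2"
  unfolding is_weak_grad_def
proof (intro conjI allI impI ballI)
  have loc: "locally_integrable \<Omega> U" "locally_integrable \<Omega> G1"
    using W unfolding is_weak_grad_def by blast+
  show "locally_integrable \<Omega> U" by fact
  show "locally_integrable \<Omega> G2"
    unfolding locally_integrable_def
  proof (intro allI impI)
    fix K :: "'a set" assume K: "compact K \<and> K \<subseteq> \<Omega>"
    show "set_integrable lborel K G2"
      by (rule set_integrable_AE_cong[OF _ meas, of _ G1])
        (use loc(2) K eq in \<open>auto simp: locally_integrable_def borel_compact\<close>)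
  qed
  fix f b assume f: "test_fun \<Omega> f" and b: "b \<in> (Basis::'a set)"
  have "(LINT z:\<Omega>|lborel. (G1 z \<bullet> b) * f z) = (LINT z:\<Omega>|lborel. (G2 z \<bullet> b) * f z)"
    unfolding set_lebesgue_integral_def
  proof (rule integral_cong_AE)
    have *: "indicat_real \<Omega> z *\<^sub>R ((G z \<bullet> b) * f z) = ((indicat_real \<Omega> z *\<^sub>R G z) \<bullet> b) * f z" for z G
      by simp
    have fm: "f \<in> borel_measurable borel" using smooth_fun_measurable[OF test_fun_smooth[OF f]] .
    show "(\<lambda>z. indicat_real \<Omega> z *\<^sub>R ((G1 z \<bullet> b) * f z)) \<in> borel_measurable lborel"
      unfolding * using locally_integrable_measurable[OF loc(2) op] fm
      by (intro borel_measurable_times borel_measurable_inner) auto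
    show "(\<lambda>z. indicat_real \<Omega> z *\<^sub>R ((G2 z \<bullet> b) * f z)) \<in> borel_measurable lborel"
      unfolding * using meas fm
      by (intro borel_measurable_times borel_measurable_inner) auto
    show "AE z in lborel. indicat_real \<Omega> z *\<^sub>R ((G1 z \<bullet> b) * f z) = indicat_real \<Omega> z *\<^sub>R ((G2 z \<bullet> b) * f z)"
      using eq by eventually_elim (auto simp: indicator_def)
  qed
  moreover have "(LINT z:\<Omega>|lborel. U z * frechet_derivative f (at z) b)
          = - (LINT z:\<Omega>|lborel. (G1 z \<bullet> b) * f z)"
    using is_weak_grad_identity[OF W f b] .
  ultimately show "(LINT z:\<Omega>|lborel. U z * frechet_derivative f (at z) b)
          = - (LINT z:\<Omega>|lborel. (G2 z \<bullet> b) * f z)" by simp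
qed

text \<open>Weak gradients on the members of an exhaustion agree almost everywhere by uniqueness, so
  they can be glued. Every test function on the union is a test function on some member.\<close>

lemma is_weak_grad_Union:
  fixes \<Omega> :: "nat \<Rightarrow> 'e::euclidean_space set"
  assumes op: "\<And>n. open (\<Omega> n)" and inc: "incseq \<Omega>" and W: "\<And>n. is_weak_grad (\<Omega> n) U (G n)"
  obtains F where "is_weak_grad (\<Union>n. \<Omega> n) U F"
proof -
  obtain F where Fm: "(\<lambda>z. indicator (\<Union>n. \<Omega> n) z *\<^sub>R F z) \<in> borel_measurable lborel"
    and F: "\<And>n. AE z in lborel. z \<in> \<Omega> n \<longrightarrow> F z = G n z"
  proof (rule glue_measurable_functions[OF inc])
    show "(\<lambda>z. indicat_real (\<Omega> n) z *\<^sub>R G n z) \<in> borel_measurable lborel" for n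
      using locally_integrable_measurable[OF is_weak_grad_locally_integrable(2)[OF W] op] .
    show "AE z in lborel. z \<in> \<Omega> n \<longrightarrow> G n z = G (Suc n) z" for n
      using is_weak_grad_unique[OF op W is_weak_grad_subset[OF W, of "\<Omega> n" "Suc n"]] inc
      by (auto simp: incseq_Suc_iff)
  qed metis
  have WF: "is_weak_grad (\<Omega> n) U F" for n
  proof (rule is_weak_grad_cong[OF W op])
    show "AE z in lborel. z \<in> \<Omega> n \<longrightarrow> G n z = F z" using F[of n] by eventually_elim auto
    have "(\<lambda>z. indicat_real (\<Omega> n) z *\<^sub>R F z) =
        (\<lambda>z. indicat_real (\<Omega> n) z *\<^sub>R (indicat_real (\<Union>n. \<Omega> n) z *\<^sub>R F z))"
      by (rule ext) (auto simp: indicator_def)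
    moreover have "indicat_real (\<Omega> n) \<in> borel_measurable lborel"
      using op by (simp add: borel_open)
    ultimately show "(\<lambda>z. indicat_real (\<Omega> n) z *\<^sub>R F z) \<in> borel_measurable lborel"
      using Fm by (simp only: borel_measurable_scaleR)
  qed
  have sub: "\<exists>n. K \<subseteq> \<Omega> n" if "compact K" "K \<subseteq> (\<Union>n. \<Omega> n)" for K
    using compact_subset_incseq_open[OF that op inc] by metis
  have "is_weak_grad (\<Union>n. \<Omega> n) U F"
    unfolding is_weak_grad_def
  proof (intro conjI allI impI ballI)
    show "locally_integrable (\<Union>n. \<Omega> n) U" "locally_integrable (\<Union>n. \<Omega> n) F"
      using WF sub unfolding is_weak_grad_def locally_integrable_def by meson+
    fix f b assume f: "test_fun (\<Union>n. \<Omega> n) f" and b: "b \<in> (Basis::'e set)"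
    obtain n where n: "test_fun (\<Omega> n) f"
      using f sub unfolding test_fun_def by metis
    have "\<Omega> n \<subseteq> (\<Union>n. \<Omega> n)" by blast
    from is_weak_grad_identity_mono[OF n this]
    show "(LINT z:(\<Union>n. \<Omega> n)|lborel. U z * frechet_derivative f (at z) b)
          = - (LINT z:(\<Union>n. \<Omega> n)|lborel. (F z \<bullet> b) * f z)"
      using is_weak_grad_identity[OF WF n b] by simp
  qed
  with that show ?thesis .
qed

section \<open>Gradients on cylinders and on the half space-time\<close>

abbreviation later :: "('e \<times> real) set" where
  "later \<equiv> UNIV \<times> {0<..}"

lemma has_derivative_classical_grad:
  assumes "smooth_fun f"
  shows "(f has_derivative (\<lambda>v. classical_grad f z \<bullet> v)) (at z)"
proof -
  have D: "(f has_derivative frechet_derivative f (at z)) (at z)"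
    by (rule smooth_fun_has_derivative[OF assms])
  have "frechet_derivative f (at z) v = classical_grad f z \<bullet> v" for v
  proof -
    have "frechet_derivative f (at z) v = frechet_derivative f (at z) (\<Sum>b\<in>Basis. (v \<bullet> b) *\<^sub>R b)"
      by (simp add: euclidean_representation)
    also have "\<dots> = (\<Sum>b\<in>Basis. (v \<bullet> b) * frechet_derivative f (at z) b)"
      by (simp only: linear_sum[OF has_derivative_linear[OF D]] linear_scale[OF has_derivative_linear[OF D]]
          real_scaleR_def)
    also have "\<dots> = classical_grad f z \<bullet> v"
      unfolding classical_grad_def
      by (simp add: inner_sum_left) (simp add: mult.commute inner_commute)
    finally show ?thesis .
  qed
  then have "frechet_derivative f (at z) = (\<lambda>v. classical_grad f z \<bullet> v)" by (rule ext)
  then show ?thesis using D by (simp only:)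
qed

lemma frechet_derivative_eq_grad:
  "smooth_fun f \<Longrightarrow> frechet_derivative f (at z) v = classical_grad f z \<bullet> v"
  using frechet_derivative_at[OF has_derivative_classical_grad] by metis

lemma classical_gradI:
  assumes "(f has_derivative (\<lambda>v. D \<bullet> v)) (at z)"
  shows "classical_grad f z = D"
  unfolding classical_grad_def frechet_derivative_at[OF assms, symmetric]
  by (simp add: euclidean_representation)

lemma classical_grad_diff:
  assumes "smooth_fun f" "smooth_fun g"
  shows "classical_grad (\<lambda>z. f z - g z) z = classical_grad f z - classical_grad g z"
  by (rule classical_gradI)
    (simp add: inner_diff_left has_derivative_diff has_derivative_classical_grad assms)

lemma classical_grad_measurable:
  assumes "smooth_fun f"
  shows "classical_grad f \<in> borel_measurable borel"
  unfolding classical_grad_def[abs_def]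
  by (intro borel_measurable_sum borel_measurable_scaleR borel_measurable_const
      smooth_fun_measurable smooth_fun_frechet assms)

lemma wt_nonneg: "0 \<le> wt a X" "0 \<le> wt_time a z"
  by (simp_all add: wt_def wt_time_def)

lemma wt_measurable: "(wt a :: 'a::finite space \<Rightarrow> real) \<in> borel_measurable borel"
proof -
  have [measurable]: "(snd :: 'a space \<Rightarrow> real) \<in> borel_measurable borel"
    by (intro borel_measurable_continuous_onI continuous_intros)
  show ?thesis unfolding wt_def[abs_def] by measurable
qed

lemma wt_time_measurable: "(wt_time a :: 'n::finite spacetime \<Rightarrow> real) \<in> borel_measurable borel"
proof -
  have "(fst :: 'n spacetime \<Rightarrow> 'n space) \<in> borel_measurable borel"
    by (intro borel_measurable_continuous_onI continuous_intros)
  from measurable_compose[OF this wt_measurable] show ?thesis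
    by (simp add: wt_time_def[abs_def])
qed

lemma open_Qplus: "open (Qplus R)"
  unfolding Qplus_def by (intro open_Times open_ball open_greaterThanLessThan)

lemma Qplus_mono: "0 \<le> R \<Longrightarrow> R \<le> R' \<Longrightarrow> Qplus R \<subseteq> Qplus R'"
  unfolding Qplus_def by (intro Sigma_mono subset_ball greaterThanLessThan_subseteq_greaterThanLessThan[THEN iffD2] power_mono impI) auto

lemma exhaust_ball_interval:
  "(\<Union>n. ball 0 (real (Suc n)) \<times> {0<..<(real (Suc n))\<^sup>2}) = (UNIV :: 'e::real_normed_vector set) \<times> {0<..}"
proof -
  have "\<exists>n. norm x < real (Suc n) \<and> t < (real (Suc n))\<^sup>2" if "t > 0" for t :: real and x :: 'e
  proof -
    obtain n where n: "max (norm x) t < real n" using reals_Archimedean2 by blast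
    have sq: "m \<le> m\<^sup>2" if "m \<ge> 1" for m :: real
      using that by (simp add: power2_eq_square)
    have "t < real (Suc n)" using n by simp
    also have "\<dots> \<le> (real (Suc n))\<^sup>2" by (rule sq) simp
    finally have "t < (real (Suc n))\<^sup>2" .
    then show ?thesis using n by (intro exI[of _ n]) auto
  qed
  then show ?thesis by (auto simp: dist_norm)
qed

lemma Qplus_subset_later: "Qplus R \<subseteq> later"
  by (auto simp: Qplus_def)

lemma weak_grad_is_weak_grad: "is_weak_grad \<Omega> U G \<Longrightarrow> is_weak_grad \<Omega> U (weak_grad \<Omega> U)"
  unfolding weak_grad_def by (rule someI[where P="is_weak_grad \<Omega> U"])

text \<open>Membership in \<open>UU\<close> only gives one weak gradient for each cylinder; this is where they are glued to
  one on the whole half space-time, as the functional requires.\<close>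

lemma UU_is_weak_grad:
  assumes U: "U \<in> UU a"
  shows "is_weak_grad later U (weak_grad later U)"
proof -
  have "\<exists>G. is_weak_grad (Qplus (real (Suc n))) U G" for n
    using U unfolding UU_def H1_def by fastforce
  then obtain G where G: "\<And>n. is_weak_grad (Qplus (real (Suc n))) U (G n)" by metis
  have "incseq (\<lambda>n. Qplus (real (Suc n)) :: 'a spacetime set)"
    by (rule incseq_SucI) (rule Qplus_mono, auto)
  from is_weak_grad_Union[OF open_Qplus this G] obtain F
    where "is_weak_grad (\<Union>n. Qplus (real (Suc n))) U F" by metis
  then show ?thesis
    unfolding Qplus_def exhaust_ball_interval by (rule weak_grad_is_weak_grad)
qed

definition H1_dist ::
    "('e::euclidean_space \<Rightarrow> real) \<Rightarrow> 'e set \<Rightarrow> ('e \<Rightarrow> real) \<Rightarrow> ('e \<Rightarrow> real) \<Rightarrow> ('e \<Rightarrow> 'e) \<Rightarrow> ennreal" where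
  "H1_dist w \<Omega> f U G =
     (\<integral>\<^sup>+z\<in>\<Omega>. ennreal (w z * ((f z - U z)\<^sup>2 + (norm (classical_grad f z - G z))\<^sup>2)) \<partial>lborel)"

lemma H1_tendsto_iff:
  "H1_tendsto w \<Omega> f U \<longleftrightarrow> (\<exists>G. is_weak_grad \<Omega> U G \<and> (\<lambda>k. H1_dist w \<Omega> (f k) U G) \<longlonglongrightarrow> 0)"
  by (simp add: H1_tendsto_def H1_dist_def)

lemma H1_dist_mono: "\<Omega>' \<subseteq> \<Omega> \<Longrightarrow> H1_dist w \<Omega>' f U G \<le> H1_dist w \<Omega> f U G"
  unfolding H1_dist_def by (rule nn_set_integral_set_mono)

text \<open>The definition of convergence lets the gradient of the limit depend on the sequence and on the domain.
  By uniqueness, one gradient fixed in advance serves for all sequences.\<close>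

lemma H1_tendsto_H1_dist:
  assumes "H1_tendsto w \<Omega> f U" and G: "is_weak_grad \<Omega> U G" and op: "open \<Omega>"
  shows "(\<lambda>k. H1_dist w \<Omega> (f k) U G) \<longlonglongrightarrow> 0"
proof -
  obtain G' where G': "is_weak_grad \<Omega> U G'" "(\<lambda>k. H1_dist w \<Omega> (f k) U G') \<longlonglongrightarrow> 0"
    using assms(1) unfolding H1_tendsto_iff by blast
  have "H1_dist w \<Omega> (f k) U G' = H1_dist w \<Omega> (f k) U G" for k
    unfolding H1_dist_def
  proof (rule nn_integral_cong_AE)
    show "AE z in lborel. ennreal (w z * ((f k z - U z)\<^sup>2 + (norm (classical_grad (f k) z - G' z))\<^sup>2)) * indicator \<Omega> z =
        ennreal (w z * ((f k z - U z)\<^sup>2 + (norm (classical_grad (f k) z - G z))\<^sup>2)) * indicator \<Omega> z"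
      using is_weak_grad_unique[OF op G'(1) G]
      by eventually_elim (auto simp: indicator_def)
  qed
  with G'(2) show ?thesis by simp
qed

lemma tendsto_0_le_ennreal:
  fixes f g :: "nat \<Rightarrow> ennreal"
  assumes "g \<longlonglongrightarrow> 0" "\<And>n. f n \<le> g n"
  shows "f \<longlonglongrightarrow> 0"
  by (rule tendsto_sandwich[OF _ _ tendsto_const assms(1)]) (use assms(2) in auto)

lemma H1_tendsto_subset:
  assumes "H1_tendsto w \<Omega> f U" "\<Omega>' \<subseteq> \<Omega>"
  shows "H1_tendsto w \<Omega>' f U"
proof -
  obtain G where G: "is_weak_grad \<Omega> U G" "(\<lambda>k. H1_dist w \<Omega> (f k) U G) \<longlonglongrightarrow> 0"
    using assms(1) unfolding H1_tendsto_iff by blast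
  show ?thesis unfolding H1_tendsto_iff
    using is_weak_grad_subset[OF G(1) assms(2)] tendsto_0_le_ennreal[OF G(2) H1_dist_mono[OF assms(2)]]
    by blast
qed

lemma norm_diff_square_le:
  fixes x y u :: "'a::real_inner"
  shows "(norm (x - y))\<^sup>2 \<le> 2 * (norm (x - u))\<^sup>2 + 2 * (norm (y - u))\<^sup>2"
proof -
  have "norm (x - y) \<le> norm (x - u) + norm (y - u)"
    using norm_triangle_ineq4[of "x - u" "y - u"] by simp
  then have "(norm (x - y))\<^sup>2 \<le> (norm (x - u) + norm (y - u))\<^sup>2" by (rule power_mono) simp
  also have "\<dots> \<le> 2 * (norm (x - u))\<^sup>2 + 2 * (norm (y - u))\<^sup>2"
    using sum_squares_bound[of "norm (x - u)" "norm (y - u)"] by (simp add: power2_sum)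
  finally show ?thesis .
qed

lemma real_diff_square_le: "(x - y)\<^sup>2 \<le> 2 * (x - u)\<^sup>2 + 2 * (y - u)\<^sup>2" for x y u :: real
  using norm_diff_square_le[of x y u] by simp

lemma H1_dist_measurable:
  fixes f :: "'e::euclidean_space \<Rightarrow> real"
  assumes f: "smooth_fun f" and w: "w \<in> borel_measurable borel"
    and U: "locally_integrable \<Omega> U" and G: "locally_integrable \<Omega> G" and op: "open \<Omega>"
  shows "(\<lambda>z. ennreal (w z * ((f z - U z)\<^sup>2 + (norm (classical_grad f z - G z))\<^sup>2)) * indicator \<Omega> z)
    \<in> borel_measurable lborel"
proof -
  define U' where "U' z = indicator \<Omega> z *\<^sub>R U z" for z
  define G' where "G' z = indicator \<Omega> z *\<^sub>R G z" for z
  have "U' \<in> borel_measurable lborel" "G' \<in> borel_measurable lborel"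
    unfolding U'_def[abs_def] G'_def[abs_def] using locally_integrable_measurable U G op by blast+
  then have [measurable]: "U' \<in> borel_measurable borel" "G' \<in> borel_measurable borel"
    "f \<in> borel_measurable borel" "classical_grad f \<in> borel_measurable borel" "w \<in> borel_measurable borel"
    "\<Omega> \<in> sets borel"
    using smooth_fun_measurable[OF f] classical_grad_measurable[OF f] w op by auto
  have "(\<lambda>z. ennreal (w z * ((f z - U z)\<^sup>2 + (norm (classical_grad f z - G z))\<^sup>2)) * indicator \<Omega> z)
    = (\<lambda>z. ennreal (w z * ((f z - U' z)\<^sup>2 + (norm (classical_grad f z - G' z))\<^sup>2)) * indicator \<Omega> z)"
    by (rule ext) (auto simp: U'_def G'_def indicator_def)
  also have "\<dots> \<in> borel_measurable lborel" by simp
  finally show ?thesis .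
qed

text \<open>With \<open>d j\<close> tending to zero, a bound by \<open>d j + d k\<close> is the Cauchy property of a sequence; this is how
  convergence towards \<open>U\<close> is passed on to the traces.\<close>

lemma H1_dist_diff_le:
  fixes f g :: "'e::euclidean_space \<Rightarrow> real"
  assumes f: "smooth_fun f" and g: "smooth_fun g" and w: "w \<in> borel_measurable borel" "\<And>z. w z \<ge> 0"
    and W: "is_weak_grad \<Omega> U G" and op: "open \<Omega>"
  shows "(\<integral>\<^sup>+z\<in>\<Omega>. ennreal (w z * ((f z - g z)\<^sup>2 + (norm (classical_grad (\<lambda>z. f z - g z) z))\<^sup>2)) \<partial>lborel)
    \<le> 2 * (H1_dist w \<Omega> f U G + H1_dist w \<Omega> g U G)"
proof -
  note m = H1_dist_measurable[OF _ w(1) is_weak_grad_locally_integrable[OF W] op]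
  have "(\<integral>\<^sup>+z\<in>\<Omega>. ennreal (w z * ((f z - g z)\<^sup>2 + (norm (classical_grad (\<lambda>z. f z - g z) z))\<^sup>2)) \<partial>lborel)
    \<le> (\<integral>\<^sup>+z. 2 * (ennreal (w z * ((f z - U z)\<^sup>2 + (norm (classical_grad f z - G z))\<^sup>2)) * indicator \<Omega> z
          + ennreal (w z * ((g z - U z)\<^sup>2 + (norm (classical_grad g z - G z))\<^sup>2)) * indicator \<Omega> z) \<partial>lborel)"
  proof (rule nn_integral_mono)
    fix z
    have "w z * ((f z - g z)\<^sup>2 + (norm (classical_grad f z - classical_grad g z))\<^sup>2)
      \<le> w z * (2 * ((f z - U z)\<^sup>2 + (norm (classical_grad f z - G z))\<^sup>2)
            + 2 * ((g z - U z)\<^sup>2 + (norm (classical_grad g z - G z))\<^sup>2))"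
      using real_diff_square_le[of "f z" "g z" "U z"]
        norm_diff_square_le[of "classical_grad f z" "classical_grad g z" "G z"] w(2)
      by (intro mult_left_mono) auto
    also have "\<dots> = 2 * (w z * ((f z - U z)\<^sup>2 + (norm (classical_grad f z - G z))\<^sup>2)
            + w z * ((g z - U z)\<^sup>2 + (norm (classical_grad g z - G z))\<^sup>2))" (is "_ = 2 * (?A + ?B)")
      by (simp add: algebra_simps)
    finally have "ennreal (w z * ((f z - g z)\<^sup>2 + (norm (classical_grad f z - classical_grad g z))\<^sup>2))
      \<le> ennreal (2 * (?A + ?B))" by (rule ennreal_leI)
    also have "\<dots> = 2 * (ennreal ?A + ennreal ?B)"
    proof -
      have "0 \<le> ?A" "0 \<le> ?B" using w(2) by auto
      then show ?thesis by (simp only: ennreal_mult' ennreal_plus ennreal_numeral zero_le_numeral)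
    qed
    finally show "ennreal (w z * ((f z - g z)\<^sup>2 + (norm (classical_grad (\<lambda>z. f z - g z) z))\<^sup>2)) * indicator \<Omega> z
      \<le> 2 * (ennreal ?A * indicator \<Omega> z + ennreal ?B * indicator \<Omega> z)"
      unfolding classical_grad_diff[OF f g] by (auto simp: indicator_def)
  qed
  also have "\<dots> = 2 * (H1_dist w \<Omega> f U G + H1_dist w \<Omega> g U G)"
    unfolding H1_dist_def using m[OF f] m[OF g]
    by (subst nn_integral_cmult) (auto simp: nn_integral_add)
  finally show ?thesis .
qed


section \<open>Completeness of L2\<close>

text \<open>A sequence whose consecutive distances decay geometrically converges almost everywhere, and
  Fatou's lemma identifies the pointwise limit as the limit in the mean.\<close>

lemma L2_complete:
  fixes g :: "nat \<Rightarrow> 'a \<Rightarrow> real" and d :: "nat \<Rightarrow> ennreal"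
  assumes [measurable]: "\<And>k. g k \<in> borel_measurable M"
    and d: "d \<longlonglongrightarrow> 0"
    and bound: "\<And>j k. (\<integral>\<^sup>+x. ennreal ((g j x - g k x)\<^sup>2) \<partial>M) \<le> d j + d k"
  obtains h where "h \<in> borel_measurable M" "(\<lambda>k. \<integral>\<^sup>+x. ennreal ((g k x - h x)\<^sup>2) \<partial>M) \<longlonglongrightarrow> 0"
proof -
  have "\<exists>N. d N \<le> ennreal ((1/8) ^ j)" for j :: nat
  proof -
    have "0 < ennreal ((1/8) ^ j)" by simp
    from order_tendstoD(2)[OF d this] show ?thesis
      by (metis eventually_sequentially le_refl order_less_imp_le)
  qed
  then obtain N where N: "\<And>j. d (N j) \<le> ennreal ((1/8) ^ j)" by metis
  define \<Delta> where "\<Delta> j x = g (N (Suc j)) x - g (N j) x" for j x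
  have [measurable]: "\<Delta> j \<in> borel_measurable M" for j unfolding \<Delta>_def[abs_def] by measurable
  \<comment> \<open>The weights \<open>4\<^sup>j\<close> leave the series of integrals convergent, and force \<open>\<Delta> j x\<close> to decay like
    \<open>2\<^bsup>-j\<^esup>\<close> wherever the sum is finite.\<close>
  have "(\<integral>\<^sup>+x. (\<Sum>j. ennreal (4 ^ j * (\<Delta> j x)\<^sup>2)) \<partial>M) = (\<Sum>j. \<integral>\<^sup>+x. ennreal (4 ^ j * (\<Delta> j x)\<^sup>2) \<partial>M)"
    by (rule nn_integral_suminf) measurable
  also have "\<dots> \<le> (\<Sum>j. ennreal (2 * (1/2) ^ j))"
  proof (rule suminf_le)
    fix j
    have "(\<integral>\<^sup>+x. ennreal (4 ^ j * (\<Delta> j x)\<^sup>2) \<partial>M) = ennreal (4 ^ j) * (\<integral>\<^sup>+x. ennreal ((\<Delta> j x)\<^sup>2) \<partial>M)"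
      by (simp add: ennreal_mult nn_integral_cmult)
    also have "\<dots> \<le> ennreal (4 ^ j) * (ennreal ((1/8) ^ Suc j) + ennreal ((1/8) ^ j))"
      unfolding \<Delta>_def by (rule mult_left_mono[OF order_trans[OF bound add_mono[OF N N]]]) simp
    also have "\<dots> = ennreal (4 ^ j * ((1/8) ^ Suc j + (1/8) ^ j))"
      by (subst ennreal_mult) (auto simp del: power_Suc)
    also have "\<dots> \<le> ennreal (2 * (1/2) ^ j)"
    proof (rule ennreal_leI)
      have "(1/8::real) ^ Suc j + (1/8) ^ j \<le> 2 * (1/8) ^ j" by simp
      then have "4 ^ j * ((1/8::real) ^ Suc j + (1/8) ^ j) \<le> 4 ^ j * (2 * (1/8) ^ j)"
        by (intro mult_left_mono) auto
      also have "\<dots> = 2 * (4 * (1/8)) ^ j" by (simp only: power_mult_distrib mult.left_commute)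
      finally show "4 ^ j * ((1/8::real) ^ Suc j + (1/8) ^ j) \<le> 2 * (1/2) ^ j" by simp
    qed
    finally show "(\<integral>\<^sup>+x. ennreal (4 ^ j * (\<Delta> j x)\<^sup>2) \<partial>M) \<le> ennreal (2 * (1/2) ^ j)" .
  qed auto
  also have "\<dots> = ennreal (\<Sum>j. 2 * (1/2) ^ j)"
    by (rule suminf_ennreal2) (auto intro: summable_mult summable_geometric)
  also have "\<dots> < \<infinity>" by simp
  finally have "AE x in M. (\<Sum>j. ennreal (4 ^ j * (\<Delta> j x)\<^sup>2)) \<noteq> \<infinity>"
    by (intro nn_integral_noteq_infinite) auto
  then have conv: "AE x in M. (\<lambda>j. g (N j) x) \<longlonglongrightarrow> lim (\<lambda>j. g (N j) x)"
  proof eventually_elim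
    case (elim x)
    define s where "s = enn2real (\<Sum>j. ennreal (4 ^ j * (\<Delta> j x)\<^sup>2))"
    have s: "s \<ge> 0" "(\<Sum>j. ennreal (4 ^ j * (\<Delta> j x)\<^sup>2)) = ennreal s"
      using elim by (simp_all add: s_def less_top)
    have le: "norm (\<Delta> j x) \<le> sqrt s * (1/2) ^ j" for j
    proof -
      have "ennreal (4 ^ j * (\<Delta> j x)\<^sup>2) \<le> ennreal s"
        using sum_le_suminf[of "\<lambda>j. ennreal (4 ^ j * (\<Delta> j x)\<^sup>2)" "{j}"] s(2) by auto
      then have "4 ^ j * (\<Delta> j x)\<^sup>2 \<le> s"
        using s(1) by (simp only: ennreal_le_iff)
      moreover have "(2 ^ j * \<Delta> j x)\<^sup>2 = 4 ^ j * (\<Delta> j x)\<^sup>2"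
        by (simp add: power_mult_distrib power2_eq_square flip: power_mult_distrib[of 2 2 j])
      ultimately have "(2 ^ j * \<Delta> j x)\<^sup>2 \<le> s" by simp
      then have "\<bar>2 ^ j * \<Delta> j x\<bar> \<le> sqrt s" by (intro real_le_rsqrt) simp
      then show ?thesis by (simp add: abs_mult power_divide field_simps)
    qed
    have "summable (\<lambda>j. \<Delta> j x)"
      by (rule summable_comparison_test[of _ "\<lambda>j. sqrt s * (1/2) ^ j"])
        (use le in \<open>auto intro: summable_mult summable_geometric\<close>)
    then have "convergent (\<lambda>n. (\<Sum>j<n. \<Delta> j x) + g (N 0) x)"
      by (intro convergent_add convergent_const) (simp add: summable_iff_convergent)
    moreover have "(\<Sum>j<n. \<Delta> j x) + g (N 0) x = g (N n) x" for n
      unfolding \<Delta>_def by (subst sum_lessThan_telescope[of "\<lambda>j. g (N j) x"]) simp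
    ultimately show ?case by (simp add: convergent_LIMSEQ_iff)
  qed
  define h where "h x = lim (\<lambda>j. g (N j) x)" for x
  have hm[measurable]: "h \<in> borel_measurable M"
    unfolding h_def[abs_def] by (rule borel_measurable_lim_metric) measurable
  have "(\<integral>\<^sup>+x. ennreal ((g k x - h x)\<^sup>2) \<partial>M) \<le> d k" for k
  proof -
    have "(\<integral>\<^sup>+x. ennreal ((g k x - h x)\<^sup>2) \<partial>M)
      = (\<integral>\<^sup>+x. liminf (\<lambda>j. ennreal ((g k x - g (N j) x)\<^sup>2)) \<partial>M)"
    proof (rule nn_integral_cong_AE)
      show "AE x in M. ennreal ((g k x - h x)\<^sup>2) = liminf (\<lambda>j. ennreal ((g k x - g (N j) x)\<^sup>2))"
        using conv
      proof eventually_elim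
        case (elim x)
        then have "(\<lambda>j. ennreal ((g k x - g (N j) x)\<^sup>2)) \<longlonglongrightarrow> ennreal ((g k x - h x)\<^sup>2)"
          unfolding h_def by (intro tendsto_intros tendsto_ennrealI)
        then show ?case using lim_imp_Liminf[of sequentially] by force
      qed
    qed
    also have "\<dots> \<le> liminf (\<lambda>j. \<integral>\<^sup>+x. ennreal ((g k x - g (N j) x)\<^sup>2) \<partial>M)"
      by (rule nn_integral_liminf) measurable
    also have "\<dots> \<le> liminf (\<lambda>j. d k + ennreal ((1/8) ^ j))"
      using order_trans[OF bound add_left_mono[OF N]] by (intro Liminf_mono always_eventually) auto
    also have "\<dots> = d k"
    proof -
      have "(\<lambda>j. ennreal ((1/8) ^ j)) \<longlonglongrightarrow> ennreal 0"
        by (intro tendsto_ennrealI LIMSEQ_power_zero) simp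
      from tendsto_add[OF tendsto_const this, of "d k"]
      have "(\<lambda>j. d k + ennreal ((1/8) ^ j)) \<longlonglongrightarrow> d k" by simp
      then show ?thesis by (intro lim_imp_Liminf) auto
    qed
    finally show ?thesis .
  qed
  from that[OF hm tendsto_0_le_ennreal[OF d this]] show ?thesis .
qed

section \<open>Traces on the hyperplane where the weight degenerates\<close>

lemma nn_integral_powr:
  fixes b h :: real
  assumes "-1 < b" "0 < h"
  shows "(\<integral>\<^sup>+y\<in>{0<..<h}. ennreal (y powr b) \<partial>lborel) = ennreal (h powr (b + 1) / (b + 1))"
proof -
  have "((\<lambda>y. y powr b) has_integral (h powr (b + 1) / (b + 1))) {0<..<h}"
    using has_integral_powr_from_0[of b h] assms by (simp add: has_integral_Icc_iff_Ioo)
  from nn_integral_has_integral_lebesgue[OF _ this]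
  have "(\<integral>\<^sup>+y. ennreal (indicator {0<..<h} y * y powr b) \<partial>lborel) = ennreal (h powr (b + 1) / (b + 1))"
    by simp
  then show ?thesis
    by (simp add: ennreal_mult' ennreal_indicator mult.commute)
qed

text \<open>With \<open>c\<close> the integral of \<open>y\<^sup>a\<close> and \<open>K\<close> that of \<open>y\<^bsup>-a\<^esup>\<close> over \<open>(0, h)\<close>, this is \<open>(2 + 2 c K) / c\<close>.\<close>

definition trace_const :: "real \<Rightarrow> real \<Rightarrow> real" where
  "trace_const a h =
     (2 + 2 * (h powr (a + 1) / (a + 1)) * (h powr (1 - a) / (1 - a))) / (h powr (a + 1) / (a + 1))"

text \<open>For every \<open>y\<close> in \<open>(0, h)\<close> the square of \<open>g 0\<close> is at most \<open>2 (g y)\<^sup>2\<close> plus twice the square of the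
  integral of \<open>|g'|\<close>. The Cauchy-Schwarz inequality with the weights \<open>y\<^sup>a\<close> and \<open>y\<^bsup>-a\<^esup>\<close> bounds the latter
  square by the weighted integral of \<open>g'\<^sup>2\<close>; it remains to average over \<open>y\<close> with weight \<open>y\<^sup>a\<close>.\<close>

lemma trace_inequality_1d:
  fixes g g' :: "real \<Rightarrow> real"
  assumes a: "-1 < a" "a < 1" and h: "0 < h"
    and g: "\<And>y. (g has_real_derivative g' y) (at y)" and cont: "continuous_on UNIV g'"
  shows "ennreal ((g 0)\<^sup>2) \<le> ennreal (trace_const a h) *
    (\<integral>\<^sup>+y\<in>{0<..<h}. ennreal (\<bar>y\<bar> powr a * ((g y)\<^sup>2 + (g' y)\<^sup>2)) \<partial>lborel)"
proof -
  define c where "c = h powr (a + 1) / (a + 1)"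
  define K where "K = h powr (1 - a) / (1 - a)"
  have c: "c > 0" and K: "K \<ge> 0" using a h by (simp_all add: c_def K_def)
  have [measurable]: "g' \<in> borel_measurable borel" "g \<in> borel_measurable borel"
    using cont continuous_on_real_deriv[OF g] by (auto intro: borel_measurable_continuous_onI)
  define J where "J = (\<integral>\<^sup>+y\<in>{0<..<h}. ennreal (\<bar>y\<bar> powr a * (g' y)\<^sup>2) \<partial>lborel)"
  define I where "I = (\<integral>\<^sup>+y\<in>{0<..<h}. ennreal (\<bar>y\<bar> powr a * (g y)\<^sup>2) \<partial>lborel)"
  define V where "V = (\<integral>\<^sup>+s\<in>{0<..<h}. ennreal \<bar>g' s\<bar> \<partial>lborel)"
  have incr: "ennreal \<bar>g y - g 0\<bar> \<le> V" if y: "y \<in> {0<..<h}" for y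
  proof -
    have "has_bochner_integral lborel (\<lambda>x. indicator {0..y} x *\<^sub>R g' x) (g y - g 0)"
      using y cont g by (intro has_bochner_integral_FTC_Icc)
        (auto simp: has_real_derivative_iff_has_vector_derivative[symmetric]
          intro: has_field_derivative_at_within continuous_on_subset)
    then have int: "integrable lborel (\<lambda>x. indicator {0..y} x *\<^sub>R g' x)"
      and eq: "g y - g 0 = (LINT x|lborel. indicator {0..y} x *\<^sub>R g' x)"
      by (auto simp: has_bochner_integral_iff)
    have "ennreal \<bar>g y - g 0\<bar> \<le> (\<integral>\<^sup>+x. ennreal (norm (indicator {0..y} x *\<^sub>R g' x)) \<partial>lborel)"
      using integral_norm_bound_ennreal[OF int] unfolding eq by simp
    also have "\<dots> \<le> V"
      unfolding V_def
    proof (rule nn_integral_mono_AE)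
      show "AE x in lborel. ennreal (norm (indicat_real {0..y} x *\<^sub>R g' x)) \<le> ennreal \<bar>g' x\<bar> * indicator {0<..<h} x"
        using AE_lborel_singleton[of 0] by eventually_elim (use y in \<open>auto simp: indicator_def\<close>)
    qed
    finally show ?thesis .
  qed
  have CS: "V\<^sup>2 \<le> ennreal K * J"
  proof -
    have "V = (\<integral>\<^sup>+s. (ennreal (s powr (- a / 2)) * indicator {0<..<h} s) *
          (ennreal (s powr (a / 2) * \<bar>g' s\<bar>) * indicator {0<..<h} s) \<partial>lborel)"
      unfolding V_def
    proof (rule nn_integral_cong)
      fix s :: real
      have "s powr (- a / 2) * (s powr (a / 2) * \<bar>g' s\<bar>) = \<bar>g' s\<bar>" if "s > 0"
        using that by (simp add: mult.assoc[symmetric] powr_add[symmetric])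
      then show "ennreal \<bar>g' s\<bar> * indicator {0<..<h} s = (ennreal (s powr (- a / 2)) * indicator {0<..<h} s) *
          (ennreal (s powr (a / 2) * \<bar>g' s\<bar>) * indicator {0<..<h} s)"
        by (auto simp: indicator_def ennreal_mult[symmetric])
    qed
    then have "V\<^sup>2 \<le> (\<integral>\<^sup>+s. (ennreal (s powr (- a / 2)) * indicator {0<..<h} s)\<^sup>2 \<partial>lborel) *
          (\<integral>\<^sup>+s. (ennreal (s powr (a / 2) * \<bar>g' s\<bar>) * indicator {0<..<h} s)\<^sup>2 \<partial>lborel)"
      using Cauchy_Schwarz_nn_integral[of "\<lambda>s. ennreal (s powr (- a / 2)) * indicator {0<..<h} s" lborel
        "\<lambda>s. ennreal (s powr (a / 2) * \<bar>g' s\<bar>) * indicator {0<..<h} s"] by simp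
    also have "(\<integral>\<^sup>+s. (ennreal (s powr (- a / 2)) * indicator {0<..<h} s)\<^sup>2 \<partial>lborel)
        = (\<integral>\<^sup>+s\<in>{0<..<h}. ennreal (s powr (- a)) \<partial>lborel)"
      by (rule nn_integral_cong)
        (auto simp: indicator_def ennreal_power power2_eq_square powr_add[symmetric] ennreal_mult[symmetric])
    also have "\<dots> = ennreal K"
      using nn_integral_powr[of "-a" h] a h by (simp add: K_def)
    also have "(\<integral>\<^sup>+s. (ennreal (s powr (a / 2) * \<bar>g' s\<bar>) * indicator {0<..<h} s)\<^sup>2 \<partial>lborel) = J"
      unfolding J_def
    proof (rule nn_integral_cong)
      fix s :: real
      have "(s powr (a / 2) * \<bar>g' s\<bar>)\<^sup>2 = \<bar>s\<bar> powr a * (g' s)\<^sup>2" if "s > 0"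
        using that by (simp add: power_mult_distrib powr_power)
      then show "(ennreal (s powr (a / 2) * \<bar>g' s\<bar>) * indicator {0<..<h} s)\<^sup>2
          = ennreal (\<bar>s\<bar> powr a * (g' s)\<^sup>2) * indicator {0<..<h} s"
        by (auto simp: indicator_def ennreal_power)
    qed
    finally show ?thesis .
  qed
  have pt: "ennreal ((g 0)\<^sup>2) * ennreal (\<bar>y\<bar> powr a)
      \<le> 2 * ennreal (\<bar>y\<bar> powr a * (g y)\<^sup>2) + 2 * (ennreal K * J) * ennreal (\<bar>y\<bar> powr a)"
    if y: "y \<in> {0<..<h}" for y
  proof -
    have "ennreal ((g y - g 0)\<^sup>2) = (ennreal \<bar>g y - g 0\<bar>)\<^sup>2" by (simp add: ennreal_power)
    also have "\<dots> \<le> V\<^sup>2" using incr[OF y] by (intro power_mono) auto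
    finally have le: "ennreal ((g y - g 0)\<^sup>2) \<le> ennreal K * J" using CS by (rule order_trans)
    have "ennreal ((g 0)\<^sup>2) \<le> ennreal (2 * (g y)\<^sup>2 + 2 * (g y - g 0)\<^sup>2)"
      using real_diff_square_le[of "g 0" 0 "g y"] by (intro ennreal_leI) (simp add: power2_commute)
    also have "\<dots> = 2 * ennreal ((g y)\<^sup>2) + 2 * ennreal ((g y - g 0)\<^sup>2)"
      by (simp add: ennreal_mult)
    also have "\<dots> \<le> 2 * ennreal ((g y)\<^sup>2) + 2 * (ennreal K * J)"
      using le by (intro add_left_mono mult_left_mono) auto
    finally have "ennreal ((g 0)\<^sup>2) * ennreal (\<bar>y\<bar> powr a)
        \<le> (2 * ennreal ((g y)\<^sup>2) + 2 * (ennreal K * J)) * ennreal (\<bar>y\<bar> powr a)"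
      by (rule mult_right_mono) simp
    moreover have "(2 * ennreal ((g y)\<^sup>2) + 2 * (ennreal K * J)) * ennreal (\<bar>y\<bar> powr a)
        = 2 * (ennreal ((g y)\<^sup>2) * ennreal (\<bar>y\<bar> powr a)) + 2 * (ennreal K * J) * ennreal (\<bar>y\<bar> powr a)"
      by (simp add: distrib_right mult.assoc)
    moreover have "ennreal (\<bar>y\<bar> powr a * (g y)\<^sup>2) = ennreal ((g y)\<^sup>2) * ennreal (\<bar>y\<bar> powr a)"
      by (simp add: ennreal_mult mult.commute)
    ultimately show ?thesis by (simp only:)
  qed
  have c_eq: "(\<integral>\<^sup>+y\<in>{0<..<h}. ennreal (\<bar>y\<bar> powr a) \<partial>lborel) = ennreal c"
  proof -
    have "(\<integral>\<^sup>+y\<in>{0<..<h}. ennreal (\<bar>y\<bar> powr a) \<partial>lborel) = (\<integral>\<^sup>+y\<in>{0<..<h}. ennreal (y powr a) \<partial>lborel)"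
      by (rule nn_integral_cong) (auto simp: indicator_def)
    then show ?thesis using nn_integral_powr[of a h] a h by (simp add: c_def)
  qed
  have "ennreal ((g 0)\<^sup>2) * ennreal c = (\<integral>\<^sup>+y. ennreal ((g 0)\<^sup>2) * (ennreal (\<bar>y\<bar> powr a) * indicator {0<..<h} y) \<partial>lborel)"
    unfolding c_eq[symmetric] by (rule nn_integral_cmult[symmetric]) measurable
  also have "\<dots> \<le> (\<integral>\<^sup>+y. 2 * (ennreal (\<bar>y\<bar> powr a * (g y)\<^sup>2) * indicator {0<..<h} y)
      + 2 * (ennreal K * J) * (ennreal (\<bar>y\<bar> powr a) * indicator {0<..<h} y) \<partial>lborel)"
    by (rule nn_integral_mono) (use pt in \<open>auto simp: indicator_def\<close>)
  also have "\<dots> = 2 * I + 2 * (ennreal K * J) * ennreal c"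
    unfolding c_eq[symmetric] I_def by (simp add: nn_integral_add nn_integral_cmult)
  also have "\<dots> \<le> ennreal (2 + 2 * c * K) * (I + J)"
  proof -
    have "ennreal (2 + 2 * c * K) = 2 + 2 * (ennreal c * ennreal K)"
      using c K by (simp add: ennreal_mult mult.assoc)
    moreover have "2 * I \<le> 2 * (I + J)"
      by (intro mult_left_mono) auto
    moreover have "2 * (ennreal K * J) * ennreal c \<le> 2 * (ennreal c * ennreal K) * (I + J)"
    proof -
      have "2 * (ennreal K * J) * ennreal c = 2 * (ennreal c * ennreal K) * J" by (simp add: mult_ac)
      also have "\<dots> \<le> 2 * (ennreal c * ennreal K) * (I + J)" by (intro mult_left_mono) auto
      finally show ?thesis .
    qed
    ultimately show ?thesis by (simp only: distrib_right[of 2] add_mono)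
  qed
  also have "I + J = (\<integral>\<^sup>+y\<in>{0<..<h}. ennreal (\<bar>y\<bar> powr a * ((g y)\<^sup>2 + (g' y)\<^sup>2)) \<partial>lborel)" (is "_ = ?S")
    unfolding I_def J_def
    by (subst nn_integral_add[symmetric])
      (auto intro!: nn_integral_cong simp: indicator_def distrib_left)
  finally have le: "ennreal ((g 0)\<^sup>2) * ennreal c \<le> ennreal (2 + 2 * c * K) * ?S" .
  have "ennreal ((g 0)\<^sup>2) = ennreal (1 / c) * (ennreal ((g 0)\<^sup>2) * ennreal c)"
    using c by (simp add: ennreal_mult[symmetric])
  also have "\<dots> \<le> ennreal (1 / c) * (ennreal (2 + 2 * c * K) * ?S)"
    using le by (intro mult_left_mono) auto
  also have "\<dots> = ennreal (trace_const a h) * ?S"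
  proof -
    have "trace_const a h = 1 / c * (2 + 2 * c * K)"
      unfolding trace_const_def c_def K_def by simp
    then have "ennreal (trace_const a h) = ennreal (1 / c) * ennreal (2 + 2 * c * K)"
      using c K by (simp only:) (rule ennreal_mult, auto)
    then show ?thesis by (simp only: mult.assoc)
  qed
  finally show ?thesis .
qed

lemma smooth_fun_line:
  fixes f :: "'n::finite space \<Rightarrow> real"
  assumes f: "smooth_fun f"
  shows "((\<lambda>y. f (x, y)) has_real_derivative classical_grad f (x, y) \<bullet> (0, 1)) (at y)"
proof -
  have "((\<lambda>y. (x, y)) has_derivative (\<lambda>v. (0, v))) (at y)"
    by (intro derivative_eq_intros) auto
  from diff_chain_at[OF this has_derivative_classical_grad[OF f]]
  have "((\<lambda>y. f (x, y)) has_derivative (\<lambda>v. classical_grad f (x, y) \<bullet> (0, v))) (at y)"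
    by (simp add: o_def)
  moreover have "(\<lambda>v. classical_grad f (x, y) \<bullet> (0, v)) = (*) (classical_grad f (x, y) \<bullet> (0, 1))"
    by (simp add: inner_prod_def fun_eq_iff)
  ultimately show ?thesis by (simp add: has_field_derivative_def)
qed

text \<open>The one-dimensional inequality on each vertical segment, integrated over its base point.\<close>

lemma trace_inequality_space:
  fixes f :: "'n::finite space \<Rightarrow> real"
  assumes a: "-1 < a" "a < 1" and h: "0 < h" and f: "smooth_fun f" and A: "A \<in> sets borel"
  shows "(\<integral>\<^sup>+x\<in>A. ennreal ((f (x, 0))\<^sup>2) \<partial>lborel) \<le> ennreal (trace_const a h) *
    (\<integral>\<^sup>+X\<in>A \<times> {0<..<h}. ennreal (wt a X * ((f X)\<^sup>2 + (norm (classical_grad f X))\<^sup>2)) \<partial>lborel)"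
proof -
  define F where "F X = ennreal (wt a X * ((f X)\<^sup>2 + (norm (classical_grad f X))\<^sup>2)) * indicator (A \<times> {0<..<h}) X" for X
  have [measurable]: "f \<in> borel_measurable borel" "classical_grad f \<in> borel_measurable borel"
    "(wt a :: 'n space \<Rightarrow> real) \<in> borel_measurable borel" "A \<times> {0<..<h} \<in> sets borel"
    using smooth_fun_measurable[OF f] classical_grad_measurable[OF f] wt_measurable A
    by (auto simp: borel_Times)
  have Fm: "F \<in> borel_measurable (lborel \<Otimes>\<^sub>M lborel)"
    unfolding lborel_prod F_def[abs_def] by simp
  have "(\<integral>\<^sup>+x\<in>A. ennreal ((f (x, 0))\<^sup>2) \<partial>lborel) \<le> (\<integral>\<^sup>+x. ennreal (trace_const a h) * (\<integral>\<^sup>+y. F (x, y) \<partial>lborel) \<partial>lborel)"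
  proof (rule nn_integral_mono)
    fix x
    show "ennreal ((f (x, 0))\<^sup>2) * indicator A x \<le> ennreal (trace_const a h) * (\<integral>\<^sup>+y. F (x, y) \<partial>lborel)"
    proof (cases "x \<in> A")
      case True
      have "continuous_on UNIV (\<lambda>y. frechet_derivative f (at (x, y)) (0, 1))"
        by (rule continuous_on_compose2[OF smooth_fun_continuous[OF smooth_fun_frechet[OF f], of UNIV]])
          (auto intro!: continuous_intros)
      then have "continuous_on UNIV (\<lambda>y. classical_grad f (x, y) \<bullet> (0, 1))"
        by (simp only: frechet_derivative_eq_grad[OF f])
      from trace_inequality_1d[OF a h smooth_fun_line[OF f] this]
      have "ennreal ((f (x, 0))\<^sup>2) \<le> ennreal (trace_const a h) * (\<integral>\<^sup>+y\<in>{0<..<h}. ennreal (\<bar>y\<bar> powr a *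
          ((f (x, y))\<^sup>2 + (classical_grad f (x, y) \<bullet> (0, 1))\<^sup>2)) \<partial>lborel)" .
      also have "\<dots> \<le> ennreal (trace_const a h) * (\<integral>\<^sup>+y. F (x, y) \<partial>lborel)"
      proof (intro mult_left_mono nn_integral_mono)
        fix y
        have "\<bar>classical_grad f (x, y) \<bullet> (0, 1)\<bar> \<le> norm (classical_grad f (x, y))"
          using Cauchy_Schwarz_ineq2[of "classical_grad f (x, y)" "(0, 1)"] by (simp add: norm_prod_def)
        then have "(classical_grad f (x, y) \<bullet> (0, 1))\<^sup>2 \<le> (norm (classical_grad f (x, y)))\<^sup>2"
          by (rule abs_le_square_iff[THEN iffD1, OF order_trans]) simp
        then show "ennreal (\<bar>y\<bar> powr a * ((f (x, y))\<^sup>2 + (classical_grad f (x, y) \<bullet> (0, 1))\<^sup>2)) * indicator {0<..<h} y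
            \<le> F (x, y)"
          unfolding F_def wt_def using True
          by (auto simp: indicator_def intro!: ennreal_leI mult_left_mono)
      qed simp
      finally show ?thesis using True by simp
    qed simp
  qed
  also have "\<dots> = ennreal (trace_const a h) * (\<integral>\<^sup>+x. \<integral>\<^sup>+y. F (x, y) \<partial>lborel \<partial>lborel)"
    using lborel.borel_measurable_nn_integral_fst[OF Fm] by (rule nn_integral_cmult)
  also have "(\<integral>\<^sup>+x. \<integral>\<^sup>+y. F (x, y) \<partial>lborel \<partial>lborel) = integral\<^sup>N lborel F"
    unfolding lborel.nn_integral_fst[OF Fm] lborel_prod ..
  finally show ?thesis unfolding F_def .
qed

lemma smooth_fun_time_slice:
  fixes f :: "'n::finite spacetime \<Rightarrow> real"
  assumes "smooth_fun f"
  shows "smooth_fun (\<lambda>X. f (X, t))" "classical_grad (\<lambda>X. f (X, t)) X = fst (classical_grad f (X, t))"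
proof -
  show "smooth_fun (\<lambda>X. f (X, t))"
  proof (rule smooth_fun_compose[OF _ assms])
    fix b :: "'n spacetime"
    have "smooth_fun (\<lambda>X. X \<bullet> fst b + t * snd b)"
      by (intro smooth_fun_add smooth_fun_const smooth_fun_bounded_linear bounded_linear_inner_left)
    then show "smooth_fun (\<lambda>X. (X, t) \<bullet> b)" by (simp add: inner_prod_def)
  qed
  have "((\<lambda>X. (X, t)) has_derivative (\<lambda>v. (v, 0))) (at X)"
    by (intro derivative_eq_intros) auto
  from diff_chain_at[OF this has_derivative_classical_grad[OF assms]]
  show "classical_grad (\<lambda>X. f (X, t)) X = fst (classical_grad f (X, t))"
    by (intro classical_gradI) (simp add: o_def inner_prod_def)
qed

lemma norm_fst_snd_square: "(norm z)\<^sup>2 = (norm (fst z))\<^sup>2 + (norm (snd z))\<^sup>2"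
  by (simp add: norm_prod_def)

lemma nn_integral_lborel_snd:
  fixes F :: "'a::euclidean_space \<times> 'b::euclidean_space \<Rightarrow> ennreal"
  assumes "F \<in> borel_measurable lborel"
  shows "integral\<^sup>N lborel F = (\<integral>\<^sup>+t. \<integral>\<^sup>+x. F (x, t) \<partial>lborel \<partial>lborel)"
    "(\<lambda>t. \<integral>\<^sup>+x. F (x, t) \<partial>lborel) \<in> borel_measurable lborel"
proof -
  have Fm: "F \<in> borel_measurable (lborel \<Otimes>\<^sub>M lborel)" using assms by (simp add: lborel_prod)
  show "integral\<^sup>N lborel F = (\<integral>\<^sup>+t. \<integral>\<^sup>+x. F (x, t) \<partial>lborel \<partial>lborel)"
    using lborel_pair.nn_integral_snd[OF Fm] by (simp add: lborel_prod)
  show "(\<lambda>t. \<integral>\<^sup>+x. F (x, t) \<partial>lborel) \<in> borel_measurable lborel"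
    using lborel.borel_measurable_nn_integral_fst[OF measurable_pair_swap[OF Fm]] by simp
qed

lemma smooth_fun_at_y0_measurable:
  fixes f :: "'n::finite spacetime \<Rightarrow> real"
  assumes "smooth_fun f"
  shows "(\<lambda>p. f ((fst p, 0), snd p)) \<in> borel_measurable borel"
  by (intro borel_measurable_continuous_onI
      continuous_on_compose2[OF smooth_fun_continuous[OF assms, of UNIV]] continuous_intros) auto

lemma trace_inequality_spacetime:
  fixes f :: "'n::finite spacetime \<Rightarrow> real"
  assumes a: "-1 < a" "a < 1" and h: "0 < h" and f: "smooth_fun f"
    and A: "A \<in> sets borel" and T: "T \<in> sets borel"
  shows "(\<integral>\<^sup>+p\<in>A \<times> T. ennreal ((f ((fst p, 0), snd p))\<^sup>2) \<partial>lborel) \<le> ennreal (trace_const a h) *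
    (\<integral>\<^sup>+z\<in>(A \<times> {0<..<h}) \<times> T. ennreal (wt_time a z * ((f z)\<^sup>2 + (norm (classical_grad f z))\<^sup>2)) \<partial>lborel)"
proof -
  define F where "F z = ennreal (wt_time a z * ((f z)\<^sup>2 + (norm (classical_grad f z))\<^sup>2)) *
    indicator ((A \<times> {0<..<h}) \<times> T) z" for z
  have [measurable]: "f \<in> borel_measurable borel" "classical_grad f \<in> borel_measurable borel"
    "(wt_time a :: 'n spacetime \<Rightarrow> real) \<in> borel_measurable borel"
    "(A \<times> {0<..<h}) \<times> T \<in> sets borel" "A \<times> T \<in> sets borel"
    using smooth_fun_measurable[OF f] classical_grad_measurable[OF f] wt_time_measurable A T
    by (auto simp: borel_Times)
  have Fm: "F \<in> borel_measurable lborel"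
    unfolding F_def[abs_def] by simp
  have "(\<integral>\<^sup>+p\<in>A \<times> T. ennreal ((f ((fst p, 0), snd p))\<^sup>2) \<partial>lborel)
    = (\<integral>\<^sup>+t. \<integral>\<^sup>+x. ennreal ((f ((x, 0), t))\<^sup>2) * indicator (A \<times> T) (x, t) \<partial>lborel \<partial>lborel)"
    using smooth_fun_at_y0_measurable[OF f] by (subst nn_integral_lborel_snd) auto
  also have "\<dots> \<le> (\<integral>\<^sup>+t. ennreal (trace_const a h) * (\<integral>\<^sup>+X. F (X, t) \<partial>lborel) \<partial>lborel)"
  proof (rule nn_integral_mono)
    fix t
    show "(\<integral>\<^sup>+x. ennreal ((f ((x, 0), t))\<^sup>2) * indicator (A \<times> T) (x, t) \<partial>lborel)
      \<le> ennreal (trace_const a h) * (\<integral>\<^sup>+X. F (X, t) \<partial>lborel)"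
    proof (cases "t \<in> T")
      case True
      have "(\<integral>\<^sup>+x. ennreal ((f ((x, 0), t))\<^sup>2) * indicator (A \<times> T) (x, t) \<partial>lborel)
        = (\<integral>\<^sup>+x\<in>A. ennreal ((f ((x, 0), t))\<^sup>2) \<partial>lborel)"
        by (rule nn_integral_cong) (use True in \<open>auto simp: indicator_def\<close>)
      also have "\<dots> \<le> ennreal (trace_const a h) *
        (\<integral>\<^sup>+X\<in>A \<times> {0<..<h}. ennreal (wt a X * ((f (X, t))\<^sup>2 + (norm (fst (classical_grad f (X, t))))\<^sup>2)) \<partial>lborel)"
        using trace_inequality_space[OF a h smooth_fun_time_slice(1)[OF f, of t] A]
        unfolding smooth_fun_time_slice(2)[OF f] .
      also have "\<dots> \<le> ennreal (trace_const a h) * (\<integral>\<^sup>+X. F (X, t) \<partial>lborel)"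
      proof (intro mult_left_mono nn_integral_mono)
        fix X
        have "wt a X * ((f (X, t))\<^sup>2 + (norm (fst (classical_grad f (X, t))))\<^sup>2)
          \<le> wt_time a (X, t) * ((f (X, t))\<^sup>2 + (norm (classical_grad f (X, t)))\<^sup>2)"
          unfolding norm_fst_snd_square[of "classical_grad f (X, t)"]
          by (auto simp: wt_time_def intro!: mult_left_mono wt_nonneg)
        then show "ennreal (wt a X * ((f (X, t))\<^sup>2 + (norm (fst (classical_grad f (X, t))))\<^sup>2)) *
            indicator (A \<times> {0<..<h}) X \<le> F (X, t)"
          unfolding F_def using True by (auto simp: indicator_def intro!: ennreal_leI)
      qed simp
      finally show ?thesis .
    qed (simp add: indicator_def)
  qed
  also have "\<dots> = ennreal (trace_const a h) * (\<integral>\<^sup>+t. \<integral>\<^sup>+X. F (X, t) \<partial>lborel \<partial>lborel)"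
    using nn_integral_lborel_snd(2)[OF Fm] by (rule nn_integral_cmult)
  also have "(\<integral>\<^sup>+t. \<integral>\<^sup>+X. F (X, t) \<partial>lborel \<partial>lborel) = integral\<^sup>N lborel F"
    by (rule nn_integral_lborel_snd(1)[OF Fm, symmetric])
  finally show ?thesis unfolding F_def .
qed

text \<open>By the trace inequality for the differences, the restrictions of an approximating sequence to the
  hyperplane form a Cauchy sequence in L2.\<close>

lemma has_space_trace_y0_space_trace:
  fixes U0 :: "'n::finite space \<Rightarrow> real"
  assumes a: "-1 < a" "a < 1" and U0: "U0 \<in> H1 (wt a) UNIV"
  shows "has_space_trace_y0 a U0 (space_trace_y0 a U0)"
proof -
  obtain f where f: "\<And>k. smooth_fun (f k)" and H: "H1_tendsto (wt a) UNIV f U0"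
    using U0 unfolding H1_def by blast
  obtain G where G: "is_weak_grad UNIV U0 G" and lim: "(\<lambda>k. H1_dist (wt a) UNIV (f k) U0 G) \<longlonglongrightarrow> 0"
    using H unfolding H1_tendsto_iff by blast
  define C where "C = ennreal (trace_const a 1)"
  define d where "d k = C * 2 * H1_dist (wt a) UNIV (f k) U0 G" for k
  have d0: "d \<longlonglongrightarrow> 0"
    using tendsto_mult_ennreal[OF tendsto_const lim, of "C * 2"]
    by (simp add: d_def[abs_def] C_def ennreal_mult_eq_top_iff)
  have bound: "(\<integral>\<^sup>+x. ennreal ((f j (x, 0) - f k (x, 0))\<^sup>2) \<partial>lborel) \<le> d j + d k" for j k
  proof -
    have "(\<integral>\<^sup>+x\<in>UNIV. ennreal ((f j (x, 0) - f k (x, 0))\<^sup>2) \<partial>lborel) \<le> C *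
      (\<integral>\<^sup>+X\<in>UNIV \<times> {0<..<1}. ennreal (wt a X * ((f j X - f k X)\<^sup>2 + (norm (classical_grad (\<lambda>X. f j X - f k X) X))\<^sup>2)) \<partial>lborel)"
      unfolding C_def by (rule trace_inequality_space[OF a _ smooth_fun_diff[OF f f]]) auto
    also have "\<dots> \<le> C * (\<integral>\<^sup>+X\<in>UNIV. ennreal (wt a X * ((f j X - f k X)\<^sup>2 + (norm (classical_grad (\<lambda>X. f j X - f k X) X))\<^sup>2)) \<partial>lborel)"
      by (intro mult_left_mono nn_set_integral_set_mono) auto
    also have "\<dots> \<le> C * (2 * (H1_dist (wt a) UNIV (f j) U0 G + H1_dist (wt a) UNIV (f k) U0 G))"
      by (intro mult_left_mono H1_dist_diff_le f wt_measurable wt_nonneg G) auto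
    finally show ?thesis by (simp add: d_def distrib_left mult.assoc)
  qed
  have "(\<lambda>x. f k (x, 0)) \<in> borel_measurable borel" for k
    by (intro borel_measurable_continuous_onI
        continuous_on_compose2[OF smooth_fun_continuous[OF f, of UNIV]] continuous_intros) auto
  then have m: "(\<lambda>x. f k (x, 0)) \<in> borel_measurable lborel" for k by simp
  obtain u where "u \<in> borel_measurable lborel"
    "(\<lambda>k. \<integral>\<^sup>+x. ennreal ((f k (x, 0) - u x)\<^sup>2) \<partial>lborel) \<longlonglongrightarrow> 0"
    by (rule L2_complete[OF m d0 bound]) (rule that)
  then have "has_space_trace_y0 a U0 u"
    unfolding has_space_trace_y0_def using f H by blast
  then show ?thesis
    unfolding space_trace_y0_def by (rule someI[of "has_space_trace_y0 a U0"])
qed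

lemma set_diff_square_indicator:
  "(\<integral>\<^sup>+p\<in>A. ennreal ((F p - u p)\<^sup>2) \<partial>M)
    = (\<integral>\<^sup>+p. ennreal ((indicator A p *\<^sub>R F p - indicator A p *\<^sub>R u p)\<^sup>2) \<partial>M)" for F u :: "'a \<Rightarrow> real"
  by (rule nn_integral_cong) (auto simp: indicator_def)

lemma L2_limits_AE_eq:
  fixes f g :: "nat \<Rightarrow> 'a \<Rightarrow> real"
  assumes [measurable]: "u \<in> borel_measurable M" "v \<in> borel_measurable M"
    "\<And>k. f k \<in> borel_measurable M" "\<And>k. g k \<in> borel_measurable M"
    and lim: "(\<lambda>k. \<integral>\<^sup>+x. ennreal ((f k x - u x)\<^sup>2) \<partial>M) \<longlonglongrightarrow> 0"
    "(\<lambda>k. \<integral>\<^sup>+x. ennreal ((g k x - v x)\<^sup>2) \<partial>M) \<longlonglongrightarrow> 0"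
    "(\<lambda>k. \<integral>\<^sup>+x. ennreal ((f k x - g k x)\<^sup>2) \<partial>M) \<longlonglongrightarrow> 0"
  shows "AE x in M. u x = v x"
proof -
  define d where "d k = 2 * (\<integral>\<^sup>+x. ennreal ((f k x - u x)\<^sup>2) \<partial>M) + 4 * (\<integral>\<^sup>+x. ennreal ((g k x - v x)\<^sup>2) \<partial>M)
    + 4 * (\<integral>\<^sup>+x. ennreal ((f k x - g k x)\<^sup>2) \<partial>M)" for k
  have "d \<longlonglongrightarrow> 2 * 0 + 4 * 0 + 4 * 0"
    unfolding d_def[abs_def] by (intro tendsto_add tendsto_mult_ennreal tendsto_const lim) auto
  moreover have "(\<integral>\<^sup>+x. ennreal ((u x - v x)\<^sup>2) \<partial>M) \<le> d k" for k
  proof -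
    have "(\<integral>\<^sup>+x. ennreal ((u x - v x)\<^sup>2) \<partial>M) \<le> (\<integral>\<^sup>+x. 2 * ennreal ((f k x - u x)\<^sup>2)
        + 4 * ennreal ((g k x - v x)\<^sup>2) + 4 * ennreal ((f k x - g k x)\<^sup>2) \<partial>M)"
    proof (rule nn_integral_mono)
      fix x
      have "(u x - v x)\<^sup>2 \<le> 2 * (f k x - u x)\<^sup>2 + 4 * (g k x - v x)\<^sup>2 + 4 * (f k x - g k x)\<^sup>2"
        using real_diff_square_le[of "u x" "v x" "f k x"] real_diff_square_le[of "v x" "f k x" "g k x"]
        by (simp add: power2_commute)
      then have "ennreal ((u x - v x)\<^sup>2) \<le> ennreal (2 * (f k x - u x)\<^sup>2 + 4 * (g k x - v x)\<^sup>2 + 4 * (f k x - g k x)\<^sup>2)"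
        by (rule ennreal_leI)
      also have "\<dots> = 2 * ennreal ((f k x - u x)\<^sup>2)
        + 4 * ennreal ((g k x - v x)\<^sup>2) + 4 * ennreal ((f k x - g k x)\<^sup>2)"
        by (simp add: ennreal_mult)
      finally show "ennreal ((u x - v x)\<^sup>2) \<le> \<dots>" .
    qed
    also have "\<dots> = d k" unfolding d_def by (simp add: nn_integral_add nn_integral_cmult)
    finally show ?thesis .
  qed
  ultimately have "(\<integral>\<^sup>+x. ennreal ((u x - v x)\<^sup>2) \<partial>M) \<le> 0"
    by (intro tendsto_lowerbound[of d]) (auto intro: always_eventually)
  then have "(\<integral>\<^sup>+x. ennreal ((u x - v x)\<^sup>2) \<partial>M) = 0" by simp
  then have "AE x in M. ennreal ((u x - v x)\<^sup>2) = 0"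
    by (subst (asm) nn_integral_0_iff_AE) auto
  then show ?thesis by eventually_elim simp
qed

text \<open>The trace inequality needs room above the hyperplane, hence the doubled radius.\<close>

lemma trace_diff_le_H1_dist:
  fixes f g :: "'n::finite spacetime \<Rightarrow> real"
  assumes a: "-1 < a" "a < 1" and R: "0 < R" and f: "smooth_fun f" and g: "smooth_fun g"
    and G: "is_weak_grad (Qplus (2 * R)) U G"
  shows "(\<integral>\<^sup>+p\<in>ball 0 R \<times> {0<..<R\<^sup>2}. ennreal ((f ((fst p, 0), snd p) - g ((fst p, 0), snd p))\<^sup>2) \<partial>lborel)
    \<le> ennreal (trace_const a R) * 2 * H1_dist (wt_time a) (Qplus (2 * R)) f U G
      + ennreal (trace_const a R) * 2 * H1_dist (wt_time a) (Qplus (2 * R)) g U G"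
proof -
  have sub: "(ball 0 R \<times> {0<..<R}) \<times> {0<..<R\<^sup>2} \<subseteq> (Qplus (2 * R) :: 'n spacetime set)"
  proof -
    have "norm (x, y) < 2 * R" if "norm x < R" "0 < y" "y < R" for x :: "real ^ 'n" and y :: real
      using norm_Pair_le[of x y] that by simp
    moreover have "R\<^sup>2 \<le> (2 * R)\<^sup>2" using R by (intro power_mono) auto
    ultimately show ?thesis unfolding Qplus_def by (auto simp del: power_mult_distrib)
  qed
  define D where "D S = (\<integral>\<^sup>+z\<in>S. ennreal (wt_time a z *
    ((f z - g z)\<^sup>2 + (norm (classical_grad (\<lambda>z. f z - g z) z))\<^sup>2)) \<partial>lborel)" for S
  have "(\<integral>\<^sup>+p\<in>ball 0 R \<times> {0<..<R\<^sup>2}. ennreal ((f ((fst p, 0), snd p) - g ((fst p, 0), snd p))\<^sup>2) \<partial>lborel)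
    \<le> ennreal (trace_const a R) * D ((ball 0 R \<times> {0<..<R}) \<times> {0<..<R\<^sup>2})"
    unfolding D_def by (rule trace_inequality_spacetime[OF a R smooth_fun_diff[OF f g]]) auto
  also have "\<dots> \<le> ennreal (trace_const a R) * D (Qplus (2 * R))"
    unfolding D_def by (intro mult_left_mono nn_set_integral_set_mono sub) simp
  also have "\<dots> \<le> ennreal (trace_const a R) *
      (2 * (H1_dist (wt_time a) (Qplus (2 * R)) f U G + H1_dist (wt_time a) (Qplus (2 * R)) g U G))"
    unfolding D_def
    by (intro mult_left_mono H1_dist_diff_le f g wt_time_measurable wt_nonneg G open_Qplus) simp
  finally show ?thesis by (simp add: distrib_left mult.assoc)
qed

lemma tendsto_0_scaled:
  assumes "d \<longlonglongrightarrow> 0"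
  shows "(\<lambda>k. ennreal C * 2 * d k) \<longlonglongrightarrow> 0"
  using tendsto_mult_ennreal[OF tendsto_const assms, of "ennreal C * 2"]
  by (simp add: ennreal_mult_eq_top_iff)

lemma local_trace_unique:
  fixes f g :: "nat \<Rightarrow> 'n::finite spacetime \<Rightarrow> real"
  assumes a: "-1 < a" "a < 1" and R: "0 < R"
    and f: "\<And>k. smooth_fun (f k)" "H1_tendsto (wt_time a) (Qplus (2 * R)) f U"
    and g: "\<And>k. smooth_fun (g k)" "H1_tendsto (wt_time a) (Qplus (2 * R)) g U"
    and u: "(\<lambda>p. indicator (ball 0 R \<times> {0<..<R\<^sup>2}) p *\<^sub>R u p) \<in> borel_measurable lborel"
    and v: "(\<lambda>p. indicator (ball 0 R \<times> {0<..<R\<^sup>2}) p *\<^sub>R v p) \<in> borel_measurable lborel"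
    and fu: "(\<lambda>k. \<integral>\<^sup>+p\<in>ball 0 R \<times> {0<..<R\<^sup>2}. ennreal ((f k ((fst p, 0), snd p) - u p)\<^sup>2) \<partial>lborel) \<longlonglongrightarrow> 0"
    and gv: "(\<lambda>k. \<integral>\<^sup>+p\<in>ball 0 R \<times> {0<..<R\<^sup>2}. ennreal ((g k ((fst p, 0), snd p) - v p)\<^sup>2) \<partial>lborel) \<longlonglongrightarrow> 0"
  shows "AE p in lborel. p \<in> ball 0 R \<times> {0<..<R\<^sup>2} \<longrightarrow> u p = v p"
proof -
  let ?A = "ball 0 R \<times> {0<..<R\<^sup>2} :: ((real ^ 'n) \<times> real) set"
  obtain G where G: "is_weak_grad (Qplus (2 * R)) U G"
    using f(2) unfolding H1_tendsto_iff by blast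
  note lim = H1_tendsto_H1_dist[OF _ G open_Qplus]
  have fg: "(\<lambda>k. \<integral>\<^sup>+p\<in>?A. ennreal ((f k ((fst p, 0), snd p) - g k ((fst p, 0), snd p))\<^sup>2) \<partial>lborel) \<longlonglongrightarrow> 0"
  proof (rule tendsto_0_le_ennreal)
    show "(\<lambda>k. ennreal (trace_const a R) * 2 * H1_dist (wt_time a) (Qplus (2 * R)) (f k) U G
      + ennreal (trace_const a R) * 2 * H1_dist (wt_time a) (Qplus (2 * R)) (g k) U G) \<longlonglongrightarrow> 0"
      using tendsto_add[OF tendsto_0_scaled[OF lim[OF f(2)]] tendsto_0_scaled[OF lim[OF g(2)]]]
      by simp
  qed (rule trace_diff_le_H1_dist[OF a R f(1) g(1) G])
  have [measurable]: "?A \<in> sets borel" by (auto simp: borel_Times)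
  have m: "(\<lambda>p. indicator ?A p *\<^sub>R h ((fst p, 0), snd p)) \<in> borel_measurable lborel"
    if "smooth_fun h" for h :: "'n spacetime \<Rightarrow> real"
    using smooth_fun_at_y0_measurable[OF that] by measurable
  have "AE p in lborel. indicator ?A p *\<^sub>R u p = indicator ?A p *\<^sub>R v p"
    by (rule L2_limits_AE_eq[OF u v m[OF f(1)] m[OF g(1)]])
      (use fu gv fg in \<open>simp_all only: set_diff_square_indicator\<close>)
  then show ?thesis by eventually_elim (auto simp: indicator_def split: if_splits)
qed

lemma has_trace_y0_unique:
  assumes a: "-1 < a" "a < 1" and u: "has_trace_y0 a U u" and v: "has_trace_y0 a U v"
  shows "AE p in lborel. p \<in> later \<longrightarrow> u p = v p"
proof -
  have loc: "AE p in lborel. p \<in> ball 0 R \<times> {0<..<R\<^sup>2} \<longrightarrow> u p = v p" if R: "0 < R" for R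
  proof -
    let ?A = "ball 0 R \<times> {0<..<R\<^sup>2} :: ((real ^ 'a) \<times> real) set"
    have R2: "0 < 2 * R" using R by simp
    obtain f where f: "\<And>k. smooth_fun (f k)" "H1_tendsto (wt_time a) (Qplus (2 * R)) f U"
      "(\<lambda>k. \<integral>\<^sup>+p\<in>ball 0 (2 * R) \<times> {0<..<(2 * R)\<^sup>2}. ennreal ((f k ((fst p, 0), snd p) - u p)\<^sup>2) \<partial>lborel) \<longlonglongrightarrow> 0"
      using u R2 unfolding has_trace_y0_def by meson
    obtain g where g: "\<And>k. smooth_fun (g k)" "H1_tendsto (wt_time a) (Qplus (2 * R)) g U"
      "(\<lambda>k. \<integral>\<^sup>+p\<in>ball 0 (2 * R) \<times> {0<..<(2 * R)\<^sup>2}. ennreal ((g k ((fst p, 0), snd p) - v p)\<^sup>2) \<partial>lborel) \<longlonglongrightarrow> 0"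
      using v R2 unfolding has_trace_y0_def by meson
    have "R\<^sup>2 \<le> (2 * R)\<^sup>2" using R by (intro power_mono) auto
    then have sub: "?A \<subseteq> ball 0 (2 * R) \<times> {0<..<(2 * R)\<^sup>2}"
      using R by (auto simp del: power_mult_distrib)
    have m: "(\<lambda>p. indicator ?A p *\<^sub>R w p) \<in> borel_measurable lborel"
      if "set_borel_measurable lborel later w" for w :: "_ \<Rightarrow> real"
    proof -
      have "?A \<in> sets borel" by (auto simp: borel_Times)
      moreover have "?A \<subseteq> later" by auto
      ultimately show ?thesis
        using set_borel_measurable_subset[OF that, of ?A] by (simp add: set_borel_measurable_def)
    qed
    show ?thesis
    proof (rule local_trace_unique[OF a R f(1,2) g(1,2)])
      show "(\<lambda>p. indicator ?A p *\<^sub>R u p) \<in> borel_measurable lborel"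
        "(\<lambda>p. indicator ?A p *\<^sub>R v p) \<in> borel_measurable lborel"
        by (rule m[OF u[unfolded has_trace_y0_def, THEN conjunct1]],
            rule m[OF v[unfolded has_trace_y0_def, THEN conjunct1]])
    qed (rule tendsto_0_le_ennreal[OF f(3) nn_set_integral_set_mono[OF sub]]
        tendsto_0_le_ennreal[OF g(3) nn_set_integral_set_mono[OF sub]])+
  qed
  have "AE p in lborel. \<forall>n. p \<in> ball 0 (real (Suc n)) \<times> {0<..<(real (Suc n))\<^sup>2} \<longrightarrow> u p = v p"
    unfolding AE_all_countable by (intro allI loc) simp
  then show ?thesis
    unfolding exhaust_ball_interval[symmetric] by eventually_elim blast
qed

text \<open>Each cylinder needs its own approximating sequence, taken on the cylinder of twice its size. Local
  uniqueness makes the resulting traces compatible, and they are glued to a single function.\<close>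

theorem has_trace_y0_trace:
  fixes U :: "'n::finite spacetime \<Rightarrow> real"
  assumes a: "-1 < a" "a < 1" and U: "U \<in> UU a"
  shows "has_trace_y0 a U (trace_y0 a U)"
proof -
  define A :: "nat \<Rightarrow> ((real ^ 'n) \<times> real) set"
    where "A n = ball 0 (real (Suc n)) \<times> {0<..<(real (Suc n))\<^sup>2}" for n
  have Am: "A n \<in> sets borel" for n by (auto simp: A_def borel_Times)
  have inc: "incseq A"
    unfolding A_def by (intro incseq_SucI Sigma_mono subset_ball
        greaterThanLessThan_subseteq_greaterThanLessThan[THEN iffD2] power_mono impI conjI) auto
  define approx where "approx n f u \<longleftrightarrow> (\<forall>k. smooth_fun (f k)) \<and>
      H1_tendsto (wt_time a) (Qplus (2 * real (Suc n))) f U \<and> u \<in> borel_measurable lborel \<and>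
      (\<lambda>k. \<integral>\<^sup>+p\<in>A n. ennreal ((f k ((fst p, 0), snd p) - u p)\<^sup>2) \<partial>lborel) \<longlonglongrightarrow> 0"
    for n f and u :: "(real ^ 'n) \<times> real \<Rightarrow> real"
  have "\<exists>f u. approx n f u" for n
  proof -
    define R where "R = real (Suc n)"
    have R: "0 < R" by (simp add: R_def)
    have "U \<in> H1 (wt_time a) (Qplus (2 * R))"
      using U R unfolding UU_def by simp
    then obtain f where f: "\<And>k. smooth_fun (f k)" "H1_tendsto (wt_time a) (Qplus (2 * R)) f U"
      unfolding H1_def by blast
    obtain G where G: "is_weak_grad (Qplus (2 * R)) U G"
      and lim: "(\<lambda>k. H1_dist (wt_time a) (Qplus (2 * R)) (f k) U G) \<longlonglongrightarrow> 0"
      using f(2) unfolding H1_tendsto_iff by blast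
    define F where "F k p = indicator (A n) p *\<^sub>R f k ((fst p, 0), snd p)" for k p
    have m: "F k \<in> borel_measurable lborel" for k
      using smooth_fun_at_y0_measurable[OF f(1)[of k]] Am[of n] unfolding F_def[abs_def] by measurable
    have bound: "(\<integral>\<^sup>+p. ennreal ((F j p - F k p)\<^sup>2) \<partial>lborel)
      \<le> ennreal (trace_const a R) * 2 * H1_dist (wt_time a) (Qplus (2 * R)) (f j) U G
        + ennreal (trace_const a R) * 2 * H1_dist (wt_time a) (Qplus (2 * R)) (f k) U G" for j k
      using trace_diff_le_H1_dist[OF a R f(1)[of j] f(1)[of k] G]
      unfolding F_def set_diff_square_indicator A_def R_def by simp
    obtain u where u: "u \<in> borel_measurable lborel"
      "(\<lambda>k. \<integral>\<^sup>+p. ennreal ((F k p - u p)\<^sup>2) \<partial>lborel) \<longlonglongrightarrow> 0"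
      by (rule L2_complete[OF m tendsto_0_scaled[OF lim] bound]) (rule that)
    have "(\<integral>\<^sup>+p\<in>A n. ennreal ((f k ((fst p, 0), snd p) - u p)\<^sup>2) \<partial>lborel)
      \<le> (\<integral>\<^sup>+p. ennreal ((F k p - u p)\<^sup>2) \<partial>lborel)" for k
      by (rule nn_integral_mono) (auto simp: F_def indicator_def)
    from tendsto_0_le_ennreal[OF u(2) this] show ?thesis
      using f u(1) unfolding R_def approx_def by blast
  qed
  then obtain f u where "\<And>n. approx n (f n) (u n)" by metis
  then have f: "\<And>n k. smooth_fun (f n k)"
    "\<And>n. H1_tendsto (wt_time a) (Qplus (2 * real (Suc n))) (f n) U"
    and u: "\<And>n. u n \<in> borel_measurable lborel"
    "\<And>n. (\<lambda>k. \<integral>\<^sup>+p\<in>A n. ennreal ((f n k ((fst p, 0), snd p) - u n p)\<^sup>2) \<partial>lborel) \<longlonglongrightarrow> 0"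
    unfolding approx_def by simp_all
  have um: "(\<lambda>p. indicator (A m) p *\<^sub>R u n p) \<in> borel_measurable lborel" for m n
    using u(1)[of n] Am[of m] by measurable
  obtain v where vm: "(\<lambda>p. indicator (\<Union>n. A n) p *\<^sub>R v p) \<in> borel_measurable lborel"
    and v: "\<And>n. AE p in lborel. p \<in> A n \<longrightarrow> v p = u n p"
  proof (rule glue_measurable_functions[OF inc um])
    show "AE p in lborel. p \<in> A n \<longrightarrow> u n p = u (Suc n) p" for n
    proof -
      have sub: "A n \<subseteq> A (Suc n)" using inc by (simp add: incseq_Suc_iff)
      have Q: "Qplus (2 * real (Suc n)) \<subseteq> (Qplus (2 * real (Suc (Suc n))) :: 'n spacetime set)"
        by (rule Qplus_mono) auto
      have lim: "(\<lambda>k. \<integral>\<^sup>+p\<in>A n. ennreal ((f (Suc n) k ((fst p, 0), snd p) - u (Suc n) p)\<^sup>2) \<partial>lborel) \<longlonglongrightarrow> 0"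
        by (rule tendsto_0_le_ennreal[OF u(2)[of "Suc n"]]) (rule nn_set_integral_set_mono[OF sub])
      show ?thesis
        unfolding A_def
      proof (rule local_trace_unique[OF a, where f="f n" and g="f (Suc n)" and U=U])
        show "H1_tendsto (wt_time a) (Qplus (2 * real (Suc n))) (f n) U" by (rule f(2))
        show "H1_tendsto (wt_time a) (Qplus (2 * real (Suc n))) (f (Suc n)) U"
          by (rule H1_tendsto_subset[OF f(2) Q])
      qed (use f(1) um[of n] u(2)[of n] lim in \<open>unfold A_def, simp_all only: of_nat_0_less_iff zero_less_Suc\<close>)
    qed
  qed (rule that)
  have "has_trace_y0 a U v"
    unfolding has_trace_y0_def
  proof (intro conjI allI impI)
    show "set_borel_measurable lborel later v"
      using vm unfolding set_borel_measurable_def A_def exhaust_ball_interval .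
    fix R :: real assume R: "R > 0"
    obtain n where n: "R \<le> real (Suc n)" using real_arch_simple[of R] by (metis le_SucI of_nat_le_iff order_trans le_refl)
    have sub: "ball 0 R \<times> {0<..<R\<^sup>2} \<subseteq> A n"
      unfolding A_def using R n by (intro Sigma_mono subset_ball
        greaterThanLessThan_subseteq_greaterThanLessThan[THEN iffD2] power_mono impI conjI) auto
    have "(\<integral>\<^sup>+p\<in>ball 0 R \<times> {0<..<R\<^sup>2}. ennreal ((f n k ((fst p, 0), snd p) - v p)\<^sup>2) \<partial>lborel)
      \<le> (\<integral>\<^sup>+p\<in>A n. ennreal ((f n k ((fst p, 0), snd p) - u n p)\<^sup>2) \<partial>lborel)" for k
    proof (rule nn_integral_mono_AE)
      show "AE p in lborel. ennreal ((f n k ((fst p, 0), snd p) - v p)\<^sup>2) * indicator (ball 0 R \<times> {0<..<R\<^sup>2}) p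
        \<le> ennreal ((f n k ((fst p, 0), snd p) - u n p)\<^sup>2) * indicator (A n) p"
        using v[of n] by eventually_elim (use sub in \<open>auto simp: indicator_def\<close>)
    qed
    from tendsto_0_le_ennreal[OF u(2) this]
    show "\<exists>f. (\<forall>k. smooth_fun (f k)) \<and> H1_tendsto (wt_time a) (Qplus R) f U \<and>
        (\<lambda>k. \<integral>\<^sup>+p\<in>ball 0 R \<times> {0<..<R\<^sup>2}. ennreal ((f k ((fst p, 0), snd p) - v p)\<^sup>2) \<partial>lborel) \<longlonglongrightarrow> 0"
      using f(1)[of n] H1_tendsto_subset[OF f(2)[of n] Qplus_mono[of R "2 * real (Suc n)"]] R n by fastforce
  qed
  then show ?thesis
    unfolding trace_y0_def by (rule someI[of "has_trace_y0 a U"])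
qed

section \<open>Reparametrisation of time\<close>

lemma smooth_fun_prod_components:
  "smooth_fun (\<lambda>z::'e::euclidean_space \<times> real. fst z \<bullet> b)" "smooth_fun (snd :: 'e \<times> real \<Rightarrow> real)"
  by (rule smooth_fun_bounded_linear, intro bounded_linear_intros)+

lemma smooth_fun_reparam:
  fixes f :: "'e::euclidean_space \<times> real \<Rightarrow> real" and h :: "real \<Rightarrow> real"
  assumes f: "smooth_fun f" and h: "smooth_fun h"
  shows "smooth_fun (\<lambda>z. f (fst z, h (snd z)))"
proof (rule smooth_fun_compose[OF _ f])
  fix b :: "'e \<times> real"
  have "smooth_fun (\<lambda>z::'e \<times> real. fst z \<bullet> fst b + h (snd z) * snd b)"
    by (intro smooth_fun_add smooth_fun_mult smooth_fun_const smooth_fun_prod_components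
        smooth_fun_real_compose[OF _ h])
  then show "smooth_fun (\<lambda>z::'e \<times> real. (fst z, h (snd z)) \<bullet> b)"
    by (simp add: inner_prod_def)
qed

lemma classical_grad_reparam:
  fixes f :: "'e::euclidean_space \<times> real \<Rightarrow> real" and h :: "real \<Rightarrow> real"
  assumes f: "smooth_fun f" and h: "\<And>t. (h has_real_derivative h' t) (at t)"
  shows "classical_grad (\<lambda>z. f (fst z, h (snd z))) z =
    (fst (classical_grad f (fst z, h (snd z))), h' (snd z) * snd (classical_grad f (fst z, h (snd z))))"
proof (rule classical_gradI)
  have "((\<lambda>z::'e \<times> real. h (snd z)) has_derivative (\<lambda>v. h' (snd z) * snd v)) (at z)"
    using diff_chain_at[of snd snd z h "(*) (h' (snd z))"] h[of "snd z"]
    by (simp add: has_field_derivative_def o_def has_derivative_snd)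
  then have "((\<lambda>z::'e \<times> real. (fst z, h (snd z))) has_derivative (\<lambda>v. (fst v, h' (snd z) * snd v))) (at z)"
    by (intro has_derivative_Pair has_derivative_fst has_derivative_ident)
  from diff_chain_at[OF this has_derivative_classical_grad[OF f]]
  show "((\<lambda>z. f (fst z, h (snd z))) has_derivative (\<lambda>v. (fst (classical_grad f (fst z, h (snd z))),
      h' (snd z) * snd (classical_grad f (fst z, h (snd z)))) \<bullet> v)) (at z)"
    by (simp add: o_def inner_prod_def mult_ac)
qed

lemma AE_lborel_snd:
  fixes P :: "'a::euclidean_space \<times> 'b::euclidean_space \<Rightarrow> bool"
  assumes "AE z in lborel. P z"
  shows "AE t in lborel. AE x in lborel. P (x, t)"
proof -
  obtain N where N: "N \<in> null_sets lborel" "{z. \<not> P z} \<subseteq> N"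
    using assms unfolding eventually_ae_filter by auto
  have Nm: "N \<in> sets borel" using N(1) by (auto simp: null_sets_def)
  have "(\<integral>\<^sup>+t. \<integral>\<^sup>+x. indicator N (x, t) \<partial>lborel \<partial>lborel) = (\<integral>\<^sup>+z. indicator N z \<partial>lborel)"
    using Nm by (subst nn_integral_lborel_snd(1)) auto
  also have "\<dots> = 0" using N(1) Nm by (auto simp: null_sets_def)
  finally have "AE t in lborel. (\<integral>\<^sup>+x. indicator N (x, t) \<partial>lborel) = 0"
    using nn_integral_lborel_snd(2)[of "indicator N"] Nm
    by (subst (asm) nn_integral_0_iff_AE) auto
  then show ?thesis
  proof eventually_elim
    case (elim t)
    have "(\<lambda>x. (x, t)) \<in> borel_measurable borel"
      by (intro borel_measurable_continuous_onI continuous_intros)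
    then have "(\<lambda>x. indicator N (x, t) :: ennreal) \<in> borel_measurable lborel"
      using Nm by measurable
    then have "AE x in lborel. indicator N (x, t) = (0 :: ennreal)"
      using elim by (subst (asm) nn_integral_0_iff_AE) auto
    then show ?case
      by eventually_elim (use N(2) in \<open>auto simp: indicator_def split: if_splits\<close>)
  qed
qed

text \<open>The condition \<open>\<psi>' \<ge> 1\<close> makes \<open>\<psi>\<close> a diffeomorphism of the whole line. Its inverse \<open>\<phi>\<close> fixes \<open>0\<close>, does not
  run ahead of the original time, and has derivative at most \<open>1\<close>, so that composing with \<open>\<phi>\<close> does not
  increase gradients.\<close>

locale time_change =
  fixes \<psi> \<psi>' :: "real \<Rightarrow> real"
  assumes zero: "\<psi> 0 = 0"
    and deriv: "\<And>s. (\<psi> has_real_derivative \<psi>' s) (at s)"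
    and ge1: "\<And>s. 1 \<le> \<psi>' s"
    and smooth: "smooth_fun \<psi>"
begin

definition \<phi> :: "real \<Rightarrow> real" where "\<phi> = inv \<psi>"

lemma increase:
  assumes "s \<le> t"
  shows "t - s \<le> \<psi> t - \<psi> s"
proof -
  have "\<psi> s - s \<le> \<psi> t - t"
  proof (rule deriv_nonneg_imp_mono[of s t "\<lambda>s. \<psi> s - s" "\<lambda>s. \<psi>' s - 1"])
    show "((\<lambda>s. \<psi> s - s) has_real_derivative \<psi>' x - 1) (at x)" for x
      by (intro derivative_intros deriv)
  qed (use ge1 assms in auto)
  then show ?thesis by simp
qed

lemma strict_mono: "s < t \<Longrightarrow> \<psi> s < \<psi> t"
  using increase[of s t] by simp

lemma less_iff: "\<psi> s < \<psi> t \<longleftrightarrow> s < t"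
  using strict_mono[of s t] strict_mono[of t s] by (metis linorder_neqE_linordered_idom order_less_asym)

lemma bij: "bij \<psi>"
proof (rule bijI)
  show "inj \<psi>" using less_iff by (intro linorder_injI) (metis order_less_irrefl)
  have cont: "continuous_on S \<psi>" for S using smooth_fun_continuous[OF smooth] .
  show "surj \<psi>"
    unfolding surj_def
  proof
    fix y
    show "\<exists>x. y = \<psi> x"
    proof (cases "0 \<le> y")
      case True
      then show ?thesis using IVT'[of \<psi> 0 y y] increase[of 0 y] zero cont by auto
    next
      case False
      then show ?thesis using IVT'[of \<psi> y y 0] increase[of y 0] zero cont by auto
    qed
  qed
qed

lemma \<phi>_\<psi> [simp]: "\<phi> (\<psi> s) = s"
  unfolding \<phi>_def using bij by (simp add: bij_is_inj)

lemma \<psi>_\<phi> [simp]: "\<psi> (\<phi> t) = t"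
  unfolding \<phi>_def using bij by (simp add: bij_is_surj surj_f_inv_f)

lemma \<phi>_zero: "\<phi> 0 = 0"
  using \<phi>_\<psi>[of 0] zero by simp

lemma \<psi>_pos_iff: "0 < \<psi> s \<longleftrightarrow> 0 < s"
  using less_iff[of 0 s] zero by simp

lemma \<phi>_pos_iff: "0 < \<phi> t \<longleftrightarrow> 0 < t"
  using \<psi>_pos_iff[of "\<phi> t"] by simp

lemma le_\<psi>: "0 \<le> s \<Longrightarrow> s \<le> \<psi> s"
  using increase[of 0 s] zero by simp

lemma \<psi>'_pos: "0 < \<psi>' s"
  using ge1[of s] by simp

lemma \<phi>_deriv: "(\<phi> has_real_derivative 1 / \<psi>' (\<phi> t)) (at t)"
proof -
  have cont: "isCont \<phi> (\<psi> (\<phi> t))"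
    by (rule isCont_inverse_function[of 1]) (auto intro: DERIV_isCont[OF deriv])
  have "(\<phi> has_real_derivative inverse (\<psi>' (\<phi> t))) (at t)"
    by (rule DERIV_inverse_function[OF deriv, where a="t - 1" and b="t + 1"])
      (use \<psi>'_pos[of "\<phi> t"] cont in auto)
  then show ?thesis by (simp add: inverse_eq_divide)
qed

lemma \<psi>'_smooth: "smooth_fun \<psi>'"
  by (rule smooth_fun_real_deriv[OF smooth deriv])

lemma \<phi>_smooth: "smooth_fun \<phi>"
  by (rule smooth_fun_autonomous_ODE[OF \<phi>_deriv])
    (rule smooth_fun_inverse[OF \<psi>'_smooth \<psi>'_pos])

lemma measurable_\<psi> [measurable]: "\<psi> \<in> borel_measurable borel" "\<psi>' \<in> borel_measurable borel"
    "\<phi> \<in> borel_measurable borel"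
  using smooth \<psi>'_smooth \<phi>_smooth by (simp_all add: smooth_fun_measurable)

abbreviation forward :: "'e \<times> real \<Rightarrow> 'e \<times> real" where
  "forward z \<equiv> (fst z, \<psi> (snd z))"

abbreviation backward :: "'e \<times> real \<Rightarrow> 'e \<times> real" where
  "backward z \<equiv> (fst z, \<phi> (snd z))"

text \<open>Substitution as an identity of measures: on the product with the space variable it then serves
  nonnegative integrals, Bochner integrals and integrability alike.\<close>

lemma lborel_eq_distr: "lborel = distr (density lborel (\<lambda>s. ennreal (\<psi>' s))) borel \<psi>"
proof (rule lborel_eqI)
  fix l u :: real
  assume "\<And>b. b \<in> Basis \<Longrightarrow> l \<bullet> b \<le> u \<bullet> b"
  then have lu: "l \<le> u" by simp
  have "\<psi> -` {l<..<u} = {\<phi> l<..<\<phi> u}"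
    using less_iff[of "\<phi> l"] less_iff[of _ "\<phi> u"] by auto
  then have "emeasure (distr (density lborel (\<lambda>s. ennreal (\<psi>' s))) borel \<psi>) (box l u)
    = (\<integral>\<^sup>+s. ennreal (\<psi>' s) * indicator {\<phi> l<..<\<phi> u} s \<partial>lborel)"
    by (simp add: emeasure_distr emeasure_density box_real)
  also have "\<dots> = (\<integral>\<^sup>+s. ennreal (\<psi>' s) * indicator {\<phi> l..\<phi> u} s \<partial>lborel)"
  proof (rule nn_integral_cong_AE)
    show "AE s in lborel. ennreal (\<psi>' s) * indicator {\<phi> l<..<\<phi> u} s = ennreal (\<psi>' s) * indicator {\<phi> l..\<phi> u} s"
      using AE_lborel_singleton[of "\<phi> l"] AE_lborel_singleton[of "\<phi> u"]
      by eventually_elim (auto simp: indicator_def)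
  qed
  also have "\<dots> = ennreal (u - l)"
  proof -
    have "\<phi> l \<le> \<phi> u" using less_iff[of "\<phi> u" "\<phi> l"] lu by simp
    from nn_integral_FTC_Icc[OF _ deriv _ this] show ?thesis
      using less_imp_le[OF \<psi>'_pos] by simp
  qed
  finally show "emeasure (distr (density lborel (\<lambda>s. ennreal (\<psi>' s))) borel \<psi>) (box l u)
    = ennreal (\<Prod>b\<in>Basis. (u - l) \<bullet> b)" by simp
qed simp

lemma nn_integral_change:
  assumes [measurable]: "F \<in> borel_measurable borel"
  shows "(\<integral>\<^sup>+t. F t \<partial>lborel) = (\<integral>\<^sup>+s. ennreal (\<psi>' s) * F (\<psi> s) \<partial>lborel)"
proof -
  have "(\<integral>\<^sup>+t. F t \<partial>lborel) = (\<integral>\<^sup>+t. F t \<partial>distr (density lborel (\<lambda>s. ennreal (\<psi>' s))) borel \<psi>)"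
    by (rule arg_cong[where f="\<lambda>M. nn_integral M F", OF lborel_eq_distr])
  then show ?thesis by (simp add: nn_integral_distr nn_integral_density)
qed

lemma measurable_reparam [measurable]:
  "(forward :: 'e::euclidean_space \<times> real \<Rightarrow> _) \<in> borel_measurable borel"
  "(backward :: 'e::euclidean_space \<times> real \<Rightarrow> _) \<in> borel_measurable borel"
  "(\<lambda>z::'e::euclidean_space \<times> real. \<psi>' (snd z)) \<in> borel_measurable borel"
  by (intro borel_measurable_continuous_onI continuous_intros
      continuous_on_compose2[OF smooth_fun_continuous[OF smooth, of UNIV]]
      continuous_on_compose2[OF smooth_fun_continuous[OF \<phi>_smooth, of UNIV]]
      continuous_on_compose2[OF smooth_fun_continuous[OF \<psi>'_smooth, of UNIV]]; simp)+

lemma nn_integral_change_prod: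
  fixes F :: "'e::euclidean_space \<times> real \<Rightarrow> ennreal"
  assumes F: "F \<in> borel_measurable borel"
  shows "(\<integral>\<^sup>+z. F z \<partial>lborel) = (\<integral>\<^sup>+z. ennreal (\<psi>' (snd z)) * F (forward z) \<partial>lborel)"
proof -
  have Fm: "F \<in> borel_measurable (lborel \<Otimes>\<^sub>M lborel)" using F by (simp add: lborel_prod)
  have slice: "(\<lambda>t. F (x, t)) \<in> borel_measurable borel" for x
    by (rule measurable_compose[OF _ F]) (intro borel_measurable_continuous_onI continuous_intros)
  have "(\<lambda>z. ennreal (\<psi>' (snd z)) * F (forward z)) \<in> borel_measurable borel"
    using measurable_compose[OF measurable_reparam(1) F] by measurable
  then have Hm: "(\<lambda>z. ennreal (\<psi>' (snd z)) * F (forward z)) \<in> borel_measurable (lborel \<Otimes>\<^sub>M lborel)"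
    by (simp add: lborel_prod)
  have "(\<integral>\<^sup>+z. F z \<partial>lborel) = (\<integral>\<^sup>+x. \<integral>\<^sup>+t. F (x, t) \<partial>lborel \<partial>lborel)"
    using lborel.nn_integral_fst[OF Fm] by (simp add: lborel_prod)
  also have "\<dots> = (\<integral>\<^sup>+x. \<integral>\<^sup>+s. ennreal (\<psi>' s) * F (x, \<psi> s) \<partial>lborel \<partial>lborel)"
    by (intro nn_integral_cong nn_integral_change slice)
  also have "\<dots> = (\<integral>\<^sup>+z. ennreal (\<psi>' (snd z)) * F (forward z) \<partial>lborel)"
    using lborel.nn_integral_fst[OF Hm] by (simp add: lborel_prod)
  finally show ?thesis .
qed

lemma lborel_eq_distr_prod:
  "(lborel :: ('e::euclidean_space \<times> real) measure) =
    distr (density lborel (\<lambda>z. ennreal (\<psi>' (snd z)))) borel forward"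
proof (rule measure_eqI)
  fix A :: "('e \<times> real) set" assume "A \<in> sets lborel"
  then have A[measurable]: "A \<in> sets borel" by simp
  have "emeasure lborel A = (\<integral>\<^sup>+z. indicator A z \<partial>lborel)" by simp
  also have "\<dots> = (\<integral>\<^sup>+z. ennreal (\<psi>' (snd z)) * indicator A (forward z) \<partial>lborel)"
    by (rule nn_integral_change_prod) simp
  also have "\<dots> = emeasure (density lborel (\<lambda>z. ennreal (\<psi>' (snd z)))) (forward -` A)"
  proof (subst emeasure_density)
    show "forward -` A \<in> sets lborel"
      using measurable_sets[OF measurable_reparam(1) A] by simp
  qed (auto simp: indicator_def intro!: nn_integral_cong)
  also have "\<dots> = emeasure (distr (density lborel (\<lambda>z. ennreal (\<psi>' (snd z)))) borel forward) A"
    by (subst emeasure_distr) auto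
  finally show "emeasure lborel A =
    emeasure (distr (density lborel (\<lambda>z. ennreal (\<psi>' (snd z)))) borel forward) A" .
qed simp

lemma integrable_change:
  fixes h :: "'e::euclidean_space \<times> real \<Rightarrow> 'b::{banach, second_countable_topology}"
  assumes [measurable]: "h \<in> borel_measurable borel"
  shows "integrable lborel h \<longleftrightarrow> integrable lborel (\<lambda>z. \<psi>' (snd z) *\<^sub>R h (forward z))"
proof -
  have [measurable]: "(\<lambda>z. h (forward z)) \<in> borel_measurable borel"
    by (rule measurable_compose[OF measurable_reparam(1) assms])
  have "integrable lborel h \<longleftrightarrow>
      integrable (distr (density lborel (\<lambda>z. ennreal (\<psi>' (snd z)))) borel forward) h"
    by (rule arg_cong[where f="\<lambda>M. integrable M h", OF lborel_eq_distr_prod])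
  also have "\<dots> \<longleftrightarrow> integrable (density lborel (\<lambda>z. ennreal (\<psi>' (snd z)))) (\<lambda>z. h (forward z))"
    by (rule integrable_distr_eq) auto
  also have "\<dots> \<longleftrightarrow> integrable lborel (\<lambda>z. \<psi>' (snd z) *\<^sub>R h (forward z))"
    by (rule integrable_density) (auto simp: less_imp_le[OF \<psi>'_pos])
  finally show ?thesis .
qed

lemma integral_change:
  fixes h :: "'e::euclidean_space \<times> real \<Rightarrow> 'b::{banach, second_countable_topology}"
  assumes [measurable]: "h \<in> borel_measurable borel"
  shows "(LINT z|lborel. h z) = (LINT z|lborel. \<psi>' (snd z) *\<^sub>R h (forward z))"
proof -
  have [measurable]: "(\<lambda>z. h (forward z)) \<in> borel_measurable borel"
    by (rule measurable_compose[OF measurable_reparam(1) assms])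
  have "(LINT z|lborel. h z) =
      integral\<^sup>L (distr (density lborel (\<lambda>z. ennreal (\<psi>' (snd z)))) borel forward) h"
    by (rule arg_cong[where f="\<lambda>M. integral\<^sup>L M h", OF lborel_eq_distr_prod])
  also have "\<dots> = (LINT z|density lborel (\<lambda>z. ennreal (\<psi>' (snd z))). h (forward z))"
    by (rule integral_distr) auto
  also have "\<dots> = (LINT z|lborel. \<psi>' (snd z) *\<^sub>R h (forward z))"
    by (rule integral_density) (auto simp: less_imp_le[OF \<psi>'_pos])
  finally show ?thesis .
qed

lemma set_integral_change:
  fixes h :: "'e::euclidean_space \<times> real \<Rightarrow> real"
  assumes "(\<lambda>z. indicator later z *\<^sub>R h z) \<in> borel_measurable lborel"
  shows "(LINT z:later|lborel. h z) = (LINT z:later|lborel. \<psi>' (snd z) * h (forward z))"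
proof -
  have "(\<lambda>z. indicator later z *\<^sub>R h z) \<in> borel_measurable borel" using assms by simp
  from integral_change[OF this] show ?thesis
    unfolding set_lebesgue_integral_def
    by (simp add: indicator_def \<psi>_pos_iff mult.left_commute cong: if_cong)
      (auto intro!: Bochner_Integration.integral_cong)
qed

lemma \<psi>'_bound: obtains B where "B \<ge> 0" "\<And>s. s \<in> {0..r} \<Longrightarrow> \<psi>' s \<le> B"
proof -
  have "bounded (\<psi>' ` {0..r})"
    by (intro compact_imp_bounded compact_continuous_image smooth_fun_continuous[OF \<psi>'_smooth] compact_Icc)
  then obtain B where "\<And>s. s \<in> {0..r} \<Longrightarrow> norm (\<psi>' s) \<le> B"
    unfolding bounded_iff by blast
  then have "max 0 B \<ge> 0" "\<And>s. s \<in> {0..r} \<Longrightarrow> \<psi>' s \<le> max 0 B" by fastforce+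
  then show ?thesis by (rule that)
qed

text \<open>The reparametrised functions only use earlier times, so cylinders are mapped into themselves.\<close>

lemma nn_integral_reparam_bound:
  obtains B where "\<And>(F :: 'e::euclidean_space \<times> real \<Rightarrow> ennreal) A. A \<in> sets borel \<Longrightarrow>
    (\<lambda>z. F z * indicator (A \<times> {0<..<r}) z) \<in> borel_measurable lborel \<Longrightarrow>
    (\<integral>\<^sup>+z\<in>A \<times> {0<..<r}. F (backward z) \<partial>lborel) \<le> ennreal B * (\<integral>\<^sup>+z\<in>A \<times> {0<..<r}. F z \<partial>lborel)"
proof -
  obtain B where B: "B \<ge> 0" "\<And>s. s \<in> {0..r} \<Longrightarrow> \<psi>' s \<le> B" using \<psi>'_bound by metis
  have "(\<integral>\<^sup>+z\<in>A \<times> {0<..<r}. F (backward z) \<partial>lborel) \<le> ennreal B * (\<integral>\<^sup>+z\<in>A \<times> {0<..<r}. F z \<partial>lborel)"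
    if A: "A \<in> sets borel" and Fm: "(\<lambda>z. F z * indicator (A \<times> {0<..<r}) z) \<in> borel_measurable lborel"
    for F :: "'e \<times> real \<Rightarrow> ennreal" and A
  proof -
    define H where "H z = F z * indicator (A \<times> {0<..<r}) z" for z
    have Hm: "H \<in> borel_measurable borel" using Fm by (simp add: H_def[abs_def])
    have sub: "\<phi> t \<in> {0<..<r}" if "t \<in> {0<..<r}" for t
      using that le_\<psi>[of "\<phi> t"] \<phi>_pos_iff[of t] by auto
    have eq: "F (backward z) * indicator (A \<times> {0<..<r}) z
      = H (backward z) * indicator (A \<times> {0<..<r}) z" for z
      using sub[of "snd z"] by (cases z) (auto simp: H_def indicator_def)
    have [measurable]: "A \<times> {0<..<r} \<in> sets borel" using A by (auto simp: borel_Times)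
    have m: "(\<lambda>z. H (backward z) * indicator (A \<times> {0<..<r}) z) \<in> borel_measurable borel"
      using measurable_compose[OF measurable_reparam(2) Hm] by measurable
    have "(\<integral>\<^sup>+z\<in>A \<times> {0<..<r}. F (backward z) \<partial>lborel)
      = (\<integral>\<^sup>+z. H (backward z) * indicator (A \<times> {0<..<r}) z \<partial>lborel)"
      unfolding eq ..
    also have "\<dots> = (\<integral>\<^sup>+z. ennreal (\<psi>' (snd z)) * (H z * indicator (A \<times> {0<..<r}) (forward z)) \<partial>lborel)"
      unfolding nn_integral_change_prod[OF m] by simp
    also have "\<dots> \<le> (\<integral>\<^sup>+z. ennreal B * H z \<partial>lborel)"
    proof (rule nn_integral_mono)
      fix z :: "'e \<times> real"
      show "ennreal (\<psi>' (snd z)) * (H z * indicator (A \<times> {0<..<r}) (forward z)) \<le> ennreal B * H z"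
      proof (cases "z \<in> A \<times> {0<..<r}")
        case True
        then have "ennreal (\<psi>' (snd z)) \<le> ennreal B" using B(2) by (intro ennreal_leI) auto
        then show ?thesis by (intro mult_mono) (auto simp: indicator_def)
      qed (simp add: H_def)
    qed
    also have "\<dots> = ennreal B * (\<integral>\<^sup>+z. H z \<partial>lborel)" using Hm by (intro nn_integral_cmult) simp
    finally show ?thesis unfolding H_def .
  qed
  then show ?thesis by (rule that)
qed

end

lemma locally_integrable_bound:
  fixes F :: "'e::euclidean_space \<Rightarrow> 'b::euclidean_space" and H :: "'e \<Rightarrow> 'c::euclidean_space"
  assumes F: "locally_integrable \<Omega> F"
    and H: "(\<lambda>z. indicator \<Omega> z *\<^sub>R H z) \<in> borel_measurable lborel"
    and le: "\<And>z. z \<in> \<Omega> \<Longrightarrow> norm (H z) \<le> norm (F z)"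
  shows "locally_integrable \<Omega> H"
  unfolding locally_integrable_def set_integrable_def
proof (intro allI impI)
  fix K assume K: "compact K \<and> K \<subseteq> \<Omega>"
  have Km: "indicat_real K \<in> borel_measurable lborel"
    by (intro borel_measurable_indicator) (simp add: K borel_compact)
  have "(\<lambda>z. indicat_real K z *\<^sub>R H z) = (\<lambda>z. indicat_real K z *\<^sub>R (indicat_real \<Omega> z *\<^sub>R H z))"
    using K by (intro ext) (auto simp: indicator_def)
  then have m: "(\<lambda>z. indicat_real K z *\<^sub>R H z) \<in> borel_measurable lborel"
    using borel_measurable_scaleR[OF Km H] by (simp only:)
  show "integrable lborel (\<lambda>z. indicat_real K z *\<^sub>R H z)"
  proof (rule Bochner_Integration.integrable_bound[OF _ m])
    show "integrable lborel (\<lambda>z. indicat_real K z *\<^sub>R F z)"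
      using F K unfolding locally_integrable_def set_integrable_def by blast
    show "AE z in lborel. norm (indicat_real K z *\<^sub>R H z) \<le> norm (indicat_real K z *\<^sub>R F z)"
      using K le by (intro AE_I2) (auto simp: indicator_def)
  qed
qed

context time_change
begin

text \<open>The chain rule for \<open>U(X, \<phi> t)\<close>, where \<open>\<phi>'\<close> is \<open>1 / \<psi>'(\<phi> t)\<close>.\<close>

definition reparam_grad :: "('e::euclidean_space \<times> real \<Rightarrow> 'e \<times> real) \<Rightarrow> 'e \<times> real \<Rightarrow> 'e \<times> real" where
  "reparam_grad G z =
    (fst (G (backward z)), 1 / \<psi>' (\<phi> (snd z)) * snd (G (backward z)))"

lemma norm_contract_snd_le: "(norm (fst v, 1 / \<psi>' s * snd v))\<^sup>2 \<le> (norm v)\<^sup>2" for v :: "'e::euclidean_space \<times> real"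
proof -
  have "\<bar>1 / \<psi>' s * snd v\<bar> \<le> 1 * \<bar>snd v\<bar>"
    unfolding abs_mult using ge1[of s] by (intro mult_right_mono) auto
  then have "(1 / \<psi>' s * snd v)\<^sup>2 \<le> (snd v)\<^sup>2" by (simp only: abs_le_square_iff[symmetric] mult_1_left)
  then show ?thesis unfolding norm_fst_snd_square by (simp add: power_divide)
qed

lemma norm_reparam_grad_le: "norm (reparam_grad G z) \<le> norm (G (backward z))"
  unfolding reparam_grad_def using norm_contract_snd_le by (rule power2_le_imp_le) simp

lemma measurable_later_reparam:
  fixes H :: "'e::euclidean_space \<times> real \<Rightarrow> 'b::real_normed_vector"
  assumes "(\<lambda>z. indicator later z *\<^sub>R H z) \<in> borel_measurable lborel"
  shows "(\<lambda>z. indicator later z *\<^sub>R H (backward z)) \<in> borel_measurable lborel"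
proof -
  have "(\<lambda>z. indicator later z *\<^sub>R H z) \<in> borel_measurable borel" using assms by simp
  from measurable_compose[OF measurable_reparam(2) this] show ?thesis
    by (simp add: indicator_def \<phi>_pos_iff mem_Times_iff)
qed

lemma measurable_later_reparam_grad:
  assumes G: "(\<lambda>z. indicator later z *\<^sub>R G z) \<in> borel_measurable lborel"
  shows "(\<lambda>z. indicator later z *\<^sub>R reparam_grad G z) \<in> borel_measurable lborel"
proof -
  define H where "H = (\<lambda>z. indicat_real later z *\<^sub>R G (backward z))"
  have Hm: "H \<in> borel_measurable borel"
    unfolding H_def using measurable_later_reparam[OF G] by simp
  have lin: "(\<lambda>v::'a \<times> real. (fst v, 0::real)) \<in> borel_measurable borel"
    "(\<lambda>v::'a \<times> real. (0::'a, snd v)) \<in> borel_measurable borel"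
    by (intro borel_measurable_continuous_onI continuous_intros)+
  have c: "(\<lambda>z::'a \<times> real. 1 / \<psi>' (\<phi> (snd z))) \<in> borel_measurable borel"
    using \<psi>'_pos by (intro borel_measurable_continuous_onI continuous_intros
      continuous_on_compose2[OF smooth_fun_continuous[OF \<psi>'_smooth, of UNIV]]
      continuous_on_compose2[OF smooth_fun_continuous[OF \<phi>_smooth, of UNIV]]) (auto simp: less_imp_neq[symmetric])
  have "(\<lambda>z. indicator later z *\<^sub>R reparam_grad G z) =
    (\<lambda>z. (fst (H z), 0) + (1 / \<psi>' (\<phi> (snd z))) *\<^sub>R (0, snd (H z)))"
    by (rule ext) (simp add: reparam_grad_def H_def indicator_def)
  also have "\<dots> \<in> borel_measurable borel"
    by (intro borel_measurable_add borel_measurable_scaleR c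
        measurable_compose[OF Hm lin(1)] measurable_compose[OF Hm lin(2)])
  finally show ?thesis by simp
qed

lemma compact_image_reparam:
  fixes K :: "('e::euclidean_space \<times> real) set"
  assumes "compact K" "K \<subseteq> later"
  shows "compact (backward ` K)" "backward ` K \<subseteq> later"
    "(forward z) \<in> K \<longleftrightarrow> z \<in> backward ` K"
proof -
  show "compact (backward ` K)"
    using assms(1) by (intro compact_continuous_image continuous_intros
      continuous_on_compose2[OF smooth_fun_continuous[OF \<phi>_smooth, of UNIV]]) auto
  show "backward ` K \<subseteq> later"
    using assms(2) by (auto simp: \<phi>_pos_iff)
  show "(forward z) \<in> K \<longleftrightarrow> z \<in> backward ` K"
  proof
    assume "(forward z) \<in> K"
    then show "z \<in> backward ` K"
      by (intro image_eqI[where x="(forward z)"]) auto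
  qed auto
qed

text \<open>On a compact set in positive times the Jacobian \<open>\<psi>'\<close> is bounded.\<close>

lemma locally_integrable_reparam:
  fixes H :: "'e::euclidean_space \<times> real \<Rightarrow> 'b::euclidean_space"
  assumes H: "locally_integrable later H"
  shows "locally_integrable later (\<lambda>z. H (backward z))"
  unfolding locally_integrable_def set_integrable_def
proof (intro allI impI)
  fix K :: "('e \<times> real) set" assume K: "compact K \<and> K \<subseteq> later"
  define K' where "K' = backward ` K"
  have K': "compact K'" "K' \<subseteq> later" "\<And>z. (forward z) \<in> K \<longleftrightarrow> z \<in> K'"
    unfolding K'_def using compact_image_reparam[OF conjunct1[OF K] conjunct2[OF K]] by simp_all
  have op: "open (later :: ('e \<times> real) set)" by (intro open_Times open_UNIV open_greaterThan)
  have "indicat_real K \<in> borel_measurable lborel"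
    by (intro borel_measurable_indicator) (simp add: K borel_compact)
  from borel_measurable_scaleR[OF this measurable_later_reparam[OF locally_integrable_measurable[OF H op]]]
  have "(\<lambda>z. indicat_real K z *\<^sub>R (indicat_real later z *\<^sub>R H (backward z))) \<in> borel_measurable borel"
    by simp
  also have "(\<lambda>z. indicat_real K z *\<^sub>R (indicat_real later z *\<^sub>R H (backward z)))
    = (\<lambda>z. indicat_real K z *\<^sub>R H (backward z))"
    using K by (intro ext) (auto simp: indicator_def)
  finally have m: "(\<lambda>z. indicat_real K z *\<^sub>R H (backward z)) \<in> borel_measurable borel" .
  have int: "integrable lborel (\<lambda>z. indicat_real K' z *\<^sub>R H z)"
    using H K'(1,2) unfolding locally_integrable_def set_integrable_def by blast
  have "bounded ((\<lambda>z. \<psi>' (snd z)) ` K')"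
    using K'(1) by (intro compact_imp_bounded compact_continuous_image continuous_intros
      continuous_on_compose2[OF smooth_fun_continuous[OF \<psi>'_smooth, of UNIV]]) auto
  then obtain B where B: "\<And>z. z \<in> K' \<Longrightarrow> norm (\<psi>' (snd z)) \<le> B"
    unfolding bounded_iff by blast
  have "integrable lborel (\<lambda>z. \<psi>' (snd z) *\<^sub>R (indicat_real K' z *\<^sub>R H z))"
  proof (rule Bochner_Integration.integrable_bound)
    show "integrable lborel (\<lambda>z. B *\<^sub>R (indicat_real K' z *\<^sub>R H z))"
      using int by (rule integrable_scaleR_right)
    show "(\<lambda>z. \<psi>' (snd z) *\<^sub>R (indicat_real K' z *\<^sub>R H z)) \<in> borel_measurable lborel"
      by (rule borel_measurable_scaleR[OF _ borel_measurable_integrable[OF int]])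
        (use measurable_reparam(3) in simp)
    show "AE z in lborel. norm (\<psi>' (snd z) *\<^sub>R (indicat_real K' z *\<^sub>R H z)) \<le> norm (B *\<^sub>R (indicat_real K' z *\<^sub>R H z))"
    proof (rule AE_I2)
      show "norm (\<psi>' (snd z) *\<^sub>R (indicat_real K' z *\<^sub>R H z)) \<le> norm (B *\<^sub>R (indicat_real K' z *\<^sub>R H z))" for z
        using B[of z] by (cases "z \<in> K'") (auto intro!: mult_right_mono)
    qed
  qed
  also have "(\<lambda>z. \<psi>' (snd z) *\<^sub>R (indicat_real K' z *\<^sub>R H z)) =
    (\<lambda>z. \<psi>' (snd z) *\<^sub>R (indicat_real K (forward z) *\<^sub>R H (fst (forward z), \<phi> (snd (forward z)))))"
    using K'(3) by (simp add: indicator_def)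
  finally show "integrable lborel (\<lambda>z. indicat_real K z *\<^sub>R H (backward z))"
    using integrable_change[OF m] by simp
qed

lemma test_fun_reparam:
  fixes f :: "'e::euclidean_space \<times> real \<Rightarrow> real"
  assumes f: "test_fun later f" and c: "smooth_fun c"
  shows "test_fun later (\<lambda>z. c (snd z) * f (forward z))"
proof -
  obtain K where K: "compact K" "K \<subseteq> later" "\<And>z. z \<notin> K \<Longrightarrow> f z = 0"
    using f unfolding test_fun_def by blast
  have "smooth_fun (\<lambda>z::'e \<times> real. c (snd z) * f (forward z))"
    by (intro smooth_fun_mult smooth_fun_reparam smooth test_fun_smooth[OF f]
        smooth_fun_real_compose[OF smooth_fun_prod_components(2) c])
  moreover have "c (snd z) * f (forward z) = 0" if "z \<notin> backward ` K" for z
    using compact_image_reparam(3)[OF K(1,2), of z] that K(3) by simp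
  ultimately show ?thesis
    unfolding test_fun_def using compact_image_reparam(1,2)[OF K(1,2)] by blast
qed

text \<open>Substituting in time composes the test function with \<open>forward\<close>. For derivatives in time the
  Jacobian \<open>\<psi>'\<close> is absorbed by the chain rule; for derivatives in space it is a factor that does not
  depend on \<open>X\<close> and is made part of the test function.\<close>

lemma is_weak_grad_reparam:
  fixes U :: "'e::euclidean_space \<times> real \<Rightarrow> real"
  assumes W: "is_weak_grad later U G"
  shows "is_weak_grad later (\<lambda>z. U (backward z)) (reparam_grad G)"
  unfolding is_weak_grad_def
proof (intro conjI allI impI ballI)
  let ?L = "later :: ('e \<times> real) set"
  have op: "open ?L" by (intro open_Times open_UNIV open_greaterThan)
  note loc = is_weak_grad_locally_integrable[OF W]
  have Um: "(\<lambda>z. indicator ?L z *\<^sub>R U (backward z)) \<in> borel_measurable lborel"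
    by (rule measurable_later_reparam[OF locally_integrable_measurable[OF loc(1) op]])
  have Gm: "(\<lambda>z. indicator ?L z *\<^sub>R reparam_grad G z) \<in> borel_measurable lborel"
    by (rule measurable_later_reparam_grad[OF locally_integrable_measurable[OF loc(2) op]])
  show "locally_integrable ?L (\<lambda>z. U (backward z))"
    by (rule locally_integrable_reparam[OF loc(1)])
  show "locally_integrable ?L (reparam_grad G)"
    by (rule locally_integrable_bound[OF locally_integrable_reparam[OF loc(2)] Gm norm_reparam_grad_le])
  fix f and b :: "'e \<times> real" assume f: "test_fun ?L f" and b: "b \<in> Basis"
  note sf = test_fun_smooth[OF f]
  have fm: "f \<in> borel_measurable lborel" "(\<lambda>z. frechet_derivative f (at z) b) \<in> borel_measurable lborel"
    using smooth_fun_measurable[OF sf] smooth_fun_measurable[OF smooth_fun_frechet[OF sf]] by simp_all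
  have "(\<lambda>z. indicator ?L z *\<^sub>R (U (backward z) * frechet_derivative f (at z) b)) \<in> borel_measurable lborel"
    using borel_measurable_times[OF Um fm(2)] by (simp add: mult.assoc)
  from set_integral_change[OF this]
  have lhs: "(LINT z:?L|lborel. U (backward z) * frechet_derivative f (at z) b)
    = (LINT z:?L|lborel. \<psi>' (snd z) * (U z * frechet_derivative f (at (forward z)) b))" by simp
  have "(\<lambda>z. indicator ?L z *\<^sub>R ((reparam_grad G z \<bullet> b) * f z)) \<in> borel_measurable lborel"
    using borel_measurable_times[OF borel_measurable_inner[OF Gm borel_measurable_const[of b]] fm(1)]
    by (simp add: mult.assoc)
  from set_integral_change[OF this]
  have rhs: "(LINT z:?L|lborel. (reparam_grad G z \<bullet> b) * f z)
    = (LINT z:?L|lborel. \<psi>' (snd z) * ((reparam_grad G (forward z) \<bullet> b) * f (forward z)))" .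
  consider b1 where "b = (b1, 0)" "b1 \<in> Basis" | "b = (0, 1)"
    using b by (auto simp: Basis_prod_def)
  then show "(LINT z:?L|lborel. U (backward z) * frechet_derivative f (at z) b)
    = - (LINT z:?L|lborel. (reparam_grad G z \<bullet> b) * f z)"
  proof cases
    case 1
    define g where "g = (\<lambda>z. \<psi>' (snd z) * f (forward z))"
    have g: "test_fun ?L g" unfolding g_def by (rule test_fun_reparam[OF f \<psi>'_smooth])
    have "frechet_derivative g (at z) b = \<psi>' (snd z) * frechet_derivative f (at (forward z)) b" for z
    proof -
      define h where "h = (\<lambda>z::'e \<times> real. \<psi>' (snd z))"
      have h: "smooth_fun h"
        unfolding h_def by (rule smooth_fun_real_compose[OF smooth_fun_prod_components(2) \<psi>'_smooth])
      have sfT: "smooth_fun (\<lambda>z. f (forward z))" by (rule smooth_fun_reparam[OF sf smooth])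
      obtain c where c: "(\<psi>' has_real_derivative c) (at (snd z))"
        using smooth_fun_has_derivative[OF \<psi>'_smooth, of "snd z"]
        by (metis differentiableI real_differentiable_def)
      have "(h has_derivative (\<lambda>v. c * snd v)) (at z)"
        using diff_chain_at[of snd snd z \<psi>' "(*) c"] c
        by (simp add: has_field_derivative_def o_def has_derivative_snd h_def)
      from has_derivative_mult[OF this has_derivative_classical_grad[OF sfT]]
      have "(g has_derivative (\<lambda>v. h z * (classical_grad (\<lambda>z. f (forward z)) z \<bullet> v)
          + c * snd v * f (forward z))) (at z)"
        by (simp add: g_def h_def)
      from frechet_derivative_at[OF this, symmetric] show ?thesis
        unfolding classical_grad_reparam[OF sf deriv] frechet_derivative_eq_grad[OF sf] 1
        by (simp add: h_def inner_prod_def)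
    qed
    then have "(LINT z:?L|lborel. \<psi>' (snd z) * (U z * frechet_derivative f (at (forward z)) b))
      = (LINT z:?L|lborel. U z * frechet_derivative g (at z) b)"
      by (simp add: mult.left_commute)
    also have "\<dots> = - (LINT z:?L|lborel. (G z \<bullet> b) * g z)" by (rule is_weak_grad_identity[OF W g b])
    also have "\<dots> = - (LINT z:?L|lborel. \<psi>' (snd z) * ((reparam_grad G (forward z) \<bullet> b) * f (forward z)))"
      by (simp add: reparam_grad_def g_def 1 inner_prod_def mult.left_commute)
    finally show ?thesis using lhs rhs by simp
  next
    case 2
    define g where "g = (\<lambda>z. f (forward z))"
    have g: "test_fun ?L g" unfolding g_def using test_fun_reparam[OF f smooth_fun_const[of 1]] by simp
    have "frechet_derivative g (at z) b = \<psi>' (snd z) * frechet_derivative f (at (forward z)) b" for z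
    proof -
      have "frechet_derivative g (at z) b = classical_grad g z \<bullet> b"
        by (rule frechet_derivative_eq_grad[OF test_fun_smooth[OF g]])
      then show ?thesis
        unfolding frechet_derivative_eq_grad[OF sf] g_def classical_grad_reparam[OF sf deriv] 2
        by (simp add: inner_prod_def)
    qed
    then have "(LINT z:?L|lborel. \<psi>' (snd z) * (U z * frechet_derivative f (at (forward z)) b))
      = (LINT z:?L|lborel. U z * frechet_derivative g (at z) b)"
      by (simp add: mult.left_commute)
    also have "\<dots> = - (LINT z:?L|lborel. (G z \<bullet> b) * g z)" by (rule is_weak_grad_identity[OF W g b])
    also have "\<dots> = - (LINT z:?L|lborel. \<psi>' (snd z) * ((reparam_grad G (forward z) \<bullet> b) * f (forward z)))"
      using \<psi>'_pos by (simp add: reparam_grad_def g_def 2 inner_prod_def less_imp_neq[symmetric])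
    finally show ?thesis using lhs rhs by simp
  qed
qed

text \<open>The map from \<open>G\<close> to \<open>reparam_grad G\<close> is linear and contracts pointwise; it is applied to the
  difference of the gradients of \<open>f\<close> and \<open>U\<close>.\<close>

lemma H1_dist_reparam_le:
  fixes f :: "'e::euclidean_space \<times> real \<Rightarrow> real"
  assumes f: "smooth_fun f" and w: "\<And>z. 0 \<le> w z" "\<And>x s t. w (x, s) = w (x, t)"
  shows "H1_dist w \<Omega> (\<lambda>z. f (backward z)) (\<lambda>z. U (backward z)) (reparam_grad G) \<le>
    (\<integral>\<^sup>+z\<in>\<Omega>. (\<lambda>z. ennreal (w z * ((f z - U z)\<^sup>2 + (norm (classical_grad f z - G z))\<^sup>2))) (backward z) \<partial>lborel)"
  unfolding H1_dist_def
proof (rule nn_integral_mono)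
  fix z :: "'e \<times> real"
  define S where "S = (backward z)"
  have "classical_grad (\<lambda>z. f (backward z)) z - reparam_grad G z
    = (fst (classical_grad f S - G S), 1 / \<psi>' (\<phi> (snd z)) * snd (classical_grad f S - G S))"
    unfolding classical_grad_reparam[OF f \<phi>_deriv] reparam_grad_def S_def by (simp add: diff_divide_distrib)
  then have "(norm (classical_grad (\<lambda>z. f (backward z)) z - reparam_grad G z))\<^sup>2
    \<le> (norm (classical_grad f S - G S))\<^sup>2"
    by (simp only: norm_contract_snd_le)
  moreover have "w z = w S" unfolding S_def using w(2) by (metis prod.collapse)
  ultimately have "w z * ((f S - U S)\<^sup>2 + (norm (classical_grad (\<lambda>z. f (backward z)) z - reparam_grad G z))\<^sup>2)
    \<le> w S * ((f S - U S)\<^sup>2 + (norm (classical_grad f S - G S))\<^sup>2)"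
    using w(1) by (simp add: mult_left_mono)
  then show "ennreal (w z * ((f (backward z) - U (backward z))\<^sup>2 +
      (norm (classical_grad (\<lambda>z. f (backward z)) z - reparam_grad G z))\<^sup>2)) * indicator \<Omega> z
    \<le> ennreal (w (backward z) * ((f (backward z) - U (backward z))\<^sup>2 +
      (norm (classical_grad f (backward z) - G (backward z)))\<^sup>2)) * indicator \<Omega> z"
    unfolding S_def by (intro mult_right_mono ennreal_leI) auto
qed

lemma later_cylinder_measurable:
  fixes H :: "'e::euclidean_space \<times> real \<Rightarrow> 'b::euclidean_space"
  assumes "(\<lambda>z. indicator later z *\<^sub>R H z) \<in> borel_measurable lborel" "A \<in> sets borel"
  shows "(\<lambda>z. indicator (A \<times> {0<..<r}) z *\<^sub>R H z) \<in> borel_measurable lborel"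
proof -
  have "indicat_real (A \<times> {0<..<r}) \<in> borel_measurable lborel"
    by (intro borel_measurable_indicator) (auto simp: borel_Times assms(2))
  from borel_measurable_scaleR[OF this assms(1)]
  have "(\<lambda>z. indicat_real (A \<times> {0<..<r}) z *\<^sub>R (indicat_real later z *\<^sub>R H z)) \<in> borel_measurable lborel" .
  also have "(\<lambda>z. indicat_real (A \<times> {0<..<r}) z *\<^sub>R (indicat_real later z *\<^sub>R H z))
    = (\<lambda>z. indicat_real (A \<times> {0<..<r}) z *\<^sub>R H z)"
    by (rule ext) (auto simp: indicator_def)
  finally show ?thesis .
qed

lemma L2w_reparam:
  fixes H V :: "'e::euclidean_space \<times> real \<Rightarrow> real"
  assumes A: "A \<in> sets borel" and w: "\<And>z. 0 \<le> w z" "\<And>x s t. w (x, s) = w (x, t)" "w \<in> borel_measurable borel"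
    and H: "(\<lambda>z. indicator later z *\<^sub>R H z) \<in> borel_measurable lborel"
    and V: "(\<lambda>z. indicator later z *\<^sub>R V z) \<in> borel_measurable lborel"
    and le: "\<And>z. \<bar>V z\<bar> \<le> \<bar>H (backward z)\<bar>"
    and L2: "H \<in> L2w w (A \<times> {0<..<r})"
  shows "V \<in> L2w w (A \<times> {0<..<r})"
proof -
  obtain B where B: "\<And>(F :: 'e \<times> real \<Rightarrow> ennreal) A. A \<in> sets borel \<Longrightarrow>
    (\<lambda>z. F z * indicator (A \<times> {0<..<r}) z) \<in> borel_measurable lborel \<Longrightarrow>
    (\<integral>\<^sup>+z\<in>A \<times> {0<..<r}. F (backward z) \<partial>lborel) \<le> ennreal B * (\<integral>\<^sup>+z\<in>A \<times> {0<..<r}. F z \<partial>lborel)"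
    by (rule nn_integral_reparam_bound) (rule that)
  define F where "F z = ennreal (w z * (H z)\<^sup>2)" for z
  have "(\<lambda>z. F z * indicator (A \<times> {0<..<r}) z)
    = (\<lambda>z. ennreal (w z * (indicator (A \<times> {0<..<r}) z *\<^sub>R H z)\<^sup>2))"
    by (rule ext) (auto simp: F_def indicator_def)
  also have "\<dots> \<in> borel_measurable lborel"
    using later_cylinder_measurable[OF H A] w(3) by measurable
  finally have Fm: "(\<lambda>z. F z * indicator (A \<times> {0<..<r}) z) \<in> borel_measurable lborel" .
  have "(\<integral>\<^sup>+z\<in>A \<times> {0<..<r}. ennreal (w z * (V z)\<^sup>2) \<partial>lborel) \<le> (\<integral>\<^sup>+z\<in>A \<times> {0<..<r}. F (backward z) \<partial>lborel)"
  proof (rule nn_integral_mono)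
    fix z :: "'e \<times> real"
    have "w z = w (backward z)" using w(2) by (metis prod.collapse)
    then have "w z * (V z)\<^sup>2 \<le> w (backward z) * (H (backward z))\<^sup>2"
      using w(1) le[of z] by (simp add: abs_le_square_iff mult_left_mono)
    then show "ennreal (w z * (V z)\<^sup>2) * indicator (A \<times> {0<..<r}) z \<le> F (backward z) * indicator (A \<times> {0<..<r}) z"
      unfolding F_def by (intro mult_right_mono ennreal_leI) auto
  qed
  also have "\<dots> \<le> ennreal B * (\<integral>\<^sup>+z\<in>A \<times> {0<..<r}. F z \<partial>lborel)" by (rule B[OF A Fm])
  also have "\<dots> < \<infinity>"
    using L2 by (auto simp: L2w_def F_def ennreal_mult_less_top)
  finally show ?thesis
    unfolding L2w_def set_borel_measurable_def using later_cylinder_measurable[OF V A] by blast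
qed

lemma H1_tendsto_reparam:
  fixes U :: "'e::euclidean_space \<times> real \<Rightarrow> real"
  assumes A: "open A" and w: "\<And>z. 0 \<le> w z" "\<And>x s t. w (x, s) = w (x, t)" "w \<in> borel_measurable borel"
    and W: "is_weak_grad later U G" and f: "\<And>k. smooth_fun (f k)"
    and lim: "H1_tendsto w (A \<times> {0<..<r}) f U"
  shows "H1_tendsto w (A \<times> {0<..<r}) (\<lambda>k z. f k (backward z)) (\<lambda>z. U (backward z))"
proof -
  have op: "open (A \<times> {0<..<r})" using A by (intro open_Times open_greaterThanLessThan)
  have Am: "A \<in> sets borel" using A by simp
  have sub: "A \<times> {0<..<r} \<subseteq> later" by auto
  note W' = is_weak_grad_subset[OF W sub]
  obtain B where B: "\<And>(F :: 'e \<times> real \<Rightarrow> ennreal) A. A \<in> sets borel \<Longrightarrow>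
    (\<lambda>z. F z * indicator (A \<times> {0<..<r}) z) \<in> borel_measurable lborel \<Longrightarrow>
    (\<integral>\<^sup>+z\<in>A \<times> {0<..<r}. F (backward z) \<partial>lborel) \<le> ennreal B * (\<integral>\<^sup>+z\<in>A \<times> {0<..<r}. F z \<partial>lborel)"
    by (rule nn_integral_reparam_bound) (rule that)
  have le: "H1_dist w (A \<times> {0<..<r}) (\<lambda>z. f k (backward z)) (\<lambda>z. U (backward z)) (reparam_grad G)
    \<le> ennreal B * H1_dist w (A \<times> {0<..<r}) (f k) U G" for k
  proof -
    let ?F = "\<lambda>z. ennreal (w z * ((f k z - U z)\<^sup>2 + (norm (classical_grad (f k) z - G z))\<^sup>2))"
    have "H1_dist w (A \<times> {0<..<r}) (\<lambda>z. f k (backward z)) (\<lambda>z. U (backward z)) (reparam_grad G)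
      \<le> (\<integral>\<^sup>+z\<in>A \<times> {0<..<r}. ?F (backward z) \<partial>lborel)"
      by (rule H1_dist_reparam_le) (rule f w(1) w(2))+
    also have "\<dots> \<le> ennreal B * (\<integral>\<^sup>+z\<in>A \<times> {0<..<r}. ?F z \<partial>lborel)"
      by (rule B[OF Am H1_dist_measurable[OF f w(3) is_weak_grad_locally_integrable[OF W'] op]])
    finally show ?thesis unfolding H1_dist_def .
  qed
  have "(\<lambda>k. ennreal B * H1_dist w (A \<times> {0<..<r}) (f k) U G) \<longlonglongrightarrow> 0"
    using tendsto_mult_ennreal[OF tendsto_const H1_tendsto_H1_dist[OF lim W' op], of "ennreal B"] by simp
  from tendsto_0_le_ennreal[OF this le]
  have "(\<lambda>k. H1_dist w (A \<times> {0<..<r}) (\<lambda>z. f k (backward z))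
      (\<lambda>z. U (backward z)) (reparam_grad G)) \<longlonglongrightarrow> 0" .
  then show ?thesis
    unfolding H1_tendsto_iff using is_weak_grad_subset[OF is_weak_grad_reparam[OF W] sub] by blast
qed

lemma H1_reparam:
  fixes U :: "'e::euclidean_space \<times> real \<Rightarrow> real"
  assumes A: "open A" and w: "\<And>z. 0 \<le> w z" "\<And>x s t. w (x, s) = w (x, t)" "w \<in> borel_measurable borel"
    and W: "is_weak_grad later U G" and U: "U \<in> H1 w (A \<times> {0<..<r})"
  shows "(\<lambda>z. U (backward z)) \<in> H1 w (A \<times> {0<..<r})"
proof -
  let ?\<Omega> = "A \<times> {0<..<r}"
  have op: "open ?\<Omega>" "open (later :: ('e \<times> real) set)"
    using A by (intro open_Times open_greaterThanLessThan open_UNIV open_greaterThan; simp)+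
  have Am: "A \<in> sets borel" using A by simp
  have sub: "?\<Omega> \<subseteq> later" by auto
  obtain G' f where G': "is_weak_grad ?\<Omega> U G'" "U \<in> L2w w ?\<Omega>" "(\<lambda>z. norm (G' z)) \<in> L2w w ?\<Omega>"
    and f: "\<And>k. smooth_fun (f k)" "H1_tendsto w ?\<Omega> f U"
    using U unfolding H1_def by blast
  note Um = locally_integrable_measurable[OF is_weak_grad_locally_integrable(1)[OF W] op(2)]
  note Gm = locally_integrable_measurable[OF is_weak_grad_locally_integrable(2)[OF W] op(2)]
  have nm: "(\<lambda>z. indicator later z *\<^sub>R norm (H z)) \<in> borel_measurable lborel"
    if "(\<lambda>z. indicat_real later z *\<^sub>R H z) \<in> borel_measurable lborel" for H :: "'e \<times> real \<Rightarrow> 'e \<times> real"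
    using measurable_compose[OF that borel_measurable_norm] by simp
  have "(\<integral>\<^sup>+z\<in>?\<Omega>. ennreal (w z * (norm (G z))\<^sup>2) \<partial>lborel) = (\<integral>\<^sup>+z\<in>?\<Omega>. ennreal (w z * (norm (G' z))\<^sup>2) \<partial>lborel)"
  proof (rule nn_integral_cong_AE)
    show "AE z in lborel. ennreal (w z * (norm (G z))\<^sup>2) * indicator ?\<Omega> z = ennreal (w z * (norm (G' z))\<^sup>2) * indicator ?\<Omega> z"
      using is_weak_grad_unique[OF op(1) is_weak_grad_subset[OF W sub] G'(1)]
      by eventually_elim (auto simp: indicator_def)
  qed
  then have GL2: "(\<lambda>z. norm (G z)) \<in> L2w w ?\<Omega>"
    using G'(3) later_cylinder_measurable[OF nm[OF Gm] Am] unfolding L2w_def set_borel_measurable_def by simp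
  have gL2: "(\<lambda>z. norm (reparam_grad G z)) \<in> L2w w ?\<Omega>"
    by (rule L2w_reparam[OF Am w nm[OF Gm] nm[OF measurable_later_reparam_grad[OF Gm]] _ GL2])
      (simp add: norm_reparam_grad_le)
  have uL2: "(\<lambda>z. U (backward z)) \<in> L2w w ?\<Omega>"
    by (rule L2w_reparam[OF Am w Um measurable_later_reparam[OF Um] _ G'(2)]) simp
  show ?thesis
    unfolding H1_def
  proof (intro CollectI conjI)
    show "\<exists>G. is_weak_grad ?\<Omega> (\<lambda>z. U (backward z)) G \<and> (\<lambda>z. U (backward z)) \<in> L2w w ?\<Omega> \<and>
        (\<lambda>z. norm (G z)) \<in> L2w w ?\<Omega>"
      using is_weak_grad_subset[OF is_weak_grad_reparam[OF W] sub] uL2 gL2 by blast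
    show "\<exists>f. (\<forall>k. smooth_fun (f k)) \<and> H1_tendsto w ?\<Omega> f (\<lambda>z. U (backward z))"
      using H1_tendsto_reparam[OF A w W f] smooth_fun_reparam[OF f(1) \<phi>_smooth]
      by (intro exI[of _ "\<lambda>k z. f k (backward z)"] conjI allI)
  qed
qed

lemma wt_time_reparam: "wt_time a (x, s) = wt_time a (x, t)"
  by (simp add: wt_time_def)

lemma UU_reparam:
  fixes U :: "'n::finite spacetime \<Rightarrow> real"
  assumes U: "U \<in> UU a"
  shows "(\<lambda>z. U (backward z)) \<in> UU a"
  unfolding UU_def Qplus_def
proof (intro INT_I)
  fix R :: real assume "R \<in> {0<..}"
  then have "U \<in> H1 (wt_time a) (ball 0 R \<times> {0<..<R\<^sup>2})" using U unfolding UU_def Qplus_def by blast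
  then show "(\<lambda>z. U (backward z)) \<in> H1 (wt_time a) (ball 0 R \<times> {0<..<R\<^sup>2})"
    by (intro H1_reparam[OF open_ball wt_nonneg(2) wt_time_reparam wt_time_measurable UU_is_weak_grad[OF U]])
qed

lemma has_trace_t0_reparam:
  fixes U :: "'n::finite spacetime \<Rightarrow> real"
  assumes U: "U \<in> UU a" and tr: "has_trace_t0 a U U0"
  shows "has_trace_t0 a (\<lambda>z. U (backward z)) U0"
  unfolding has_trace_t0_def Qplus_def
proof (intro conjI allI impI)
  show "U0 \<in> borel_measurable lborel" using tr unfolding has_trace_t0_def by blast
  fix R :: real assume "R > 0"
  then obtain f where f: "\<And>k. smooth_fun (f k)" "H1_tendsto (wt_time a) (ball 0 R \<times> {0<..<R\<^sup>2}) f U"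
    "(\<lambda>k. \<integral>\<^sup>+X\<in>ball 0 R. ennreal (wt a X * (f k (X, 0) - U0 X)\<^sup>2) \<partial>lborel) \<longlonglongrightarrow> 0"
    using tr unfolding has_trace_t0_def Qplus_def by blast
  show "\<exists>f. (\<forall>k. smooth_fun (f k)) \<and>
      H1_tendsto (wt_time a) (ball 0 R \<times> {0<..<R\<^sup>2}) f (\<lambda>z. U (backward z)) \<and>
      (\<lambda>k. \<integral>\<^sup>+X\<in>ball 0 R. ennreal (wt a X * (f k (X, 0) - U0 X)\<^sup>2) \<partial>lborel) \<longlonglongrightarrow> 0"
  proof (intro exI[of _ "\<lambda>k z. f k (backward z)"] conjI allI)
    show "smooth_fun (\<lambda>z. f k (backward z))" for k by (rule smooth_fun_reparam[OF f(1) \<phi>_smooth])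
    show "H1_tendsto (wt_time a) (ball 0 R \<times> {0<..<R\<^sup>2}) (\<lambda>k z. f k (backward z)) (\<lambda>z. U (backward z))"
      by (rule H1_tendsto_reparam[OF open_ball wt_nonneg(2) wt_time_reparam wt_time_measurable UU_is_weak_grad[OF U] f(1,2)])
  qed (use f(3) \<phi>_zero in simp)
qed

lemma has_trace_y0_reparam:
  fixes U :: "'n::finite spacetime \<Rightarrow> real"
  assumes U: "U \<in> UU a" and tr: "has_trace_y0 a U u"
  shows "has_trace_y0 a (\<lambda>z. U (backward z)) (\<lambda>p. u (backward p))"
  unfolding has_trace_y0_def Qplus_def
proof (intro conjI allI impI)
  have um: "(\<lambda>p. indicator later p *\<^sub>R u p) \<in> borel_measurable lborel"
    using tr unfolding has_trace_y0_def set_borel_measurable_def by (rule conjunct1)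
  show "set_borel_measurable lborel later (\<lambda>p. u (backward p))"
    unfolding set_borel_measurable_def by (rule measurable_later_reparam[OF um])
  fix R :: real assume "R > 0"
  then obtain f where f: "\<And>k. smooth_fun (f k)" "H1_tendsto (wt_time a) (ball 0 R \<times> {0<..<R\<^sup>2}) f U"
    "(\<lambda>k. \<integral>\<^sup>+p\<in>ball 0 R \<times> {0<..<R\<^sup>2}. ennreal ((f k ((fst p, 0), snd p) - u p)\<^sup>2) \<partial>lborel) \<longlonglongrightarrow> 0"
    using tr unfolding has_trace_y0_def Qplus_def by blast
  obtain B where B: "\<And>(F :: (real ^ 'n) \<times> real \<Rightarrow> ennreal) A. A \<in> sets borel \<Longrightarrow>
    (\<lambda>z. F z * indicator (A \<times> {0<..<R\<^sup>2}) z) \<in> borel_measurable lborel \<Longrightarrow>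
    (\<integral>\<^sup>+z\<in>A \<times> {0<..<R\<^sup>2}. F (backward z) \<partial>lborel) \<le> ennreal B * (\<integral>\<^sup>+z\<in>A \<times> {0<..<R\<^sup>2}. F z \<partial>lborel)"
    by (rule nn_integral_reparam_bound) (rule that)
  define F where "F k p = ennreal ((f k ((fst p, 0), snd p) - u p)\<^sup>2)" for k p
  have "(\<lambda>p. F k p * indicator (ball 0 R \<times> {0<..<R\<^sup>2}) p) \<in> borel_measurable lborel" for k
  proof -
    have um': "(\<lambda>p. indicator (ball 0 R \<times> {0<..<R\<^sup>2}) p *\<^sub>R u p) \<in> borel_measurable lborel"
      by (rule later_cylinder_measurable[OF um]) simp
    have fm: "(\<lambda>p. f k ((fst p, 0), snd p)) \<in> borel_measurable lborel"
      using smooth_fun_at_y0_measurable[OF f(1)] by simp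
    have ind: "indicator (ball 0 R \<times> {0<..<R\<^sup>2}) \<in> borel_measurable (lborel :: ((real ^ 'n) \<times> real) measure)"
      by (intro borel_measurable_indicator) (auto simp: borel_Times)
    have "(\<lambda>p. F k p * indicator (ball 0 R \<times> {0<..<R\<^sup>2}) p) = (\<lambda>p. ennreal ((f k ((fst p, 0), snd p)
      - indicator (ball 0 R \<times> {0<..<R\<^sup>2}) p *\<^sub>R u p)\<^sup>2) * indicator (ball 0 R \<times> {0<..<R\<^sup>2}) p)"
      by (rule ext) (auto simp: F_def indicator_def)
    also have "\<dots> \<in> borel_measurable lborel"
      using fm um' ind by (intro borel_measurable_times_ennreal measurable_compose[OF _ measurable_ennreal]
          borel_measurable_power borel_measurable_diff)
    finally show ?thesis .
  qed
  from B[OF _ this]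
  have le: "(\<integral>\<^sup>+p\<in>ball 0 R \<times> {0<..<R\<^sup>2}. F k (backward p) \<partial>lborel)
    \<le> ennreal B * (\<integral>\<^sup>+p\<in>ball 0 R \<times> {0<..<R\<^sup>2}. F k p \<partial>lborel)" for k by simp
  have "(\<lambda>k. ennreal B * (\<integral>\<^sup>+p\<in>ball 0 R \<times> {0<..<R\<^sup>2}. F k p \<partial>lborel)) \<longlonglongrightarrow> 0"
    using tendsto_mult_ennreal[OF tendsto_const f(3), of "ennreal B"] by (simp add: F_def)
  from tendsto_0_le_ennreal[OF this le]
  have conv: "(\<lambda>k. \<integral>\<^sup>+p\<in>ball 0 R \<times> {0<..<R\<^sup>2}. ennreal ((f k ((fst p, 0), \<phi> (snd p)) - u (backward p))\<^sup>2) \<partial>lborel) \<longlonglongrightarrow> 0"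
    unfolding F_def by simp
  show "\<exists>f. (\<forall>k. smooth_fun (f k)) \<and>
      H1_tendsto (wt_time a) (ball 0 R \<times> {0<..<R\<^sup>2}) f (\<lambda>z. U (backward z)) \<and>
      (\<lambda>k. \<integral>\<^sup>+p\<in>ball 0 R \<times> {0<..<R\<^sup>2}. ennreal ((f k ((fst p, 0), snd p) - u (backward p))\<^sup>2) \<partial>lborel) \<longlonglongrightarrow> 0"
  proof (intro exI[of _ "\<lambda>k z. f k (backward z)"] conjI allI)
    show "smooth_fun (\<lambda>z. f k (backward z))" for k by (rule smooth_fun_reparam[OF f(1) \<phi>_smooth])
    show "H1_tendsto (wt_time a) (ball 0 R \<times> {0<..<R\<^sup>2}) (\<lambda>k z. f k (backward z)) (\<lambda>z. U (backward z))"
      by (rule H1_tendsto_reparam[OF open_ball wt_nonneg(2) wt_time_reparam wt_time_measurable UU_is_weak_grad[OF U] f(1,2)])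
  qed (use conv in simp)
qed

lemma UU0_reparam:
  fixes U :: "'n::finite spacetime \<Rightarrow> real"
  assumes "U \<in> UU0 a U0"
  shows "(\<lambda>z. U (backward z)) \<in> UU0 a U0"
  using assms UU_reparam has_trace_t0_reparam unfolding UU0_def by blast

end

section \<open>The functional as an integral in time\<close>

definition dissipation :: "real \<Rightarrow> ('n::finite spacetime \<Rightarrow> real) \<Rightarrow> real \<Rightarrow> ennreal" where
  "dissipation a U t = (\<integral>\<^sup>+X. ennreal (wt a X * (time_deriv U (X, t))\<^sup>2) \<partial>lborel)"

definition gradient_energy :: "real \<Rightarrow> ('n::finite spacetime \<Rightarrow> real) \<Rightarrow> real \<Rightarrow> ennreal" where
  "gradient_energy a U t = (\<integral>\<^sup>+X. ennreal (wt a X * (norm (space_grad U (X, t)))\<^sup>2) \<partial>lborel)"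

definition trace_energy :: "real \<Rightarrow> (real \<Rightarrow> real) \<Rightarrow> ('n::finite spacetime \<Rightarrow> real) \<Rightarrow> real \<Rightarrow> ennreal" where
  "trace_energy a \<beta> U t = (\<integral>\<^sup>+x. ennreal (Phi \<beta> (trace_y0 a U (x, t))) \<partial>lborel)"

definition energy :: "real \<Rightarrow> (real \<Rightarrow> real) \<Rightarrow> ('n::finite spacetime \<Rightarrow> real) \<Rightarrow> real \<Rightarrow> ennreal" where
  "energy a \<beta> U t = gradient_energy a U t + trace_energy a \<beta> U t"

lemma slice_measurable:
  fixes H :: "'e::euclidean_space \<times> real \<Rightarrow> 'b::real_normed_vector"
  assumes H: "(\<lambda>z. indicator later z *\<^sub>R H z) \<in> borel_measurable lborel" and t: "t > 0"
  shows "(\<lambda>x. H (x, t)) \<in> borel_measurable borel"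
proof -
  have "(\<lambda>x::'e. (x, t)) \<in> borel_measurable borel"
    by (intro borel_measurable_continuous_onI continuous_intros)
  from measurable_compose[OF this, of "\<lambda>z. indicator later z *\<^sub>R H z" borel] H t
  show ?thesis by simp
qed

lemma slice_integral_measurable:
  fixes F :: "'e::euclidean_space \<times> real \<Rightarrow> ennreal"
  assumes "(\<lambda>z. F z * indicator later z) \<in> borel_measurable lborel"
  shows "(\<lambda>t. (\<integral>\<^sup>+x. F (x, t) \<partial>lborel) * indicator {0<..} t) \<in> borel_measurable borel"
proof -
  have "(\<lambda>t. (\<integral>\<^sup>+x. F (x, t) \<partial>lborel) * indicator {0<..} t)
    = (\<lambda>t. \<integral>\<^sup>+x. F (x, t) * indicator later (x, t) \<partial>lborel)"
    by (rule ext) (auto simp: indicator_def)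
  then show ?thesis using nn_integral_lborel_snd(2)[OF assms] by simp
qed

lemma open_later: "open (later :: ('e::euclidean_space \<times> real) set)"
  by (intro open_Times open_UNIV open_greaterThan)

lemma weak_grad_measurable:
  fixes U :: "'n::finite spacetime \<Rightarrow> real"
  assumes "U \<in> UU a"
  shows "(\<lambda>z. indicator later z *\<^sub>R weak_grad later U z) \<in> borel_measurable lborel"
  by (rule locally_integrable_measurable[OF is_weak_grad_locally_integrable(2)[OF UU_is_weak_grad[OF assms]] open_later])

lemma time_deriv_measurable:
  fixes U :: "'n::finite spacetime \<Rightarrow> real"
  assumes "U \<in> UU a"
  shows "(\<lambda>z. indicator later z *\<^sub>R time_deriv U z) \<in> borel_measurable lborel"
proof -
  have "(snd :: 'n spacetime \<Rightarrow> real) \<in> borel_measurable borel"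
    by (intro borel_measurable_continuous_onI continuous_intros)
  from measurable_compose[OF weak_grad_measurable[OF assms] this] show ?thesis
    by (simp add: time_deriv_def)
qed

lemma space_grad_measurable:
  fixes U :: "'n::finite spacetime \<Rightarrow> real"
  assumes "U \<in> UU a"
  shows "(\<lambda>z. indicator later z *\<^sub>R space_grad U z) \<in> borel_measurable lborel"
proof -
  have "(fst :: 'n spacetime \<Rightarrow> 'n space) \<in> borel_measurable borel"
    by (intro borel_measurable_continuous_onI continuous_intros)
  from measurable_compose[OF weak_grad_measurable[OF assms] this] show ?thesis
    by (simp add: space_grad_def)
qed

lemma weighted_square_measurable:
  fixes H :: "'n::finite spacetime \<Rightarrow> 'b::real_normed_vector"
  assumes H: "(\<lambda>z. indicator later z *\<^sub>R H z) \<in> borel_measurable lborel"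
  shows "(\<lambda>z. ennreal (wt_time a z * (norm (H z))\<^sup>2) * indicator later z) \<in> borel_measurable lborel"
proof -
  have "(\<lambda>z. ennreal (wt_time a z * (norm (H z))\<^sup>2) * indicator later z)
    = (\<lambda>z. ennreal (wt_time a z * (norm (indicat_real later z *\<^sub>R H z))\<^sup>2))"
    by (rule ext) (auto simp: indicator_def)
  also have "\<dots> \<in> borel_measurable lborel"
  proof -
    have "(wt_time a :: 'n spacetime \<Rightarrow> real) \<in> borel_measurable lborel" using wt_time_measurable by simp
    then show ?thesis
      by (intro measurable_compose[OF _ measurable_ennreal] borel_measurable_times borel_measurable_power
          measurable_compose[OF H borel_measurable_norm])
  qed
  finally show ?thesis .
qed

lemma dissipation_measurable:
  fixes U :: "'n::finite spacetime \<Rightarrow> real"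
  assumes "U \<in> UU a"
  shows "(\<lambda>t. dissipation a U t * indicator {0<..} t) \<in> borel_measurable borel"
  using slice_integral_measurable[OF weighted_square_measurable[OF time_deriv_measurable[OF assms], of a]]
  by (simp add: dissipation_def wt_time_def)

lemma gradient_energy_measurable:
  fixes U :: "'n::finite spacetime \<Rightarrow> real"
  assumes "U \<in> UU a"
  shows "(\<lambda>t. gradient_energy a U t * indicator {0<..} t) \<in> borel_measurable borel"
  using slice_integral_measurable[OF weighted_square_measurable[OF space_grad_measurable[OF assms], of a]]
  by (simp add: gradient_energy_def wt_time_def)

lemma Phi_deriv:
  assumes "admissible_beta \<beta>"
  shows "(Phi \<beta> has_real_derivative 2 * \<beta> x) (at x)"
proof -
  have cont: "continuous_on S \<beta>" for S
    using assms continuous_on_subset unfolding admissible_beta_def by blast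
  have "((\<lambda>u. LBINT v=ereal 0..ereal u. \<beta> v) has_vector_derivative \<beta> x) (at x within {min 0 x - 1..max 0 x + 1})"
    by (rule interval_integral_FTC2[OF _ _ cont]) auto
  then have "((\<lambda>u. LBINT v=ereal 0..ereal u. \<beta> v) has_vector_derivative \<beta> x) (at x)"
    by (subst (asm) at_within_interior) (auto simp: interior_atLeastAtMost_real)
  then have "((\<lambda>u. LBINT v=ereal 0..ereal u. \<beta> v) has_real_derivative \<beta> x) (at x)"
    by (simp add: has_real_derivative_iff_has_vector_derivative)
  from DERIV_cmult[OF this, of 2] show ?thesis
    by (simp add: Phi_def[abs_def])
qed

text \<open>The density \<open>\<beta>\<close> vanishes outside \<open>[0, 1]\<close>, so \<open>\<Phi>\<close> is constant to the left of \<open>0\<close> and to the right of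
  \<open>1\<close>, with the values \<open>0\<close> and \<open>1\<close>.\<close>

lemma Phi_bounds:
  assumes adm: "admissible_beta \<beta>"
  shows "0 \<le> Phi \<beta> u" "Phi \<beta> u \<le> 1" "u \<le> 0 \<Longrightarrow> Phi \<beta> u = 0"
proof -
  have outside: "\<beta> v = 0" if "v \<notin> {0..1}" for v
    using adm that closure_subset[of "{v. \<beta> v \<noteq> 0}"] unfolding admissible_beta_def by auto
  have pos: "0 \<le> \<beta> v" for v using adm unfolding admissible_beta_def by blast
  have mono: "Phi \<beta> s \<le> Phi \<beta> t" if "s \<le> t" for s t
    by (rule deriv_nonneg_imp_mono[OF Phi_deriv[OF adm] _ that]) (simp add: pos)
  have const: "Phi \<beta> s = Phi \<beta> t" if "s \<le> t" "t \<le> 0 \<or> 1 \<le> s" for s t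
  proof -
    have cont: "isCont (Phi \<beta>) x" for x using Phi_deriv[OF adm] by (rule DERIV_isCont)
    show ?thesis
    proof (cases "s = t")
      case False
      then have "s < t" using that(1) by simp
      have "(Phi \<beta> has_real_derivative 0) (at x)" if x: "s < x" "x < t" for x
        using Phi_deriv[OF adm, of x] outside[of x] x \<open>t \<le> 0 \<or> 1 \<le> s\<close> by auto
      moreover have "continuous_on {s..t} (Phi \<beta>)"
        using cont by (intro continuous_at_imp_continuous_on) blast
      ultimately have "Phi \<beta> t = Phi \<beta> s"
        by (intro DERIV_isconst_end[OF \<open>s < t\<close>])
      then show ?thesis by simp
    qed simp
  qed
  have zero: "Phi \<beta> 0 = 0" by (simp add: Phi_def zero_ereal_def)
  have one: "Phi \<beta> 1 = 1"
    using adm unfolding admissible_beta_def Phi_def by (simp add: zero_ereal_def one_ereal_def)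
  show le0: "Phi \<beta> u = 0" if "u \<le> 0"
    using const[of u 0] that zero by simp
  show "0 \<le> Phi \<beta> u" using mono[of 0 u] le0 zero by (cases "u \<le> 0") auto
  show "Phi \<beta> u \<le> 1" using mono[of u 1] const[of 1 u] one by (cases "u \<le> 1") auto
qed

lemma Phi_measurable:
  assumes "admissible_beta \<beta>"
  shows "Phi \<beta> \<in> borel_measurable borel"
  by (intro borel_measurable_continuous_onI continuous_on_real_deriv[OF Phi_deriv[OF assms]])

lemma trace_measurable:
  fixes U :: "'n::finite spacetime \<Rightarrow> real"
  assumes "-1 < a" "a < 1" "U \<in> UU a"
  shows "(\<lambda>p. indicator later p *\<^sub>R trace_y0 a U p) \<in> borel_measurable lborel"
  using has_trace_y0_trace[OF assms] unfolding has_trace_y0_def set_borel_measurable_def by (rule conjunct1)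

lemma trace_energy_measurable:
  fixes U :: "'n::finite spacetime \<Rightarrow> real"
  assumes a: "-1 < a" "a < 1" and U: "U \<in> UU a" and adm: "admissible_beta \<beta>"
  shows "(\<lambda>t. trace_energy a \<beta> U t * indicator {0<..} t) \<in> borel_measurable borel"
  unfolding trace_energy_def
proof (rule slice_integral_measurable)
  have "(\<lambda>p. ennreal (Phi \<beta> (trace_y0 a U p)) * indicator later p)
    = (\<lambda>p. ennreal (Phi \<beta> (indicator later p *\<^sub>R trace_y0 a U p)))"
    by (rule ext) (auto simp: indicator_def Phi_bounds(3)[OF adm])
  also have "\<dots> \<in> borel_measurable lborel"
    by (rule measurable_compose[OF measurable_compose[OF trace_measurable[OF a U] Phi_measurable[OF adm]] measurable_ennreal])
  finally show "(\<lambda>p. ennreal (Phi \<beta> (trace_y0 a U p)) * indicator later p) \<in> borel_measurable lborel" .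
qed

lemma energy_measurable:
  fixes U :: "'n::finite spacetime \<Rightarrow> real"
  assumes a: "-1 < a" "a < 1" and U: "U \<in> UU a" and adm: "admissible_beta \<beta>"
  shows "(\<lambda>t. energy a \<beta> U t * indicator {0<..} t) \<in> borel_measurable borel"
  using borel_measurable_add[OF gradient_energy_measurable[OF U] trace_energy_measurable[OF a U adm]]
  by (simp add: energy_def distrib_right)

lemma slice_square_measurable:
  fixes H :: "'n::finite spacetime \<Rightarrow> 'b::real_normed_vector"
  assumes H: "(\<lambda>z. indicator later z *\<^sub>R H z) \<in> borel_measurable lborel" and t: "t > 0"
  shows "(\<lambda>X. ennreal (wt a X * (norm (H (X, t)))\<^sup>2)) \<in> borel_measurable lborel"
proof -
  have "(wt a :: 'n space \<Rightarrow> real) \<in> borel_measurable lborel" using wt_measurable by simp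
  moreover have "(\<lambda>X. H (X, t)) \<in> borel_measurable lborel" using slice_measurable[OF H t] by simp
  ultimately show ?thesis
    by (intro measurable_compose[OF _ measurable_ennreal] borel_measurable_times borel_measurable_power
        measurable_compose[OF _ borel_measurable_norm])
qed

lemma FF_eq:
  fixes U :: "'n::finite spacetime \<Rightarrow> real"
  assumes U: "U \<in> UU a" and \<epsilon>: "\<epsilon> > 0"
  shows "FF a \<beta> \<epsilon> U = (\<integral>\<^sup>+t\<in>{0<..}. ennreal (exp (- t / \<epsilon>) / \<epsilon>) *
    (ennreal \<epsilon> * dissipation a U t + energy a \<beta> U t) \<partial>lborel)"
  unfolding FF_def
proof (rule nn_integral_cong)
  fix t :: real
  have "(\<integral>\<^sup>+X. ennreal (wt a X * (\<epsilon> * (time_deriv U (X, t))\<^sup>2 + (norm (space_grad U (X, t)))\<^sup>2)) \<partial>lborel)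
    = ennreal \<epsilon> * dissipation a U t + gradient_energy a U t" if t: "t > 0"
  proof -
    have m: "(\<lambda>X. ennreal (wt a X * (time_deriv U (X, t))\<^sup>2)) \<in> borel_measurable lborel"
      "(\<lambda>X. ennreal (wt a X * (norm (space_grad U (X, t)))\<^sup>2)) \<in> borel_measurable lborel"
      using slice_square_measurable[OF time_deriv_measurable[OF U] t, of a]
        slice_square_measurable[OF space_grad_measurable[OF U] t, of a] by simp_all
    have "(\<integral>\<^sup>+X. ennreal (wt a X * (\<epsilon> * (time_deriv U (X, t))\<^sup>2 + (norm (space_grad U (X, t)))\<^sup>2)) \<partial>lborel)
      = (\<integral>\<^sup>+X. ennreal \<epsilon> * ennreal (wt a X * (time_deriv U (X, t))\<^sup>2)
          + ennreal (wt a X * (norm (space_grad U (X, t)))\<^sup>2) \<partial>lborel)"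
    proof (rule nn_integral_cong)
      fix X
      have "wt a X * (\<epsilon> * (time_deriv U (X, t))\<^sup>2 + (norm (space_grad U (X, t)))\<^sup>2)
        = \<epsilon> * (wt a X * (time_deriv U (X, t))\<^sup>2) + wt a X * (norm (space_grad U (X, t)))\<^sup>2"
        by (simp add: algebra_simps)
      then show "ennreal (wt a X * (\<epsilon> * (time_deriv U (X, t))\<^sup>2 + (norm (space_grad U (X, t)))\<^sup>2))
        = ennreal \<epsilon> * ennreal (wt a X * (time_deriv U (X, t))\<^sup>2) + ennreal (wt a X * (norm (space_grad U (X, t)))\<^sup>2)"
        using \<epsilon> wt_nonneg(1)[of a X] by (simp only: ennreal_mult'[symmetric] ennreal_plus mult_nonneg_nonneg zero_le_power2 less_imp_le)
    qed
    also have "\<dots> = ennreal \<epsilon> * dissipation a U t + gradient_energy a U t"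
      unfolding dissipation_def gradient_energy_def using m by (simp add: nn_integral_add nn_integral_cmult)
    finally show ?thesis .
  qed
  then show "ennreal (exp (- t / \<epsilon>) / \<epsilon>) *
        ((\<integral>\<^sup>+X. ennreal (wt a X * (\<epsilon> * (time_deriv U (X, t))\<^sup>2 + (norm (space_grad U (X, t)))\<^sup>2)) \<partial>lborel)
         + (\<integral>\<^sup>+x. ennreal (Phi \<beta> (trace_y0 a U (x, t))) \<partial>lborel)) * indicator {0<..} t
    = ennreal (exp (- t / \<epsilon>) / \<epsilon>) * (ennreal \<epsilon> * dissipation a U t + energy a \<beta> U t) * indicator {0<..} t"
    by (cases "t > 0") (simp_all add: energy_def trace_energy_def add.assoc)
qed

context time_change
begin

text \<open>The weak gradient and the trace of the reparametrised function are identified by uniqueness, almost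
  everywhere in space-time and hence, by Fubini, on almost every time slice.\<close>

lemma AE_reparam_energies:
  fixes U :: "'n::finite spacetime \<Rightarrow> real"
  assumes a: "-1 < a" "a < 1" and U: "U \<in> UU a"
  defines "V \<equiv> (\<lambda>z. U (backward z))"
  shows "AE t in lborel. t > 0 \<longrightarrow>
    dissipation a V t = ennreal ((1 / \<psi>' (\<phi> t))\<^sup>2) * dissipation a U (\<phi> t) \<and>
    energy a \<beta> V t = energy a \<beta> U (\<phi> t)"
proof -
  have V: "V \<in> UU a" unfolding V_def by (rule UU_reparam[OF U])
  have grad: "AE z in lborel. z \<in> later \<longrightarrow>
    weak_grad later V z = reparam_grad (weak_grad later U) z"
    by (rule is_weak_grad_unique[OF open_later UU_is_weak_grad[OF V]])
      (unfold V_def, rule is_weak_grad_reparam[OF UU_is_weak_grad[OF U]])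
  have trace: "AE p in lborel. p \<in> later \<longrightarrow> trace_y0 a V p = trace_y0 a U (backward p)"
    by (rule has_trace_y0_unique[OF a has_trace_y0_trace[OF a V]])
      (unfold V_def, rule has_trace_y0_reparam[OF U has_trace_y0_trace[OF a U]])
  from AE_lborel_snd[OF grad] AE_lborel_snd[OF trace] show ?thesis
  proof eventually_elim
    case (elim t)
    show ?case
    proof
      assume t: "t > 0"
      then have ft: "\<phi> t > 0" by (simp add: \<phi>_pos_iff)
      have td: "AE X in lborel. time_deriv V (X, t) = 1 / \<psi>' (\<phi> t) * time_deriv U (X, \<phi> t)"
        using elim(1) by eventually_elim (use t in \<open>simp add: time_deriv_def reparam_grad_def\<close>)
      have sg: "AE X in lborel. space_grad V (X, t) = space_grad U (X, \<phi> t)"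
        using elim(1) by eventually_elim (use t in \<open>simp add: space_grad_def reparam_grad_def\<close>)
      have tr: "AE x in lborel. trace_y0 a V (x, t) = trace_y0 a U (x, \<phi> t)"
        using elim(2) by eventually_elim (use t in simp)
      have "dissipation a V t = (\<integral>\<^sup>+X. ennreal ((1 / \<psi>' (\<phi> t))\<^sup>2) * ennreal (wt a X * (time_deriv U (X, \<phi> t))\<^sup>2) \<partial>lborel)"
        unfolding dissipation_def
      proof (rule nn_integral_cong_AE)
        show "AE X in lborel. ennreal (wt a X * (time_deriv V (X, t))\<^sup>2)
          = ennreal ((1 / \<psi>' (\<phi> t))\<^sup>2) * ennreal (wt a X * (time_deriv U (X, \<phi> t))\<^sup>2)"
          using td by eventually_elim
            (simp only: ennreal_mult'[symmetric] zero_le_power2 power_mult_distrib mult.left_commute)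
      qed
      also have "\<dots> = ennreal ((1 / \<psi>' (\<phi> t))\<^sup>2) * dissipation a U (\<phi> t)"
        unfolding dissipation_def
        by (rule nn_integral_cmult) (use slice_square_measurable[OF time_deriv_measurable[OF U] ft, of a] in simp)
      finally have 1: "dissipation a V t = ennreal ((1 / \<psi>' (\<phi> t))\<^sup>2) * dissipation a U (\<phi> t)" .
      have 2: "gradient_energy a V t = gradient_energy a U (\<phi> t)"
        unfolding gradient_energy_def
        by (rule nn_integral_cong_AE) (use sg in \<open>eventually_elim, simp\<close>)
      have 3: "trace_energy a \<beta> V t = trace_energy a \<beta> U (\<phi> t)"
        unfolding trace_energy_def
        by (rule nn_integral_cong_AE) (use tr in \<open>eventually_elim, simp\<close>)
      show "dissipation a V t = ennreal ((1 / \<psi>' (\<phi> t))\<^sup>2) * dissipation a U (\<phi> t) \<and>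
        energy a \<beta> V t = energy a \<beta> U (\<phi> t)"
        unfolding energy_def using 1 2 3 by simp
    qed
  qed
qed

lemma FF_reparam:
  fixes U :: "'n::finite spacetime \<Rightarrow> real"
  assumes a: "-1 < a" "a < 1" and U: "U \<in> UU a" and adm: "admissible_beta \<beta>" and \<epsilon>: "\<epsilon> > 0"
  shows "FF a \<beta> \<epsilon> (\<lambda>z. U (backward z)) = (\<integral>\<^sup>+s\<in>{0<..}. ennreal (exp (- \<psi> s / \<epsilon>) / \<epsilon>) *
    (ennreal (\<epsilon> / \<psi>' s) * dissipation a U s + ennreal (\<psi>' s) * energy a \<beta> U s) \<partial>lborel)"
proof -
  define D where "D t = dissipation a U t * indicator {0<..} t" for t
  define E where "E t = energy a \<beta> U t * indicator {0<..} t" for t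
  have [measurable]: "D \<in> borel_measurable borel" "E \<in> borel_measurable borel"
    unfolding D_def[abs_def] E_def[abs_def] using dissipation_measurable[OF U] energy_measurable[OF a U adm] by auto
  define K where "K t = ennreal (exp (- t / \<epsilon>) / \<epsilon>) *
    (ennreal \<epsilon> * (ennreal ((1 / \<psi>' (\<phi> t))\<^sup>2) * D (\<phi> t)) + E (\<phi> t))" for t
  have [measurable]: "K \<in> borel_measurable borel" unfolding K_def[abs_def] by measurable
  have "FF a \<beta> \<epsilon> (\<lambda>z. U (backward z)) = (\<integral>\<^sup>+t. K t \<partial>lborel)"
    unfolding FF_eq[OF UU_reparam[OF U] \<epsilon>]
  proof (rule nn_integral_cong_AE)
    show "AE t in lborel. ennreal (exp (- t / \<epsilon>) / \<epsilon>) *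
      (ennreal \<epsilon> * dissipation a (\<lambda>z. U (backward z)) t + energy a \<beta> (\<lambda>z. U (backward z)) t) *
      indicator {0<..} t = K t"
      using AE_reparam_energies[OF a U, of \<beta>]
    proof eventually_elim
      case (elim t)
      then show ?case
        by (cases "t > 0") (simp_all add: K_def D_def E_def \<phi>_pos_iff)
    qed
  qed
  also have "\<dots> = (\<integral>\<^sup>+s. ennreal (\<psi>' s) * K (\<psi> s) \<partial>lborel)"
    by (rule nn_integral_change) measurable
  also have "\<dots> = (\<integral>\<^sup>+s\<in>{0<..}. ennreal (exp (- \<psi> s / \<epsilon>) / \<epsilon>) *
    (ennreal (\<epsilon> / \<psi>' s) * dissipation a U s + ennreal (\<psi>' s) * energy a \<beta> U s) \<partial>lborel)"
  proof (rule nn_integral_cong)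
    fix s
    have p: "0 \<le> \<psi>' s" "\<psi>' s \<noteq> 0" using \<psi>'_pos[of s] by auto
    have "\<psi>' s * (\<epsilon> * (1 / \<psi>' s)\<^sup>2) = \<epsilon> / \<psi>' s"
      using p by (simp add: power2_eq_square)
    then have "ennreal (\<psi>' s) * (ennreal \<epsilon> * (ennreal ((1 / \<psi>' s)\<^sup>2))) = ennreal (\<epsilon> / \<psi>' s)"
      using p \<epsilon> by (simp only: ennreal_mult'[symmetric] zero_le_power2 less_imp_le mult_nonneg_nonneg)
    then have "ennreal (\<psi>' s) * (ennreal \<epsilon> * (ennreal ((1 / \<psi>' s)\<^sup>2) * D s)) = ennreal (\<epsilon> / \<psi>' s) * D s"
      by (metis mult.assoc)
    moreover have "ennreal (\<psi>' s) * K (\<psi> s) = ennreal (exp (- \<psi> s / \<epsilon>) / \<epsilon>) *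
      (ennreal (\<psi>' s) * (ennreal \<epsilon> * (ennreal ((1 / \<psi>' s)\<^sup>2) * D s)) + ennreal (\<psi>' s) * E s)"
      unfolding K_def \<phi>_\<psi> by (simp only: distrib_left mult.left_commute)
    ultimately show "ennreal (\<psi>' s) * K (\<psi> s) = ennreal (exp (- \<psi> s / \<epsilon>) / \<epsilon>) *
      (ennreal (\<epsilon> / \<psi>' s) * dissipation a U s + ennreal (\<psi>' s) * energy a \<beta> U s) * indicator {0<..} s"
      by (simp add: D_def E_def indicator_def)
  qed
  finally show ?thesis .
qed

end

section \<open>Estimates from inner variations\<close>

text \<open>The perturbation \<open>\<eta> s = e\<^bsup>(1/\<epsilon> - \<kappa>) s\<^esup> - e\<^bsup>-\<kappa> s\<^esup>\<close> satisfies \<open>w \<eta> = (1 - w) e\<^bsup>-\<kappa> s\<^esup>\<close> for the weight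
  \<open>w = e\<^bsup>-s/\<epsilon>\<^esup>\<close>. To first order in \<open>\<delta>\<close>, the coefficient of the energy changes by a multiple of the
  derivative of this product, which is negative once \<open>w\<close> is small compared with \<open>\<kappa> \<epsilon>\<close>; there the
  energy is controlled without an exponential weight. The bound \<open>\<kappa> \<le> 1/\<epsilon>\<close> makes \<open>\<eta>\<close> increasing.\<close>

lemma time_change_exp:
  assumes "0 < \<delta>" "0 < \<epsilon>" "0 \<le> \<kappa>" "\<kappa> \<le> 1 / \<epsilon>"
  shows "time_change (\<lambda>s. s + \<delta> * (exp ((1 / \<epsilon> - \<kappa>) * s) - exp ((- \<kappa>) * s)))
    (\<lambda>s. 1 + \<delta> * ((1 / \<epsilon> - \<kappa>) * exp ((1 / \<epsilon> - \<kappa>) * s) + \<kappa> * exp ((- \<kappa>) * s)))"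
proof
  show "((\<lambda>s. s + \<delta> * (exp ((1 / \<epsilon> - \<kappa>) * s) - exp ((- \<kappa>) * s))) has_real_derivative
    1 + \<delta> * ((1 / \<epsilon> - \<kappa>) * exp ((1 / \<epsilon> - \<kappa>) * s) + \<kappa> * exp ((- \<kappa>) * s))) (at s)" for s
    using assms by (auto intro!: derivative_eq_intros simp: algebra_simps)
  show "1 \<le> 1 + \<delta> * ((1 / \<epsilon> - \<kappa>) * exp ((1 / \<epsilon> - \<kappa>) * s) + \<kappa> * exp ((- \<kappa>) * s))" for s
    using assms by simp
  show "smooth_fun (\<lambda>s. s + \<delta> * (exp ((1 / \<epsilon> - \<kappa>) * s) - exp ((- \<kappa>) * s)))"
    by (intro smooth_fun_add smooth_fun_mult smooth_fun_diff smooth_fun_const smooth_fun_exp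
        smooth_fun_bounded_linear bounded_linear_ident)
qed simp

text \<open>\<open>D\<close> and \<open>E\<close> are the dissipation and the energy of a minimizer at each time, extended by zero to
  nonpositive times. Only the total of the functional and its comparison with all reparametrisations
  enter the estimates.\<close>

locale minimal_energy =
  fixes D E :: "real \<Rightarrow> ennreal" and \<epsilon> c :: real
  assumes measD: "D \<in> borel_measurable borel" and measE: "E \<in> borel_measurable borel"
    and past: "\<And>s. s \<le> 0 \<Longrightarrow> D s = 0" "\<And>s. s \<le> 0 \<Longrightarrow> E s = 0"
    and \<epsilon>: "0 < \<epsilon>" and c: "0 \<le> c"
    and total: "(\<integral>\<^sup>+s. ennreal (exp (- s / \<epsilon>) / \<epsilon>) * (ennreal \<epsilon> * D s + E s) \<partial>lborel) \<le> ennreal c"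
    and minimal: "\<And>\<psi> \<psi>'. time_change \<psi> \<psi>' \<Longrightarrow>
      (\<integral>\<^sup>+s. ennreal (exp (- s / \<epsilon>) / \<epsilon>) * (ennreal \<epsilon> * D s + E s) \<partial>lborel) \<le>
      (\<integral>\<^sup>+s. ennreal (exp (- \<psi> s / \<epsilon>) / \<epsilon>) * (ennreal (\<epsilon> / \<psi>' s) * D s + ennreal (\<psi>' s) * E s) \<partial>lborel)"
begin

lemmas [measurable] = measD measE

definition W :: "real \<Rightarrow> real" where "W s = exp (- s / \<epsilon>)"

definition A :: ennreal where "A = (\<integral>\<^sup>+s. ennreal (W s) * D s \<partial>lborel)"

definition B :: ennreal where "B = (\<integral>\<^sup>+s. ennreal (W s / \<epsilon>) * E s \<partial>lborel)"

lemma W_pos: "0 < W s" by (simp add: W_def)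

lemma W_measurable [measurable]: "W \<in> borel_measurable borel"
  unfolding W_def[abs_def] by measurable

lemma weighted_sum:
  assumes [measurable]: "p \<in> borel_measurable borel" "q \<in> borel_measurable borel" "r \<in> borel_measurable borel"
    and nn: "\<And>s. 0 \<le> r s" "\<And>s. 0 \<le> p s"
  shows "(\<integral>\<^sup>+s. ennreal (r s) * (ennreal (p s) * D s + ennreal (q s) * E s) \<partial>lborel) =
    (\<integral>\<^sup>+s. ennreal (r s * p s) * D s \<partial>lborel) + (\<integral>\<^sup>+s. ennreal (r s * q s) * E s \<partial>lborel)"
proof -
  have "(\<integral>\<^sup>+s. ennreal (r s) * (ennreal (p s) * D s + ennreal (q s) * E s) \<partial>lborel) =
    (\<integral>\<^sup>+s. ennreal (r s * p s) * D s + ennreal (r s * q s) * E s \<partial>lborel)"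
    using nn by (intro nn_integral_cong) (simp add: ennreal_mult' distrib_left mult.assoc)
  then show ?thesis by (simp add: nn_integral_add)
qed

lemma total_eq: "(\<integral>\<^sup>+s. ennreal (exp (- s / \<epsilon>) / \<epsilon>) * (ennreal \<epsilon> * D s + E s) \<partial>lborel) = A + B"
  using weighted_sum[of "\<lambda>_. \<epsilon>" "\<lambda>_. 1" "\<lambda>s. exp (- s / \<epsilon>) / \<epsilon>"] \<epsilon>
  unfolding A_def B_def W_def by simp

lemma A_le: "A \<le> ennreal c" and B_le: "B \<le> ennreal c"
  using total unfolding total_eq by (meson add_increasing add_increasing2 order_trans order_refl zero_le)+

lemma minimal_le:
  assumes tc: "time_change \<psi> \<psi>'"
  shows "A + B \<le> (\<integral>\<^sup>+s. ennreal (exp (- \<psi> s / \<epsilon>) / \<psi>' s) * D s \<partial>lborel)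
    + (\<integral>\<^sup>+s. ennreal (exp (- \<psi> s / \<epsilon>) / \<epsilon> * \<psi>' s) * E s \<partial>lborel)"
proof -
  interpret time_change \<psi> \<psi>' by (rule tc)
  have "(\<integral>\<^sup>+s. ennreal (exp (- \<psi> s / \<epsilon>) / \<epsilon>) * (ennreal (\<epsilon> / \<psi>' s) * D s + ennreal (\<psi>' s) * E s) \<partial>lborel)
    = (\<integral>\<^sup>+s. ennreal (exp (- \<psi> s / \<epsilon>) / \<epsilon> * (\<epsilon> / \<psi>' s)) * D s \<partial>lborel)
    + (\<integral>\<^sup>+s. ennreal (exp (- \<psi> s / \<epsilon>) / \<epsilon> * \<psi>' s) * E s \<partial>lborel)"
    by (rule weighted_sum) (use \<epsilon> less_imp_le[OF \<psi>'_pos] in auto)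
  then show ?thesis using minimal[OF tc] \<epsilon> unfolding total_eq by simp
qed

lemma exp_minus_bound: "0 \<le> x \<Longrightarrow> exp (- x) * (1 + x) \<le> (1::real)"
  using exp_ge_add_one_self[of x] by (simp add: exp_minus field_simps)

text \<open>This is the variation with \<open>\<kappa> = 0\<close> and \<open>\<delta> = \<epsilon> \<eta>\<close>. With \<open>W = e\<^bsup>-s/\<epsilon>\<^esup>\<close> the coefficient of \<open>D\<close> drops from
  \<open>W\<close> to at most \<open>W\<^sup>2 / (W + \<eta>)\<close>, a loss of \<open>\<eta> W / (W + \<eta>)\<close>, and that of \<open>E\<close> grows at most by the factor
  \<open>1 + \<eta>\<close>. The common finite part \<open>A1 + B\<close> cancels, and so does the factor \<open>\<eta>\<close>.\<close>

lemma dissipation_weighted: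
  assumes \<eta>: "0 < \<eta>"
  shows "(\<integral>\<^sup>+s. ennreal (W s / (W s + \<eta>)) * D s \<partial>lborel) \<le> ennreal c"
proof -
  define A1 where "A1 = (\<integral>\<^sup>+s. ennreal ((W s)\<^sup>2 / (W s + \<eta>)) * D s \<partial>lborel)"
  define r where "r = (\<integral>\<^sup>+s. ennreal (\<eta> * (W s / (W s + \<eta>))) * D s \<partial>lborel)"
  define \<psi> where "\<psi> s = s + \<epsilon> * \<eta> * (exp ((1 / \<epsilon> - 0) * s) - exp ((- 0) * s))" for s
  define \<psi>' where "\<psi>' s = 1 + \<epsilon> * \<eta> * ((1 / \<epsilon> - 0) * exp ((1 / \<epsilon> - 0) * s) + 0 * exp ((- 0) * s))" for s
  have tc: "time_change \<psi> \<psi>'"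
    unfolding \<psi>_def[abs_def] \<psi>'_def[abs_def] by (rule time_change_exp) (use \<eta> \<epsilon> in auto)
  have A_split: "A = A1 + r"
  proof -
    have "ennreal (W s) * D s = ennreal ((W s)\<^sup>2 / (W s + \<eta>)) * D s + ennreal (\<eta> * (W s / (W s + \<eta>))) * D s" for s
    proof -
      have "(W s)\<^sup>2 / (W s + \<eta>) + \<eta> * (W s / (W s + \<eta>)) = W s * (W s + \<eta>) / (W s + \<eta>)"
        by (simp add: add_divide_distrib power2_eq_square distrib_left mult.commute)
      then have "W s = (W s)\<^sup>2 / (W s + \<eta>) + \<eta> * (W s / (W s + \<eta>))"
        using W_pos[of s] \<eta> by simp
      then have "ennreal (W s) = ennreal ((W s)\<^sup>2 / (W s + \<eta>)) + ennreal (\<eta> * (W s / (W s + \<eta>)))"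
        using W_pos[of s] \<eta> by (subst ennreal_plus[symmetric]) auto
      then show ?thesis by (simp only: distrib_right)
    qed
    then show ?thesis unfolding A_def A1_def r_def by (simp add: nn_integral_add)
  qed
  have inv: "exp ((1 / \<epsilon> - 0) * s) = 1 / W s" for s
    unfolding W_def by (simp add: exp_minus inverse_eq_divide)
  have \<psi>_W: "exp (- \<psi> s / \<epsilon>) = W s * exp (- (\<eta> * (1 / W s - 1)))" for s
    unfolding \<psi>_def inv using \<epsilon> by (simp add: W_def exp_add[symmetric] field_simps)
  have \<psi>'_W: "\<psi>' s = 1 + \<eta> / W s" for s
    unfolding \<psi>'_def inv using \<epsilon> by simp
  have x: "0 \<le> \<eta> * (1 / W s - 1)" if "s > 0" for s
  proof -
    have "W s \<le> 1" unfolding W_def using that \<epsilon> by simp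
    then show ?thesis using W_pos[of s] \<eta> by (simp add: field_simps)
  qed
  have q: "ennreal (exp (- \<psi> s / \<epsilon>) / \<psi>' s) * D s \<le> ennreal ((W s)\<^sup>2 / (W s + \<eta>)) * D s" for s
  proof (cases "s > 0")
    case True
    have "exp (- \<psi> s / \<epsilon>) / \<psi>' s = exp (- (\<eta> * (1 / W s - 1))) * ((W s)\<^sup>2 / (W s + \<eta>))"
      unfolding \<psi>_W \<psi>'_W using W_pos[of s] \<eta> by (simp add: field_simps power2_eq_square)
    also have "\<dots> \<le> 1 * ((W s)\<^sup>2 / (W s + \<eta>))"
      using x[OF True] W_pos[of s] \<eta> by (intro mult_right_mono) auto
    finally show ?thesis by (intro mult_right_mono ennreal_leI) auto
  qed (simp add: past)
  have p: "ennreal (exp (- \<psi> s / \<epsilon>) / \<epsilon> * \<psi>' s) * E s \<le> ennreal ((1 + \<eta>) * (W s / \<epsilon>)) * E s" for s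
  proof (cases "s > 0")
    case True
    define y where "y = \<eta> * (1 / W s - 1)"
    have y: "0 \<le> y" using x[OF True] by (simp add: y_def)
    have "\<psi>' s = 1 + y + \<eta>" unfolding \<psi>'_W y_def by (simp add: algebra_simps)
    then have "exp (- \<psi> s / \<epsilon>) / \<epsilon> * \<psi>' s = (exp (- y) * (1 + y) + exp (- y) * \<eta>) * (W s / \<epsilon>)"
      unfolding \<psi>_W y_def[symmetric] by (simp add: algebra_simps add_divide_distrib)
    also have "\<dots> \<le> (1 + 1 * \<eta>) * (W s / \<epsilon>)"
      using y exp_minus_bound[OF y] \<eta> \<epsilon> W_pos[of s] by (intro mult_right_mono add_mono) auto
    finally show ?thesis by (intro mult_right_mono ennreal_leI) auto
  qed (simp add: past)
  have "(A1 + B) + r = A + B" unfolding A_split by (simp add: ac_simps)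
  also have "\<dots> \<le> (\<integral>\<^sup>+s. ennreal (exp (- \<psi> s / \<epsilon>) / \<psi>' s) * D s \<partial>lborel)
    + (\<integral>\<^sup>+s. ennreal (exp (- \<psi> s / \<epsilon>) / \<epsilon> * \<psi>' s) * E s \<partial>lborel)"
    by (rule minimal_le[OF tc])
  also have "\<dots> \<le> A1 + (\<integral>\<^sup>+s. ennreal ((1 + \<eta>) * (W s / \<epsilon>)) * E s \<partial>lborel)"
    unfolding A1_def by (intro add_mono nn_integral_mono q p)
  also have "(\<integral>\<^sup>+s. ennreal ((1 + \<eta>) * (W s / \<epsilon>)) * E s \<partial>lborel) = ennreal (1 + \<eta>) * B"
    unfolding B_def using \<eta> by (simp only: ennreal_mult' mult.assoc add_nonneg_nonneg less_imp_le zero_le_one)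
      (rule nn_integral_cmult, measurable)
  also have "A1 + ennreal (1 + \<eta>) * B = (A1 + B) + ennreal \<eta> * B"
    using \<eta> by (simp add: distrib_right add.assoc)
  finally have "A1 + B = \<infinity> \<or> r \<le> ennreal \<eta> * B" by (simp add: ennreal_add_left_cancel_le)
  moreover have "A1 + B \<noteq> \<infinity>"
  proof -
    have "A1 \<le> ennreal c" using A_le unfolding A_split by (metis add_increasing2 order_trans order_refl zero_le)
    then show ?thesis using B_le by (auto simp: top_unique)
  qed
  ultimately have "r \<le> ennreal \<eta> * ennreal c" using mult_left_mono[OF B_le] by (meson order_trans zero_le)
  moreover have "r = ennreal \<eta> * (\<integral>\<^sup>+s. ennreal (W s / (W s + \<eta>)) * D s \<partial>lborel)"
    unfolding r_def using \<eta> by (simp only: ennreal_mult' mult.assoc less_imp_le) (rule nn_integral_cmult, measurable)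
  ultimately show ?thesis
    using \<eta> by (simp add: ennreal_mult_le_mult_iff)
qed

text \<open>The weights \<open>W / (W + \<eta>)\<close> tend to one as \<open>\<eta>\<close> tends to zero; Fatou's lemma concludes.\<close>

theorem dissipation_bound: "(\<integral>\<^sup>+s. D s \<partial>lborel) \<le> ennreal c"
proof -
  define \<eta> where "\<eta> n = 1 / real (Suc n)" for n
  have "(\<integral>\<^sup>+s. D s \<partial>lborel) = (\<integral>\<^sup>+s. liminf (\<lambda>n. ennreal (W s / (W s + \<eta> n)) * D s) \<partial>lborel)"
  proof (rule nn_integral_cong)
    fix s
    have "\<eta> \<longlonglongrightarrow> 0" unfolding \<eta>_def[abs_def] by (rule LIMSEQ_Suc[OF lim_1_over_n])
    then have "(\<lambda>n. W s / (W s + \<eta> n)) \<longlonglongrightarrow> W s / (W s + 0)"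
      using W_pos[of s] by (intro tendsto_intros) auto
    then have "(\<lambda>n. ennreal (W s / (W s + \<eta> n))) \<longlonglongrightarrow> 1"
      using W_pos[of s] by (subst ennreal_1[symmetric], intro tendsto_ennrealI) simp
    then have "(\<lambda>n. ennreal (W s / (W s + \<eta> n)) * D s) \<longlonglongrightarrow> 1 * D s"
      by (intro tendsto_mult_ennreal tendsto_const) auto
    then show "D s = liminf (\<lambda>n. ennreal (W s / (W s + \<eta> n)) * D s)"
      using lim_imp_Liminf[of sequentially] by force
  qed
  also have "\<dots> \<le> liminf (\<lambda>n. \<integral>\<^sup>+s. ennreal (W s / (W s + \<eta> n)) * D s \<partial>lborel)"
    by (rule nn_integral_liminf) measurable
  also have "\<dots> \<le> liminf (\<lambda>n. ennreal c)"
    by (intro Liminf_mono always_eventually allI dissipation_weighted) (simp add: \<eta>_def)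
  finally show ?thesis by (simp add: Liminf_const)
qed

text \<open>This is the variation with \<open>\<kappa> = 1/R\<close> and \<open>\<delta> = \<epsilon> e\<^bsup>-R/\<epsilon>\<^esup>\<close>. Up to the factor \<open>1 + \<eta>\<close> with \<open>\<eta> = \<delta>/\<epsilon>\<close> the
  coefficient of \<open>E\<close> decreases by \<open>g\<close>, so \<open>\<integral> g E\<close> is at most \<open>\<eta> c\<close>. On \<open>(0, R)\<close> both \<open>x\<close> and \<open>\<kappa> s\<close> are at
  most one, which makes \<open>g\<close> at least \<open>\<eta> (1 - W) / (R e\<^sup>2)\<close>. The part \<open>W\<close> that is missing from \<open>1\<close> is
  controlled by the functional itself, and \<open>\<epsilon> \<le> R\<close>.\<close>

theorem energy_bound:
  assumes R: "\<epsilon> \<le> R"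
  shows "(\<integral>\<^sup>+s\<in>{0<..<R}. E s \<partial>lborel) \<le> ennreal ((exp 2 + 1) * c * R)"
proof -
  have Rp: "0 < R" using R \<epsilon> by simp
  define \<kappa> where "\<kappa> = 1 / R"
  define \<nu> where "\<nu> = \<epsilon> / R"
  define \<eta> where "\<eta> = exp (- R / \<epsilon>)"
  have \<eta>: "0 < \<eta>" by (simp add: \<eta>_def)
  have \<nu>: "0 < \<nu>" "\<nu> \<le> 1" using R Rp \<epsilon> by (simp_all add: \<nu>_def)
  have \<kappa>: "0 \<le> \<kappa>" "\<kappa> \<le> 1 / \<epsilon>" using R Rp \<epsilon> by (simp_all add: \<kappa>_def frac_le)
  define x where "x s = \<eta> * (exp ((1 / \<epsilon> - \<kappa>) * s) - exp ((- \<kappa>) * s))" for s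
  define \<psi> where "\<psi> s = s + \<epsilon> * \<eta> * (exp ((1 / \<epsilon> - \<kappa>) * s) - exp ((- \<kappa>) * s))" for s
  define \<psi>' where "\<psi>' s = 1 + \<epsilon> * \<eta> * ((1 / \<epsilon> - \<kappa>) * exp ((1 / \<epsilon> - \<kappa>) * s) + \<kappa> * exp ((- \<kappa>) * s))" for s
  have tc: "time_change \<psi> \<psi>'"
    unfolding \<psi>_def[abs_def] \<psi>'_def[abs_def] by (rule time_change_exp) (use \<eta> \<epsilon> \<kappa> in auto)
  have ge1: "1 \<le> \<psi>' s" for s using tc by (rule time_change.ge1)
  have x_pos: "0 \<le> x s" if "s > 0" for s
  proof -
    have "(- \<kappa>) * s \<le> (1 / \<epsilon> - \<kappa>) * s" using that \<epsilon> by (intro mult_right_mono) auto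
    then show ?thesis unfolding x_def using \<eta> by simp
  qed
  have \<psi>_W: "exp (- \<psi> s / \<epsilon>) = W s * exp (- x s)" for s
    unfolding \<psi>_def x_def W_def using \<epsilon> by (simp add: exp_add[symmetric] field_simps)
  have \<psi>'_x: "\<psi>' s = 1 + (1 - \<nu>) * x s + \<eta> * exp ((- \<kappa>) * s)" for s
  proof -
    have "\<epsilon> * (1 / \<epsilon> - \<kappa>) = 1 - \<nu>" "\<epsilon> * \<kappa> = \<nu>" using \<epsilon> by (simp_all add: \<kappa>_def \<nu>_def right_diff_distrib)
    moreover have "\<epsilon> * \<eta> * (u * v + w * z) = \<eta> * ((\<epsilon> * u) * v + (\<epsilon> * w) * z)" for u v w z
      by (simp add: algebra_simps)
    ultimately have "\<psi>' s = 1 + \<eta> * ((1 - \<nu>) * exp ((1 / \<epsilon> - \<kappa>) * s) + \<nu> * exp ((- \<kappa>) * s))"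
      unfolding \<psi>'_def by (simp only:)
    then show ?thesis unfolding x_def by (simp add: algebra_simps)
  qed
  define g where "g s = W s / \<epsilon> * (\<nu> * x s * exp (- x s))" for s
  have [measurable]: "x \<in> borel_measurable borel" "g \<in> borel_measurable borel"
    unfolding g_def[abs_def] x_def[abs_def] by measurable
  have [measurable]: "\<psi> \<in> borel_measurable borel" "\<psi>' \<in> borel_measurable borel"
    unfolding \<psi>_def[abs_def] \<psi>'_def[abs_def] by measurable
  have q: "ennreal (exp (- \<psi> s / \<epsilon>) / \<psi>' s) * D s \<le> ennreal (W s) * D s" for s
  proof (cases "s > 0")
    case True
    have "W s * exp (- x s) \<le> W s * 1" using x_pos[OF True] W_pos[of s] by (intro mult_left_mono) auto
    then have "exp (- \<psi> s / \<epsilon>) / \<psi>' s \<le> W s / 1"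
      unfolding \<psi>_W using ge1[of s] W_pos[of s] by (intro frac_le) auto
    then show ?thesis by (intro mult_right_mono ennreal_leI) auto
  qed (simp add: past)
  have p: "ennreal (exp (- \<psi> s / \<epsilon>) / \<epsilon> * \<psi>' s) * E s + ennreal (g s) * E s \<le> ennreal ((1 + \<eta>) * (W s / \<epsilon>)) * E s" for s
  proof (cases "s > 0")
    case True
    define e where "e = exp ((- \<kappa>) * s)"
    have "0 \<le> \<kappa> * s" using \<kappa>(1) True by simp
    then have e: "e \<le> 1" "0 < e" by (simp_all add: e_def)
    have "exp (- \<psi> s / \<epsilon>) / \<epsilon> * \<psi>' s + g s = (exp (- x s) * (1 + x s) + exp (- x s) * (\<eta> * e)) * (W s / \<epsilon>)"
      unfolding \<psi>_W \<psi>'_x g_def e_def[symmetric] by (simp add: algebra_simps add_divide_distrib diff_divide_distrib)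
    also have "\<dots> \<le> (1 + 1 * (\<eta> * 1)) * (W s / \<epsilon>)"
      using x_pos[OF True] exp_minus_bound[OF x_pos[OF True]] \<eta> \<epsilon> W_pos[of s] e
      by (intro mult_right_mono add_mono mult_mono) auto
    finally have le: "exp (- \<psi> s / \<epsilon>) / \<epsilon> * \<psi>' s + g s \<le> (1 + \<eta>) * (W s / \<epsilon>)" by simp
    have "0 \<le> exp (- \<psi> s / \<epsilon>) / \<epsilon> * \<psi>' s" "0 \<le> g s"
      using \<epsilon> ge1[of s] x_pos[OF True] W_pos[of s] \<nu> unfolding g_def by auto
    then have "ennreal (exp (- \<psi> s / \<epsilon>) / \<epsilon> * \<psi>' s) + ennreal (g s) \<le> ennreal ((1 + \<eta>) * (W s / \<epsilon>))"
      using ennreal_leI[OF le] by (simp only: ennreal_plus)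
    then show ?thesis unfolding distrib_right[symmetric] by (rule mult_right_mono) simp
  qed (simp add: past)
  have "(A + B) + (\<integral>\<^sup>+s. ennreal (g s) * E s \<partial>lborel)
    \<le> (\<integral>\<^sup>+s. ennreal (exp (- \<psi> s / \<epsilon>) / \<psi>' s) * D s \<partial>lborel)
    + (\<integral>\<^sup>+s. ennreal (exp (- \<psi> s / \<epsilon>) / \<epsilon> * \<psi>' s) * E s \<partial>lborel) + (\<integral>\<^sup>+s. ennreal (g s) * E s \<partial>lborel)"
    by (rule add_right_mono[OF minimal_le[OF tc]])
  also have "\<dots> = (\<integral>\<^sup>+s. ennreal (exp (- \<psi> s / \<epsilon>) / \<psi>' s) * D s \<partial>lborel)
    + (\<integral>\<^sup>+s. ennreal (exp (- \<psi> s / \<epsilon>) / \<epsilon> * \<psi>' s) * E s + ennreal (g s) * E s \<partial>lborel)"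
    by (simp add: nn_integral_add add.assoc)
  also have "\<dots> \<le> A + (\<integral>\<^sup>+s. ennreal ((1 + \<eta>) * (W s / \<epsilon>)) * E s \<partial>lborel)"
    unfolding A_def by (intro add_mono nn_integral_mono q p)
  also have "(\<integral>\<^sup>+s. ennreal ((1 + \<eta>) * (W s / \<epsilon>)) * E s \<partial>lborel) = ennreal (1 + \<eta>) * B"
    unfolding B_def using \<eta> by (simp only: ennreal_mult' mult.assoc add_nonneg_nonneg less_imp_le zero_le_one)
      (rule nn_integral_cmult, measurable)
  also have "A + ennreal (1 + \<eta>) * B = (A + B) + ennreal \<eta> * B"
    using \<eta> by (simp add: distrib_right add.assoc)
  finally have "A + B = \<infinity> \<or> (\<integral>\<^sup>+s. ennreal (g s) * E s \<partial>lborel) \<le> ennreal \<eta> * B"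
    by (simp add: ennreal_add_left_cancel_le)
  moreover have "A + B \<noteq> \<infinity>" using A_le B_le by (auto simp: top_unique)
  ultimately have gE: "(\<integral>\<^sup>+s. ennreal (g s) * E s \<partial>lborel) \<le> ennreal \<eta> * ennreal c"
    using mult_left_mono[OF B_le] by (meson order_trans zero_le)
  define K where "K = R * exp 2 / \<eta>"
  have K: "0 \<le> K" using Rp \<eta> by (simp add: K_def)
  \<comment> \<open>The two factors \<open>e\<^sup>-\<^sup>1\<close> from \<open>x \<le> 1\<close> and \<open>\<kappa> s \<le> 1\<close> account for \<open>exp 2\<close> in \<open>K\<close>.\<close>
  have late: "1 - W s \<le> K * g s" if s: "s \<in> {0<..<R}" for s
  proof -
    have s0: "s > 0" using s by simp
    have Wx: "W s * x s = \<eta> * exp ((- \<kappa>) * s) * (1 - W s)"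
    proof -
      have "W s * exp ((1 / \<epsilon> - \<kappa>) * s) = exp ((- \<kappa>) * s)"
        unfolding W_def exp_add[symmetric] using \<epsilon> by (simp add: field_simps)
      then show ?thesis unfolding x_def by (simp add: algebra_simps)
    qed
    have "x s \<le> \<eta> * exp ((1 / \<epsilon> - \<kappa>) * s)" unfolding x_def using \<eta> by simp
    also have "\<dots> \<le> \<eta> * exp (R / \<epsilon>)"
    proof -
      have "(1 / \<epsilon> - \<kappa>) * s \<le> 1 / \<epsilon> * R" using s \<kappa> \<epsilon> by (intro mult_mono) auto
      then show ?thesis using \<eta> by simp
    qed
    also have "\<dots> = 1" by (simp add: \<eta>_def exp_minus)
    finally have "exp (- x s) \<ge> exp (- 1)" by simp
    moreover have "exp ((- \<kappa>) * s) \<ge> exp (- 1)"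
      using s Rp by (simp add: \<kappa>_def)
    moreover have W1: "0 \<le> 1 - W s" unfolding W_def using s0 \<epsilon> by simp
    ultimately have "exp (- 1) * exp (- 1) * (1 - W s) \<le> exp (- x s) * exp ((- \<kappa>) * s) * (1 - W s)"
      by (intro mult_right_mono mult_mono) auto
    then have "exp 2 * (exp (- 1) * exp (- 1) * (1 - W s)) \<le> exp 2 * (exp (- x s) * exp ((- \<kappa>) * s) * (1 - W s))"
      by (rule mult_left_mono) simp
    moreover have "exp 2 * (exp (- 1) * exp (- 1) * (1 - W s)) = 1 - W s"
      by (simp add: exp_add[symmetric] mult.assoc[symmetric])
    moreover have "K * g s = exp 2 * (exp (- x s) * exp ((- \<kappa>) * s) * (1 - W s))"
    proof -
      have "K * g s = exp 2 / \<eta> * exp (- x s) * (W s * x s)"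
        unfolding K_def g_def \<nu>_def using Rp \<epsilon> by (simp add: field_simps)
      also have "\<dots> = exp 2 * (exp (- x s) * exp ((- \<kappa>) * s) * (1 - W s))"
        unfolding Wx using \<eta> by simp
      finally show ?thesis .
    qed
    ultimately show ?thesis by simp
  qed
  have "(\<integral>\<^sup>+s\<in>{0<..<R}. E s \<partial>lborel)
    \<le> (\<integral>\<^sup>+s. ennreal K * (ennreal (g s) * E s) + ennreal \<epsilon> * (ennreal (W s / \<epsilon>) * E s) \<partial>lborel)"
  proof (rule nn_integral_mono)
    fix s
    show "E s * indicator {0<..<R} s \<le> ennreal K * (ennreal (g s) * E s) + ennreal \<epsilon> * (ennreal (W s / \<epsilon>) * E s)"
    proof (cases "s \<in> {0<..<R}")
      case True
      have "1 \<le> K * g s + \<epsilon> * (W s / \<epsilon>)" using late[OF True] \<epsilon> by simp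
      then have "ennreal 1 \<le> ennreal (K * g s + \<epsilon> * (W s / \<epsilon>))" by (rule ennreal_leI)
      also have "\<dots> = ennreal K * ennreal (g s) + ennreal \<epsilon> * ennreal (W s / \<epsilon>)"
        using K \<epsilon> W_pos[of s] x_pos[of s] \<nu> True
        by (subst ennreal_plus) (auto simp: g_def ennreal_mult'[symmetric])
      finally have "1 * E s \<le> (ennreal K * ennreal (g s) + ennreal \<epsilon> * ennreal (W s / \<epsilon>)) * E s"
        by (intro mult_right_mono) auto
      then show ?thesis using True by (simp add: distrib_right mult.assoc)
    qed simp
  qed
  also have "\<dots> = ennreal K * (\<integral>\<^sup>+s. ennreal (g s) * E s \<partial>lborel) + ennreal \<epsilon> * B"
    unfolding B_def by (simp add: nn_integral_add nn_integral_cmult)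
  also have "\<dots> \<le> ennreal K * (ennreal \<eta> * ennreal c) + ennreal \<epsilon> * ennreal c"
    by (intro add_mono mult_left_mono gE B_le) auto
  also have "\<dots> = ennreal (K * \<eta> * c + \<epsilon> * c)"
    using K \<eta> \<epsilon> c by (simp add: ennreal_mult mult.assoc)
  also have "\<dots> \<le> ennreal ((exp 2 + 1) * c * R)"
  proof (rule ennreal_leI)
    have "\<epsilon> * c \<le> R * c" using R c by (rule mult_right_mono)
    then show "K * \<eta> * c + \<epsilon> * c \<le> (exp 2 + 1) * c * R"
      using \<eta> by (simp add: K_def algebra_simps)
  qed
  finally show ?thesis .
qed

end

section \<open>The stationary competitor\<close>

lemma nn_integral_const_time:
  fixes F :: "'e::euclidean_space \<Rightarrow> ennreal"
  assumes F: "F \<in> borel_measurable borel" and A: "A \<in> sets borel" and r: "0 \<le> r"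
  shows "(\<integral>\<^sup>+z\<in>A \<times> {0<..<r}. F (fst z) \<partial>lborel) = ennreal r * (\<integral>\<^sup>+x\<in>A. F x \<partial>lborel)"
proof -
  have "(fst :: 'e \<times> real \<Rightarrow> 'e) \<in> borel_measurable borel"
    by (intro borel_measurable_continuous_onI continuous_intros)
  from measurable_compose[OF this F]
  have "(\<lambda>z::'e \<times> real. F (fst z) * indicator (A \<times> {0<..<r}) z) \<in> borel_measurable borel"
    by (rule borel_measurable_times_ennreal) (intro borel_measurable_indicator, auto simp: borel_Times A)
  then have m: "(\<lambda>z::'e \<times> real. F (fst z) * indicator (A \<times> {0<..<r}) z) \<in> borel_measurable lborel" by simp
  have m1: "(\<lambda>x. F x * indicator A x) \<in> borel_measurable lborel"
    using F A by simp
  have "(\<integral>\<^sup>+z\<in>A \<times> {0<..<r}. F (fst z) \<partial>lborel)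
    = (\<integral>\<^sup>+t. \<integral>\<^sup>+x. F x * indicator (A \<times> {0<..<r}) (x, t) \<partial>lborel \<partial>lborel)"
    using nn_integral_lborel_snd(1)[OF m] by simp
  also have "\<dots> = (\<integral>\<^sup>+t. (\<integral>\<^sup>+x\<in>A. F x \<partial>lborel) * indicator {0<..<r} t \<partial>lborel)"
  proof (rule nn_integral_cong)
    fix t
    have "(\<integral>\<^sup>+x. F x * indicator (A \<times> {0<..<r}) (x, t) \<partial>lborel)
      = (\<integral>\<^sup>+x. (F x * indicator A x) * indicator {0<..<r} t \<partial>lborel)"
      by (rule nn_integral_cong) (simp add: indicator_def)
    also have "\<dots> = (\<integral>\<^sup>+x\<in>A. F x \<partial>lborel) * indicator {0<..<r} t"
      by (rule nn_integral_multc[OF m1])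
    finally show "(\<integral>\<^sup>+x. F x * indicator (A \<times> {0<..<r}) (x, t) \<partial>lborel) = (\<integral>\<^sup>+x\<in>A. F x \<partial>lborel) * indicator {0<..<r} t" .
  qed
  also have "\<dots> = (\<integral>\<^sup>+x\<in>A. F x \<partial>lborel) * ennreal r"
    using r by (subst nn_integral_cmult) auto
  finally show ?thesis by (simp add: mult.commute)
qed

lemma locally_integrable_const_time:
  fixes H :: "'e::euclidean_space \<Rightarrow> 'b::euclidean_space"
  assumes H: "locally_integrable UNIV H"
  shows "locally_integrable \<Omega> (\<lambda>z::'e \<times> real. H (fst z))"
  unfolding locally_integrable_def set_integrable_def
proof (intro allI impI)
  fix K :: "('e \<times> real) set" assume K: "compact K \<and> K \<subseteq> \<Omega>"
  have "compact (fst ` K)" "compact (snd ` K)"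
    using K by (auto intro!: compact_continuous_image continuous_intros)
  obtain r where r: "r > 0" "\<And>t. t \<in> snd ` K \<Longrightarrow> norm t < r"
    using compact_imp_bounded[OF \<open>compact (snd ` K)\<close>] unfolding bounded_pos_less by blast
  define h where "h x = indicat_real (fst ` K) x *\<^sub>R H x" for x
  have h: "integrable lborel h"
    using H \<open>compact (fst ` K)\<close> unfolding locally_integrable_def set_integrable_def h_def[abs_def] by blast
  define g where "g = (\<lambda>z::'e \<times> real. h (fst z))"
  have "(fst :: 'e \<times> real \<Rightarrow> 'e) \<in> borel_measurable borel"
    by (intro borel_measurable_continuous_onI continuous_intros)
  moreover have "h \<in> borel_measurable borel" using borel_measurable_integrable[OF h] by simp
  ultimately have gm: "g \<in> borel_measurable borel"
    unfolding g_def by (rule measurable_compose)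
  have Km: "K \<in> sets borel" using K borel_compact by blast
  have m: "(\<lambda>z. indicat_real K z *\<^sub>R g z) \<in> borel_measurable lborel"
    using gm Km by simp
  have "integrable lborel (\<lambda>z. indicat_real K z *\<^sub>R g z)"
  proof (rule integrableI_bounded[OF m])
    have "(\<integral>\<^sup>+z. ennreal (norm (indicat_real K z *\<^sub>R g z)) \<partial>lborel)
      \<le> (\<integral>\<^sup>+z. ennreal (norm (h (fst z))) * indicator {-r<..<r} (snd z) \<partial>lborel)"
    proof (rule nn_integral_mono)
      fix z
      show "ennreal (norm (indicat_real K z *\<^sub>R g z)) \<le> ennreal (norm (h (fst z))) * indicator {-r<..<r} (snd z)"
      proof (cases "z \<in> K")
        case True
        then have "norm (snd z) < r" using r(2) by blast
        then have "snd z \<in> {-r<..<r}" by auto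
        then show ?thesis using True by (simp add: g_def)
      qed simp
    qed
    also have "\<dots> = (\<integral>\<^sup>+x. ennreal (norm (h x)) \<partial>lborel) * ennreal (2 * r)"
    proof -
      have nh: "(\<lambda>x. ennreal (norm (h x))) \<in> borel_measurable borel"
        using borel_measurable_integrable[OF h] by simp
      have "(\<lambda>z::'e \<times> real. ennreal (norm (h (fst z))) * indicator {-r<..<r} (snd z)) \<in> borel_measurable (lborel \<Otimes>\<^sub>M lborel)"
        using nh by measurable
      from lborel.nn_integral_fst[OF this]
      have "(\<integral>\<^sup>+z. ennreal (norm (h (fst z))) * indicator {-r<..<r} (snd z) \<partial>lborel)
        = (\<integral>\<^sup>+x. \<integral>\<^sup>+t. ennreal (norm (h x)) * indicator {-r<..<r} t \<partial>lborel \<partial>lborel)"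
        by (simp add: lborel_prod)
      also have "\<dots> = (\<integral>\<^sup>+x. ennreal (norm (h x)) * ennreal (2 * r) \<partial>lborel)"
        using r(1) by (intro nn_integral_cong) (subst nn_integral_cmult, auto)
      also have "\<dots> = (\<integral>\<^sup>+x. ennreal (norm (h x)) \<partial>lborel) * ennreal (2 * r)"
        using nh by (intro nn_integral_multc) simp
      finally show ?thesis .
    qed
    also have "\<dots> < \<infinity>"
      using h by (simp add: integrable_iff_bounded ennreal_mult_less_top)
    finally show "(\<integral>\<^sup>+z. ennreal (norm (indicat_real K z *\<^sub>R g z)) \<partial>lborel) < \<infinity>" .
  qed
  moreover have "(\<lambda>z. indicat_real K z *\<^sub>R g z) = (\<lambda>z. indicat_real K z *\<^sub>R H (fst z))"
    by (rule ext) (auto simp: g_def h_def indicator_def)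
  ultimately show "integrable lborel (\<lambda>z. indicat_real K z *\<^sub>R H (fst z))" by simp
qed

lemma test_fun_frechet:
  assumes "test_fun \<Omega> f"
  shows "test_fun \<Omega> (\<lambda>z. frechet_derivative f (at z) v)"
proof -
  obtain K where "compact K" "K \<subseteq> \<Omega>" "\<And>z v. z \<notin> K \<Longrightarrow> frechet_derivative f (at z) v = 0"
    using test_fun_zero_outside[OF assms] by metis
  then show ?thesis
    unfolding test_fun_def using smooth_fun_frechet[OF test_fun_smooth[OF assms]] by blast
qed

lemma integral_deriv_compact_support:
  fixes g g' :: "real \<Rightarrow> real"
  assumes g: "\<And>t. (g has_real_derivative g' t) (at t)" and cont: "continuous_on UNIV g'"
    and zero: "\<And>t. t \<notin> K \<Longrightarrow> g t = 0" "\<And>t. t \<notin> K \<Longrightarrow> g' t = 0" and K: "compact K"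
  shows "(LINT t|lborel. g' t) = 0"
proof -
  obtain r where r: "r > 0" "\<And>t. t \<in> K \<Longrightarrow> norm t < r"
    using compact_imp_bounded[OF K] unfolding bounded_pos_less by blast
  have out: "t \<notin> K" if "\<bar>t\<bar> \<ge> r" for t using r(2)[of t] that by auto
  have "has_bochner_integral lborel (\<lambda>t. indicator {-r..r} t *\<^sub>R g' t) (g r - g (-r))"
    using r(1) cont g by (intro has_bochner_integral_FTC_Icc)
      (auto simp: has_real_derivative_iff_has_vector_derivative[symmetric]
        intro: has_field_derivative_at_within continuous_on_subset)
  moreover have "(\<lambda>t. indicator {-r..r} t *\<^sub>R g' t) = g'"
  proof
    show "indicator {-r..r} t *\<^sub>R g' t = g' t" for t
      using zero(2)[of t] out[of t] by (cases "t \<in> {-r..r}") auto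
  qed
  moreover have "g r = 0" "g (-r) = 0" using zero(1) out r(1) by auto
  ultimately show ?thesis by (simp add: has_bochner_integral_iff)
qed

text \<open>In a space direction the defining identity of \<open>G\<close> holds on every time slice. In the time direction
  both sides vanish, because a time derivative of a test function has integral zero along every
  line parallel to the time axis.\<close>

lemma is_weak_grad_const_time:
  fixes U0 :: "'n::finite space \<Rightarrow> real"
  assumes W: "is_weak_grad UNIV U0 G"
  shows "is_weak_grad later (\<lambda>z::'n spacetime. U0 (fst z)) (\<lambda>z. (G (fst z), 0))"
  unfolding is_weak_grad_def
proof (intro conjI allI impI ballI)
  let ?L = "later :: 'n spacetime set"
  note loc = is_weak_grad_locally_integrable[OF W]
  show Uloc: "locally_integrable ?L (\<lambda>z. U0 (fst z))" by (rule locally_integrable_const_time[OF loc(1)])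
  have Gloc: "locally_integrable ?L (\<lambda>z. G (fst z))" by (rule locally_integrable_const_time[OF loc(2)])
  have pair: "(\<lambda>v::'n space. (v, 0::real)) \<in> borel_measurable borel"
    by (intro borel_measurable_continuous_onI continuous_intros)
  show G0loc: "locally_integrable ?L (\<lambda>z. (G (fst z), 0::real))"
  proof (rule locally_integrable_bound[OF Gloc])
    have "(\<lambda>z. (indicat_real ?L z *\<^sub>R G (fst z), 0::real)) \<in> borel_measurable lborel"
      by (rule measurable_compose[OF locally_integrable_measurable[OF Gloc open_later] pair])
    also have "(\<lambda>z. (indicat_real ?L z *\<^sub>R G (fst z), 0::real)) = (\<lambda>z. indicat_real ?L z *\<^sub>R (G (fst z), 0::real))"
      by simp
    finally show "(\<lambda>z. indicat_real ?L z *\<^sub>R (G (fst z), 0::real)) \<in> borel_measurable lborel" .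
  qed (simp add: norm_prod_def)
  fix f and b :: "'n spacetime" assume f: "test_fun ?L f" and b: "b \<in> Basis"
  note sf = test_fun_smooth[OF f]
  obtain K where K: "compact K" "K \<subseteq> ?L" "\<And>z. z \<notin> K \<Longrightarrow> f z = 0"
    "\<And>z v. z \<notin> K \<Longrightarrow> frechet_derivative f (at z) v = 0"
    using test_fun_zero_outside[OF f] by metis
  note lhs = test_fun_mult_integrable[OF Uloc test_fun_frechet[OF f, of b]]
  note rhs = test_fun_mult_integrable[OF locally_integrable_inner[OF G0loc, of b] f]
  have lhs_int: "integrable (lborel \<Otimes>\<^sub>M lborel) (\<lambda>z. U0 (fst z) * frechet_derivative f (at z) b)"
    using lhs(1) by (simp add: lborel_prod)
  have rhs_int: "integrable (lborel \<Otimes>\<^sub>M lborel) (\<lambda>z. ((G (fst z), 0) \<bullet> b) * f z)"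
    using rhs(1) by (simp add: lborel_prod)
  consider b1 where "b = (b1, 0)" "b1 \<in> Basis" | "b = (0, 1)"
    using b by (auto simp: Basis_prod_def)
  then show "(LINT z:?L|lborel. U0 (fst z) * frechet_derivative f (at z) b)
    = - (LINT z:?L|lborel. ((G (fst z), 0) \<bullet> b) * f z)"
  proof cases
    case 1
    have slice: "(LINT X|lborel. U0 X * frechet_derivative f (at (X, t)) b)
      = - (LINT X|lborel. ((G X, 0) \<bullet> b) * f (X, t))" for t
    proof -
      have tf: "test_fun UNIV (\<lambda>X. f (X, t))"
        unfolding test_fun_def
      proof (intro conjI exI[of _ "fst ` K"] allI impI)
        show "compact (fst ` K)" using K(1) by (intro compact_continuous_image continuous_intros)
        show "f (X, t) = 0" if "X \<notin> fst ` K" for X using that K(3)[of "(X, t)"] by force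
      qed (auto simp: smooth_fun_time_slice(1)[OF sf])
      have "frechet_derivative f (at (X, t)) b = frechet_derivative (\<lambda>X. f (X, t)) (at X) b1" for X
        unfolding frechet_derivative_eq_grad[OF sf] frechet_derivative_eq_grad[OF smooth_fun_time_slice(1)[OF sf]]
          smooth_fun_time_slice(2)[OF sf] 1 by (simp add: inner_prod_def)
      moreover have "(G X, 0) \<bullet> b = G X \<bullet> b1" for X unfolding 1 by simp
      ultimately show ?thesis
        using is_weak_grad_identity[OF W tf 1(2)] by (simp add: set_lebesgue_integral_def)
    qed
    have "(LINT z|lborel. U0 (fst z) * frechet_derivative f (at z) b)
      = (LINT t|lborel. LINT X|lborel. U0 X * frechet_derivative f (at (X, t)) b)"
      using lborel_pair.integral_snd[of "\<lambda>X t. U0 X * frechet_derivative f (at (X, t)) b"] lhs_int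
      by (simp add: lborel_prod case_prod_unfold)
    also have "\<dots> = - (LINT t|lborel. LINT X|lborel. ((G X, 0) \<bullet> b) * f (X, t))"
      unfolding slice by simp
    also have "(LINT t|lborel. LINT X|lborel. ((G X, 0) \<bullet> b) * f (X, t))
      = (LINT z|lborel. ((G (fst z), 0) \<bullet> b) * f z)"
      using lborel_pair.integral_snd[of "\<lambda>X t. ((G X, 0) \<bullet> b) * f (X, t)"] rhs_int
      by (simp add: lborel_prod case_prod_unfold)
    finally show ?thesis unfolding lhs(2) rhs(2) .
  next
    case 2
    have time: "(LINT t|lborel. frechet_derivative f (at (X, t)) b) = 0" for X
    proof (rule integral_deriv_compact_support[where K="snd ` K"])
      show "((\<lambda>t. f (X, t)) has_real_derivative frechet_derivative f (at (X, t)) b) (at t)" for t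
      proof -
        have "((\<lambda>t. (X, t)) has_derivative (\<lambda>v. (0, v))) (at t)"
          by (intro derivative_eq_intros) auto
        from diff_chain_at[OF this has_derivative_classical_grad[OF sf]]
        have "((\<lambda>t. f (X, t)) has_derivative (\<lambda>v. classical_grad f (X, t) \<bullet> (0, v))) (at t)"
          by (simp add: o_def)
        moreover have "(\<lambda>v. classical_grad f (X, t) \<bullet> (0, v)) = (*) (classical_grad f (X, t) \<bullet> (0, 1))"
          by (simp add: inner_prod_def fun_eq_iff)
        ultimately show ?thesis
          unfolding frechet_derivative_eq_grad[OF sf] 2 by (simp add: has_field_derivative_def)
      qed
      show "continuous_on UNIV (\<lambda>t. frechet_derivative f (at (X, t)) b)"
        by (rule continuous_on_compose2[OF smooth_fun_continuous[OF smooth_fun_frechet[OF sf], of UNIV]])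
          (auto intro!: continuous_intros)
      show "compact (snd ` K)" using K(1) by (intro compact_continuous_image continuous_intros)
      show "f (X, t) = 0" "frechet_derivative f (at (X, t)) b = 0" if "t \<notin> snd ` K" for t
      proof -
        have "(X, t) \<notin> K" using imageI[of "(X, t)" K snd] that by auto
        then show "f (X, t) = 0" "frechet_derivative f (at (X, t)) b = 0" using K(3,4) by simp_all
      qed
    qed
    have "(LINT z|lborel. U0 (fst z) * frechet_derivative f (at z) b)
      = (LINT X|lborel. LINT t|lborel. U0 X * frechet_derivative f (at (X, t)) b)"
      using lborel_pair.integral_fst'[OF lhs_int] by (simp add: lborel_prod)
    also have "\<dots> = 0" unfolding integral_mult_right_zero time by simp
    moreover have "(G (fst z), 0) \<bullet> b = 0" for z :: "'n spacetime" unfolding 2 by simp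
    ultimately show ?thesis unfolding lhs(2) rhs(2) by simp
  qed
qed

lemma smooth_fun_const_time:
  fixes f :: "'e::euclidean_space \<Rightarrow> real"
  assumes "smooth_fun f"
  shows "smooth_fun (\<lambda>z::'e \<times> real. f (fst z))"
    "classical_grad (\<lambda>z::'e \<times> real. f (fst z)) z = (classical_grad f (fst z), 0)"
proof -
  show "smooth_fun (\<lambda>z::'e \<times> real. f (fst z))"
    by (rule smooth_fun_compose[OF smooth_fun_prod_components(1) assms])
  have "((\<lambda>z::'e \<times> real. fst z) has_derivative fst) (at z)"
    by (intro has_derivative_fst has_derivative_ident)
  from diff_chain_at[OF this has_derivative_classical_grad[OF assms]]
  show "classical_grad (\<lambda>z::'e \<times> real. f (fst z)) z = (classical_grad f (fst z), 0)"
    by (intro classical_gradI) (simp add: o_def inner_prod_def)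
qed

locale stationary =
  fixes a :: real and U0 :: "'n::finite space \<Rightarrow> real" and G
  assumes a: "-1 < a" "a < 1" and U0: "U0 \<in> H1 (wt a) UNIV"
    and G: "is_weak_grad UNIV U0 G" "(\<lambda>X. norm (G X)) \<in> L2w (wt a) UNIV"
begin

lemma U0_measurable: "U0 \<in> borel_measurable borel" and G_measurable: "G \<in> borel_measurable borel"
  using locally_integrable_measurable[OF is_weak_grad_locally_integrable(1)[OF G(1)] open_UNIV]
    locally_integrable_measurable[OF is_weak_grad_locally_integrable(2)[OF G(1)] open_UNIV] by simp_all

lemma L2w_const_time:
  fixes H :: "'n space \<Rightarrow> real"
  assumes H: "H \<in> borel_measurable borel" and L2: "H \<in> L2w (wt a) UNIV"
  shows "(\<lambda>z. H (fst z)) \<in> L2w (wt_time a) (Qplus R)"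
proof -
  have Fm: "(\<lambda>X. ennreal (wt a X * (H X)\<^sup>2)) \<in> borel_measurable borel"
    using wt_measurable[of a] H by measurable
  have "(\<integral>\<^sup>+z\<in>Qplus R. ennreal (wt_time a z * (H (fst z))\<^sup>2) \<partial>lborel)
    = ennreal (R\<^sup>2) * (\<integral>\<^sup>+X\<in>ball 0 R. ennreal (wt a X * (H X)\<^sup>2) \<partial>lborel)"
    unfolding Qplus_def wt_time_def by (rule nn_integral_const_time[OF Fm]) auto
  also have "\<dots> \<le> ennreal (R\<^sup>2) * (\<integral>\<^sup>+X\<in>UNIV. ennreal (wt a X * (H X)\<^sup>2) \<partial>lborel)"
    by (intro mult_left_mono nn_set_integral_set_mono) auto
  also have "\<dots> < \<infinity>" using L2 by (auto simp: L2w_def ennreal_mult_less_top)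
  finally have fin: "(\<integral>\<^sup>+z\<in>Qplus R. ennreal (wt_time a z * (H (fst z))\<^sup>2) \<partial>lborel) < \<infinity>" .
  have "(fst :: 'n spacetime \<Rightarrow> 'n space) \<in> borel_measurable borel"
    by (intro borel_measurable_continuous_onI continuous_intros)
  from measurable_compose[OF this H]
  have m: "(\<lambda>z::'n spacetime. H (fst z)) \<in> borel_measurable lborel" by simp
  have "indicat_real (Qplus R :: 'n spacetime set) \<in> borel_measurable lborel"
    by (intro borel_measurable_indicator) (simp add: open_Qplus)
  from borel_measurable_scaleR[OF this m] fin show ?thesis
    unfolding L2w_def set_borel_measurable_def by blast
qed

lemma H1_tendsto_const_time:
  assumes f: "\<And>k. smooth_fun (f k)" and lim: "H1_tendsto (wt a) UNIV f U0"
  shows "H1_tendsto (wt_time a) (Qplus R) (\<lambda>k z. f k (fst z)) (\<lambda>z. U0 (fst z))"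
proof -
  have le: "H1_dist (wt_time a) (Qplus R) (\<lambda>z. f k (fst z)) (\<lambda>z. U0 (fst z)) (\<lambda>z. (G (fst z), 0))
    \<le> ennreal (R\<^sup>2) * H1_dist (wt a) UNIV (f k) U0 G" for k
  proof -
    have Fm: "(\<lambda>X. ennreal (wt a X * ((f k X - U0 X)\<^sup>2 + (norm (classical_grad (f k) X - G X))\<^sup>2))) \<in> borel_measurable borel"
      using wt_measurable[of a] U0_measurable G_measurable smooth_fun_measurable[OF f[of k]]
        classical_grad_measurable[OF f[of k]] by measurable
    have "H1_dist (wt_time a) (Qplus R) (\<lambda>z. f k (fst z)) (\<lambda>z. U0 (fst z)) (\<lambda>z. (G (fst z), 0))
      = ennreal (R\<^sup>2) * H1_dist (wt a) (ball 0 R) (f k) U0 G"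
      unfolding H1_dist_def Qplus_def smooth_fun_const_time(2)[OF f]
      using nn_integral_const_time[OF Fm, of "ball 0 R" "R\<^sup>2"] by (simp add: wt_time_def norm_prod_def)
    then show ?thesis by (simp add: H1_dist_mono mult_left_mono)
  qed
  have "(\<lambda>k. ennreal (R\<^sup>2) * H1_dist (wt a) UNIV (f k) U0 G) \<longlonglongrightarrow> 0"
    using tendsto_mult_ennreal[OF tendsto_const H1_tendsto_H1_dist[OF lim G(1) open_UNIV], of "ennreal (R\<^sup>2)"] by simp
  from tendsto_0_le_ennreal[OF this le]
  have "(\<lambda>k. H1_dist (wt_time a) (Qplus R) (\<lambda>z. f k (fst z)) (\<lambda>z. U0 (fst z)) (\<lambda>z. (G (fst z), 0))) \<longlonglongrightarrow> 0" .
  then show ?thesis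
    unfolding H1_tendsto_iff
    using is_weak_grad_subset[OF is_weak_grad_const_time[OF G(1)] Qplus_subset_later] by blast
qed

lemma UU_const_time: "(\<lambda>z. U0 (fst z)) \<in> UU a"
  unfolding UU_def
proof (intro INT_I)
  fix R :: real
  obtain f where f: "\<And>k. smooth_fun (f k)" "H1_tendsto (wt a) UNIV f U0"
    using U0 unfolding H1_def by blast
  have UL2: "U0 \<in> L2w (wt a) UNIV" using U0 unfolding H1_def by blast
  have Gm: "(\<lambda>X. norm (G X)) \<in> borel_measurable borel" using G_measurable by measurable
  have gL2: "(\<lambda>z. norm (G (fst z), 0::real)) \<in> L2w (wt_time a) (Qplus R)"
    using L2w_const_time[OF Gm G(2), of R] by (simp add: norm_prod_def)
  show "(\<lambda>z. U0 (fst z)) \<in> H1 (wt_time a) (Qplus R)"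
    unfolding H1_def
  proof (intro CollectI conjI)
    show "\<exists>G. is_weak_grad (Qplus R) (\<lambda>z. U0 (fst z)) G \<and> (\<lambda>z. U0 (fst z)) \<in> L2w (wt_time a) (Qplus R) \<and>
        (\<lambda>z. norm (G z)) \<in> L2w (wt_time a) (Qplus R)"
      using is_weak_grad_subset[OF is_weak_grad_const_time[OF G(1)] Qplus_subset_later]
        L2w_const_time[OF U0_measurable UL2] gL2 by blast
    show "\<exists>f. (\<forall>k. smooth_fun (f k)) \<and> H1_tendsto (wt_time a) (Qplus R) f (\<lambda>z. U0 (fst z))"
      using H1_tendsto_const_time[OF f] smooth_fun_const_time(1)[OF f(1)]
      by (intro exI[of _ "\<lambda>k z. f k (fst z)"] conjI allI)
  qed
qed

lemma has_trace_t0_const_time: "has_trace_t0 a (\<lambda>z. U0 (fst z)) U0"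
  unfolding has_trace_t0_def
proof (intro conjI allI impI)
  show "U0 \<in> borel_measurable lborel" using U0_measurable by simp
  fix R :: real
  obtain f where f: "\<And>k. smooth_fun (f k)" "H1_tendsto (wt a) UNIV f U0"
    using U0 unfolding H1_def by blast
  have "(\<integral>\<^sup>+X\<in>ball 0 R. ennreal (wt a X * (f k (fst (X, 0::real)) - U0 X)\<^sup>2) \<partial>lborel) \<le> H1_dist (wt a) UNIV (f k) U0 G" for k
    unfolding H1_dist_def
    by (rule nn_integral_mono) (auto simp: indicator_def intro!: ennreal_leI mult_left_mono wt_nonneg)
  from tendsto_0_le_ennreal[OF H1_tendsto_H1_dist[OF f(2) G(1) open_UNIV] this]
  show "\<exists>f. (\<forall>k. smooth_fun (f k)) \<and> H1_tendsto (wt_time a) (Qplus R) f (\<lambda>z. U0 (fst z)) \<and>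
      (\<lambda>k. \<integral>\<^sup>+X\<in>ball 0 R. ennreal (wt a X * (f k (X, 0) - U0 X)\<^sup>2) \<partial>lborel) \<longlonglongrightarrow> 0"
    using H1_tendsto_const_time[OF f] smooth_fun_const_time(1)[OF f(1)]
    by (intro exI[of _ "\<lambda>k z. f k (fst z)"] conjI allI)
qed

lemma UU0_const_time: "(\<lambda>z. U0 (fst z)) \<in> UU0 a U0"
  unfolding UU0_def using UU_const_time has_trace_t0_const_time by blast

lemma has_trace_y0_const_time:
  assumes tr: "has_space_trace_y0 a U0 u0"
  shows "has_trace_y0 a (\<lambda>z. U0 (fst z)) (\<lambda>p. u0 (fst p))"
  unfolding has_trace_y0_def
proof (intro conjI allI impI)
  have um: "u0 \<in> borel_measurable borel" using tr unfolding has_space_trace_y0_def by simp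
  have "(fst :: (real ^ 'n) \<times> real \<Rightarrow> real ^ 'n) \<in> borel_measurable borel"
    by (intro borel_measurable_continuous_onI continuous_intros)
  from measurable_compose[OF this um]
  have m: "(\<lambda>p::(real ^ 'n) \<times> real. u0 (fst p)) \<in> borel_measurable lborel" by simp
  have "indicat_real (later :: ((real ^ 'n) \<times> real) set) \<in> borel_measurable lborel"
    by (intro borel_measurable_indicator) (simp add: open_later)
  from borel_measurable_scaleR[OF this m]
  show "set_borel_measurable lborel later (\<lambda>p::(real ^ 'n) \<times> real. u0 (fst p))"
    unfolding set_borel_measurable_def .
  obtain f where f: "\<And>k. smooth_fun (f k)" "H1_tendsto (wt a) UNIV f U0"
    and lim: "(\<lambda>k. \<integral>\<^sup>+x. ennreal ((f k (x, 0) - u0 x)\<^sup>2) \<partial>lborel) \<longlonglongrightarrow> 0"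
    using tr unfolding has_space_trace_y0_def by blast
  fix R :: real
  have le: "(\<integral>\<^sup>+p\<in>ball 0 R \<times> {0<..<R\<^sup>2}. ennreal ((f k (fst ((fst p, 0::real), snd p)) - u0 (fst p))\<^sup>2) \<partial>lborel)
    \<le> ennreal (R\<^sup>2) * (\<integral>\<^sup>+x. ennreal ((f k (x, 0) - u0 x)\<^sup>2) \<partial>lborel)" for k
  proof -
    have "(\<lambda>x. f k (x, 0)) \<in> borel_measurable borel"
      by (intro borel_measurable_continuous_onI
        continuous_on_compose2[OF smooth_fun_continuous[OF f(1), of UNIV]] continuous_intros) auto
    then have "(\<lambda>x. ennreal ((f k (x, 0) - u0 x)\<^sup>2)) \<in> borel_measurable borel" using um by measurable
    from nn_integral_const_time[OF this, of "ball 0 R" "R\<^sup>2"]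
    have "(\<integral>\<^sup>+p\<in>ball 0 R \<times> {0<..<R\<^sup>2}. ennreal ((f k (fst p, 0) - u0 (fst p))\<^sup>2) \<partial>lborel)
      = ennreal (R\<^sup>2) * (\<integral>\<^sup>+x\<in>ball 0 R. ennreal ((f k (x, 0) - u0 x)\<^sup>2) \<partial>lborel)" by simp
    also have "\<dots> \<le> ennreal (R\<^sup>2) * (\<integral>\<^sup>+x. ennreal ((f k (x, 0) - u0 x)\<^sup>2) \<partial>lborel)"
      by (intro mult_left_mono nn_integral_mono) (auto simp: indicator_def)
    finally show ?thesis by simp
  qed
  have "(\<lambda>k. ennreal (R\<^sup>2) * (\<integral>\<^sup>+x. ennreal ((f k (x, 0) - u0 x)\<^sup>2) \<partial>lborel)) \<longlonglongrightarrow> 0"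
    using tendsto_mult_ennreal[OF tendsto_const lim, of "ennreal (R\<^sup>2)"] by simp
  from tendsto_0_le_ennreal[OF this le]
  show "\<exists>f. (\<forall>k. smooth_fun (f k)) \<and> H1_tendsto (wt_time a) (Qplus R) f (\<lambda>z. U0 (fst z)) \<and>
      (\<lambda>k. \<integral>\<^sup>+p\<in>ball 0 R \<times> {0<..<R\<^sup>2}. ennreal ((f k ((fst p, 0), snd p) - u0 (fst p))\<^sup>2) \<partial>lborel) \<longlonglongrightarrow> 0"
    using H1_tendsto_const_time[OF f] smooth_fun_const_time(1)[OF f(1)]
    by (intro exI[of _ "\<lambda>k z. f k (fst z)"] conjI allI)
qed

text \<open>The time derivative vanishes, the energy does not depend on time, and the weight \<open>e\<^bsup>-t/\<epsilon>\<^esup>/\<epsilon>\<close> has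
  total mass one.\<close>

lemma FF_const_time_le:
  assumes adm: "admissible_beta \<beta>" and \<epsilon>: "\<epsilon> > 0"
  shows "FF a \<beta> \<epsilon> (\<lambda>z. U0 (fst z)) \<le>
    (\<integral>\<^sup>+X. ennreal (wt a X * (norm (G X))\<^sup>2) \<partial>lborel) + emeasure lborel {x. space_trace_y0 a U0 x > 0}"
    (is "_ \<le> ?C")
proof -
  let ?V = "\<lambda>z::'n spacetime. U0 (fst z)" and ?u = "space_trace_y0 a U0"
  have tr: "has_space_trace_y0 a U0 ?u" by (rule has_space_trace_y0_space_trace[OF a U0])
  have um: "?u \<in> borel_measurable borel" using tr unfolding has_space_trace_y0_def by simp
  have grad: "AE z in lborel. z \<in> later \<longrightarrow> weak_grad later ?V z = (G (fst z), 0)"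
    by (rule is_weak_grad_unique[OF open_later UU_is_weak_grad[OF UU_const_time] is_weak_grad_const_time[OF G(1)]])
  have trace: "AE p in lborel. p \<in> later \<longrightarrow> trace_y0 a ?V p = ?u (fst p)"
    by (rule has_trace_y0_unique[OF a has_trace_y0_trace[OF a UU_const_time] has_trace_y0_const_time[OF tr]])
  have "AE t in lborel. ennreal (exp (- t / \<epsilon>) / \<epsilon>) * (ennreal \<epsilon> * dissipation a ?V t + energy a \<beta> ?V t) * indicator {0<..} t
    \<le> ennreal (exp (- t / \<epsilon>) / \<epsilon>) * indicator {0..} t * ?C"
    using AE_lborel_snd[OF grad] AE_lborel_snd[OF trace]
  proof eventually_elim
    case (elim t)
    show ?case
    proof (cases "t > 0")
      case t: True
      have "dissipation a ?V t = (\<integral>\<^sup>+X. 0 \<partial>(lborel :: 'n space measure))"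
        unfolding dissipation_def
      proof (rule nn_integral_cong_AE)
        show "AE X in lborel. ennreal (wt a X * (time_deriv ?V (X, t))\<^sup>2) = 0"
          using elim(1) by eventually_elim (use t in \<open>simp add: time_deriv_def\<close>)
      qed
      moreover have "gradient_energy a ?V t = (\<integral>\<^sup>+X. ennreal (wt a X * (norm (G X))\<^sup>2) \<partial>lborel)"
        unfolding gradient_energy_def
      proof (rule nn_integral_cong_AE)
        show "AE X in lborel. ennreal (wt a X * (norm (space_grad ?V (X, t)))\<^sup>2) = ennreal (wt a X * (norm (G X))\<^sup>2)"
          using elim(1) by eventually_elim (use t in \<open>simp add: space_grad_def\<close>)
      qed
      moreover have "trace_energy a \<beta> ?V t \<le> (\<integral>\<^sup>+x. indicator {x. ?u x > 0} x \<partial>lborel)"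
        unfolding trace_energy_def
      proof (rule nn_integral_mono_AE)
        show "AE x in lborel. ennreal (Phi \<beta> (trace_y0 a ?V (x, t))) \<le> indicator {x. ?u x > 0} x"
          using elim(2)
        proof eventually_elim
          case (elim x)
          then show ?case
            using t Phi_bounds[OF adm, of "?u x"] by (cases "?u x > 0") auto
        qed
      qed
      moreover have "(\<integral>\<^sup>+x. indicator {x. ?u x > 0} x \<partial>lborel) = emeasure lborel {x. ?u x > 0}"
        using um by (intro nn_integral_indicator) measurable
      ultimately have "ennreal \<epsilon> * dissipation a ?V t + energy a \<beta> ?V t \<le> ?C"
        unfolding energy_def by (simp add: add_left_mono)
      then show ?thesis using t by (simp add: mult_left_mono)
    qed simp
  qed
  then have "FF a \<beta> \<epsilon> ?V \<le> (\<integral>\<^sup>+t. ennreal (exp (- t / \<epsilon>) / \<epsilon>) * indicator {0..} t * ?C \<partial>lborel)"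
    unfolding FF_eq[OF UU_const_time \<epsilon>] by (rule nn_integral_mono_AE)
  also have "\<dots> = (\<integral>\<^sup>+t. ennreal (exp (- t / \<epsilon>) / \<epsilon>) * indicator {0..} t \<partial>lborel) * ?C"
    by (rule nn_integral_multc) measurable
  also have "(\<integral>\<^sup>+t. ennreal (exp (- t / \<epsilon>) / \<epsilon>) * indicator {0..} t \<partial>lborel) = ennreal (0 - (- exp (- 0 / \<epsilon>)))"
  proof (rule nn_integral_FTC_atLeast)
    show "((\<lambda>t. - exp (- t / \<epsilon>)) has_real_derivative exp (- t / \<epsilon>) / \<epsilon>) (at t)" for t
      using \<epsilon> by (auto intro!: derivative_eq_intros)
    show "((\<lambda>t. - exp (- t / \<epsilon>)) \<longlongrightarrow> 0) at_top"
      using \<epsilon> by real_asymp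
  qed (use \<epsilon> in auto)
  finally show ?thesis by simp
qed

end

section \<open>The uniform estimates for minimizers\<close>

theorem proposition2p6:
  fixes a :: real and U0 :: "'n::finite space \<Rightarrow> real"
  assumes "-1 < a" and "a < 1" and "U0 \<in> TT0 a"
  shows "\<exists>C>0. \<forall>\<beta>. admissible_beta \<beta> \<longrightarrow>
    (\<forall>U :: real \<Rightarrow> 'n spacetime \<Rightarrow> real.
      (\<forall>\<epsilon>\<in>{0<..<1}. is_minimizer a \<beta> U0 \<epsilon> (U \<epsilon>)) \<longrightarrow>
      (\<forall>\<epsilon>\<in>{0<..<1}.
        (\<integral>\<^sup>+\<tau>\<in>{0<..}. (\<integral>\<^sup>+X. ennreal (wt a X * (time_deriv (U \<epsilon>) (X, \<tau>))\<^sup>2) \<partial>lborel) \<partial>lborel)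
          \<le> ennreal C \<and>
        (\<forall>R\<ge>\<epsilon>.
          (\<integral>\<^sup>+\<tau>\<in>{0<..<R}. (\<integral>\<^sup>+X. ennreal (wt a X * (norm (space_grad (U \<epsilon>) (X, \<tau>)))\<^sup>2) \<partial>lborel) \<partial>lborel)
          + (\<integral>\<^sup>+\<tau>\<in>{0<..<R}. (\<integral>\<^sup>+x. ennreal (Phi \<beta> (trace_y0 a (U \<epsilon>) (x, \<tau>))) \<partial>lborel) \<partial>lborel)
          \<le> ennreal (C * R))))"
proof -
  have U0: "U0 \<in> H1 (wt a) UNIV" and fin: "emeasure lborel {x. space_trace_y0 a U0 x > 0} < \<infinity>"
    using assms(3) unfolding TT0_def by auto
  obtain G where G: "is_weak_grad UNIV U0 G" "(\<lambda>X. norm (G X)) \<in> L2w (wt a) UNIV"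
    using U0 unfolding H1_def by blast
  interpret stationary a U0 G by unfold_locales (fact assms(1,2) U0 G)+
  define C0 where "C0 = (\<integral>\<^sup>+X. ennreal (wt a X * (norm (G X))\<^sup>2) \<partial>lborel) + emeasure lborel {x. space_trace_y0 a U0 x > 0}"
  have "C0 < \<infinity>" using G(2) fin by (simp add: C0_def L2w_def)
  then obtain c where c: "0 \<le> c" "C0 = ennreal c" by (cases C0 rule: ennreal_cases) auto
  \<comment> \<open>The summand \<open>1\<close> makes \<open>C\<close> positive even if \<open>c = 0\<close>.\<close>
  define C where "C = (exp 2 + 1) * c + 1"
  have "0 \<le> exp 2 * c" using c(1) by simp
  moreover have "C = exp 2 * c + c + 1" by (simp add: C_def distrib_right)
  ultimately have C: "0 < C" "c \<le> C" using c(1) by linarith+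
  show ?thesis
  proof (intro exI[of _ C] conjI allI impI ballI C(1))
    fix \<beta> and \<epsilon> :: real and U :: "real \<Rightarrow> 'n spacetime \<Rightarrow> real"
    assume adm: "admissible_beta \<beta>" and min: "\<forall>\<epsilon>\<in>{0<..<1}. is_minimizer a \<beta> U0 \<epsilon> (U \<epsilon>)"
      and eps: "\<epsilon> \<in> {0<..<1}"
    have \<epsilon>: "\<epsilon> > 0" using eps by simp
    define u where "u = U \<epsilon>"
    have u: "u \<in> UU0 a U0" and u_min: "\<And>V. V \<in> UU0 a U0 \<Longrightarrow> FF a \<beta> \<epsilon> u \<le> FF a \<beta> \<epsilon> V"
      using min eps unfolding is_minimizer_def u_def by blast+
    have uU: "u \<in> UU a" using u unfolding UU0_def by blast
    define D where "D t = dissipation a u t * indicator {0<..} t" for t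
    define E where "E t = energy a \<beta> u t * indicator {0<..} t" for t
    have FF_DE: "FF a \<beta> \<epsilon> u = (\<integral>\<^sup>+s. ennreal (exp (- s / \<epsilon>) / \<epsilon>) * (ennreal \<epsilon> * D s + E s) \<partial>lborel)"
      unfolding FF_eq[OF uU \<epsilon>] D_def E_def by (intro nn_integral_cong) (simp add: indicator_def)
    interpret minimal_energy D E \<epsilon> c
    proof
      show "D \<in> borel_measurable borel" "E \<in> borel_measurable borel"
        unfolding D_def[abs_def] E_def[abs_def]
        using dissipation_measurable[OF uU] energy_measurable[OF assms(1,2) uU adm] by auto
      show "D s = 0" "E s = 0" if "s \<le> 0" for s using that by (simp_all add: D_def E_def)
      show "0 < \<epsilon>" "0 \<le> c" by (fact \<epsilon> c(1))+
      show "(\<integral>\<^sup>+s. ennreal (exp (- s / \<epsilon>) / \<epsilon>) * (ennreal \<epsilon> * D s + E s) \<partial>lborel) \<le> ennreal c"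
        using order_trans[OF u_min[OF UU0_const_time] FF_const_time_le[OF adm \<epsilon>]]
        unfolding FF_DE C0_def[symmetric] c(2) .
      fix \<psi> \<psi>' assume tc: "time_change \<psi> \<psi>'"
      then interpret time_change \<psi> \<psi>' .
      have "FF a \<beta> \<epsilon> (\<lambda>z. u (fst z, \<phi> (snd z))) = (\<integral>\<^sup>+s. ennreal (exp (- \<psi> s / \<epsilon>) / \<epsilon>) *
        (ennreal (\<epsilon> / \<psi>' s) * D s + ennreal (\<psi>' s) * E s) \<partial>lborel)"
        unfolding FF_reparam[OF assms(1,2) uU adm \<epsilon>] D_def E_def
        by (intro nn_integral_cong) (simp add: indicator_def)
      then show "(\<integral>\<^sup>+s. ennreal (exp (- s / \<epsilon>) / \<epsilon>) * (ennreal \<epsilon> * D s + E s) \<partial>lborel)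
        \<le> (\<integral>\<^sup>+s. ennreal (exp (- \<psi> s / \<epsilon>) / \<epsilon>) * (ennreal (\<epsilon> / \<psi>' s) * D s + ennreal (\<psi>' s) * E s) \<partial>lborel)"
        using u_min[OF UU0_reparam[OF u]] unfolding FF_DE by simp
    qed
    have "(\<integral>\<^sup>+s. D s \<partial>lborel) \<le> ennreal C"
      using dissipation_bound C(2) by (meson ennreal_leI order_trans)
    then show "(\<integral>\<^sup>+\<tau>\<in>{0<..}. (\<integral>\<^sup>+X. ennreal (wt a X * (time_deriv (U \<epsilon>) (X, \<tau>))\<^sup>2) \<partial>lborel) \<partial>lborel) \<le> ennreal C"
      unfolding D_def dissipation_def u_def .
    fix R assume R: "\<epsilon> \<le> R"
    have restrict: "(\<integral>\<^sup>+\<tau>\<in>{0<..<R}. F \<tau> \<partial>lborel)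
      = (\<integral>\<^sup>+\<tau>. F \<tau> * indicator {0<..} \<tau> * indicator {0<..<R} \<tau> \<partial>lborel)" for F :: "real \<Rightarrow> ennreal"
      by (intro nn_integral_cong) (simp add: indicator_def)
    have "(\<integral>\<^sup>+\<tau>\<in>{0<..<R}. gradient_energy a u \<tau> \<partial>lborel) + (\<integral>\<^sup>+\<tau>\<in>{0<..<R}. trace_energy a \<beta> u \<tau> \<partial>lborel)
      = (\<integral>\<^sup>+\<tau>. gradient_energy a u \<tau> * indicator {0<..} \<tau> * indicator {0<..<R} \<tau>
          + trace_energy a \<beta> u \<tau> * indicator {0<..} \<tau> * indicator {0<..<R} \<tau> \<partial>lborel)"
      unfolding restrict[of "gradient_energy a u"] restrict[of "trace_energy a \<beta> u"]
      using gradient_energy_measurable[OF uU] trace_energy_measurable[OF assms(1,2) uU adm]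
      by (intro nn_integral_add[symmetric]) (auto intro!: borel_measurable_times_ennreal)
    also have "\<dots> = (\<integral>\<^sup>+s\<in>{0<..<R}. E s \<partial>lborel)"
      by (intro nn_integral_cong) (simp add: E_def energy_def distrib_right)
    also have "\<dots> \<le> ennreal ((exp 2 + 1) * c * R)" by (rule energy_bound[OF R])
    also have "\<dots> \<le> ennreal (C * R)"
      using R \<epsilon> by (intro ennreal_leI mult_right_mono) (auto simp: C_def)
    finally show "(\<integral>\<^sup>+\<tau>\<in>{0<..<R}. (\<integral>\<^sup>+X. ennreal (wt a X * (norm (space_grad (U \<epsilon>) (X, \<tau>)))\<^sup>2) \<partial>lborel) \<partial>lborel)
      + (\<integral>\<^sup>+\<tau>\<in>{0<..<R}. (\<integral>\<^sup>+x. ennreal (Phi \<beta> (trace_y0 a (U \<epsilon>) (x, \<tau>))) \<partial>lborel) \<partial>lborel) \<le> ennreal (C * R)"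
      unfolding gradient_energy_def trace_energy_def u_def .
  qed
qed

end
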